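(* Let $G$ and $H$ be finitely presented groups with $G$ quasi isometric to $H$. Then $G$ has decidable domino problem if and only if $H$ does.
   Context: For a finite set $A$ and a group $G$, $G$ acts on the right on $A^G$ by $(\sigma\cdot h)(g)=\sigma(hg)$. A finite collection $\mathcal F$ of forbidden patterns $\alpha_i:F_i\to A$ (with $F_i\subset G$ finite) defines the subshift of finite type consisting of all $\sigma\in A^G$ such that $(\sigma\cdot g)|_{F_i}\neq\alpha_i$ for all $i$ and all $g\in G$. A finitely generated group $G$ has decidable domino problem if there exists an algorithm which takes as input a finite set of forbidden patterns (together with the finite alphabet $A$) and determines whether the subshift they define is empty. As input to the algorithm, a pattern is encoded as a finite list of pairs (word in a fixed finite symmetric generating set of $G$, letter of $A$), each word standing for the group element it represents; a list assigning different letters to two words representing the same element occurs nowhere and so imposes no restriction. A map $f:X\to Y$ of metric spaces is an $n$-quasi isometric embedding if $\frac{d(x_1,x_2)}{n}-n\le d(f(x_1),f(x_2))\le n\,d(x_1,x_2)+n$ for all $x_1,x_2\in X$, and $n$-quasi surjective if the $n$-neighborhood of $f(X)$ is all of $Y$; it is a quasi isometry if for some $n$ it is both. Finitely generated groups are quasi isometric if their Cayley graphs (with respect to finite generating sets, each edge having length $1$) are quasi isometric. *)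

theory Defs
  imports
    Complex_Main
    "HOL-Algebra.Generated_Groups"
    "HOL-Library.Nat_Bijection"
begin

section \<open>Finitely presented groups\<close>

text \<open>
  The free group of rank \<open>n\<close> is realised on reduced words. A letter \<open>(i, b)\<close> with \<open>i < n\<close> stands
  for the \<open>i\<close>-th free generator if \<open>b\<close> holds, and for its inverse otherwise.
\<close>

type_synonym letter = "nat \<times> bool"

definition letter_inv :: "letter \<Rightarrow> letter" where
  "letter_inv l = (fst l, \<not> snd l)"

definition reduced_word :: "letter list \<Rightarrow> bool" where
  "reduced_word w \<longleftrightarrow> successively (\<lambda>k l. l \<noteq> letter_inv k) w"

fun push_letter :: "letter \<Rightarrow> letter list \<Rightarrow> letter list" where
  "push_letter k [] = [k]"
| "push_letter k (l # w) = (if l = letter_inv k then w else k # l # w)"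

definition free_group :: "nat \<Rightarrow> letter list monoid" where
  "free_group n =
     \<lparr>carrier = {w \<in> lists ({..<n} \<times> UNIV). reduced_word w},
      mult = (\<lambda>v w. foldr push_letter v w),
      one = []\<rparr>"

definition normal_closure :: "('a, 'm) monoid_scheme \<Rightarrow> 'a set \<Rightarrow> 'a set" where
  "normal_closure G R = \<Inter> {N. N \<lhd> G \<and> R \<subseteq> N}"

definition presented_group :: "nat \<Rightarrow> letter list set \<Rightarrow> letter list set monoid" where
  "presented_group n R = free_group n Mod normal_closure (free_group n) R"

definition finitely_presented :: "('a, 'm) monoid_scheme \<Rightarrow> bool" where
  "finitely_presented G \<longleftrightarrow>
     (\<exists>n R. finite R \<and> R \<subseteq> carrier (free_group n) \<and> G \<cong> presented_group n R)"


section \<open>Cayley graphs and quasi isometries\<close>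

text \<open>
  A graph with vertex set \<open>V\<close> and symmetric edge relation \<open>E\<close> is realised geometrically by
  barycentric coordinates: the point at distance \<open>t\<close> from \<open>u\<close> on the edge from \<open>u\<close> to \<open>v\<close> is the
  function with value \<open>1 - t\<close> at \<open>u\<close> and \<open>t\<close> at \<open>v\<close>. Each edge is thus a copy of the unit interval
  (loops collapse to their vertex), and the distance of two points is the infimum of the
  lengths of the piecewise linear paths between them.
\<close>

definition edge_point :: "'v \<Rightarrow> 'v \<Rightarrow> real \<Rightarrow> 'v \<Rightarrow> real" where
  "edge_point u v t = (\<lambda>x. (1 - t) * of_bool (x = u) + t * of_bool (x = v))"

definition realization :: "'v set \<Rightarrow> ('v \<times> 'v) set \<Rightarrow> ('v \<Rightarrow> real) set" where
  "realization V E =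
     {edge_point u v t | u v t. u \<in> V \<and> v \<in> V \<and> (u = v \<or> (u, v) \<in> E) \<and> 0 \<le> t \<and> t \<le> 1}"

inductive path_of_length ::
  "('v \<times> 'v) set \<Rightarrow> ('v \<Rightarrow> real) \<Rightarrow> ('v \<Rightarrow> real) \<Rightarrow> real \<Rightarrow> bool" for E where
  trivial: "path_of_length E p p 0"
| segment: "\<lbrakk>path_of_length E p (edge_point u v t) l; (u, v) \<in> E;
             0 \<le> t; t \<le> 1; 0 \<le> r; r \<le> 1\<rbrakk>
            \<Longrightarrow> path_of_length E p (edge_point u v r) (l + \<bar>t - r\<bar>)"

definition path_dist :: "('v \<times> 'v) set \<Rightarrow> ('v \<Rightarrow> real) \<Rightarrow> ('v \<Rightarrow> real) \<Rightarrow> real" where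
  "path_dist E p q = Inf {l. path_of_length E p q l}"

definition cayley_edges :: "('a, 'm) monoid_scheme \<Rightarrow> 'a set \<Rightarrow> ('a \<times> 'a) set" where
  "cayley_edges G S =
     {(g, h). g \<in> carrier G \<and> h \<in> carrier G \<and> (\<exists>s\<in>S. h = g \<otimes>\<^bsub>G\<^esub> s \<or> g = h \<otimes>\<^bsub>G\<^esub> s)}"

definition cayley_points :: "('a, 'm) monoid_scheme \<Rightarrow> 'a set \<Rightarrow> ('a \<Rightarrow> real) set" where
  "cayley_points G S = realization (carrier G) (cayley_edges G S)"

definition cayley_dist ::
  "('a, 'm) monoid_scheme \<Rightarrow> 'a set \<Rightarrow> ('a \<Rightarrow> real) \<Rightarrow> ('a \<Rightarrow> real) \<Rightarrow> real" where
  "cayley_dist G S = path_dist (cayley_edges G S)"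

definition generating_set :: "('a, 'm) monoid_scheme \<Rightarrow> 'a set \<Rightarrow> bool" where
  "generating_set G S \<longleftrightarrow> S \<subseteq> carrier G \<and> generate G S = carrier G"

definition quasi_isometric_embedding ::
  "nat \<Rightarrow> 'x set \<Rightarrow> ('x \<Rightarrow> 'x \<Rightarrow> real) \<Rightarrow> 'y set \<Rightarrow> ('y \<Rightarrow> 'y \<Rightarrow> real) \<Rightarrow> ('x \<Rightarrow> 'y) \<Rightarrow> bool" where
  "quasi_isometric_embedding n X dX Y dY f \<longleftrightarrow>
     f \<in> X \<rightarrow> Y \<and>
     (\<forall>x1\<in>X. \<forall>x2\<in>X. dX x1 x2 / n - n \<le> dY (f x1) (f x2) \<and>
                    dY (f x1) (f x2) \<le> n * dX x1 x2 + n)"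

definition quasi_surjective ::
  "nat \<Rightarrow> 'x set \<Rightarrow> 'y set \<Rightarrow> ('y \<Rightarrow> 'y \<Rightarrow> real) \<Rightarrow> ('x \<Rightarrow> 'y) \<Rightarrow> bool" where
  "quasi_surjective n X Y dY f \<longleftrightarrow> (\<forall>y\<in>Y. \<exists>x\<in>X. dY (f x) y \<le> n)"

definition quasi_isometry ::
  "'x set \<Rightarrow> ('x \<Rightarrow> 'x \<Rightarrow> real) \<Rightarrow> 'y set \<Rightarrow> ('y \<Rightarrow> 'y \<Rightarrow> real) \<Rightarrow> ('x \<Rightarrow> 'y) \<Rightarrow> bool" where
  "quasi_isometry X dX Y dY f \<longleftrightarrow>
     (\<exists>n\<ge>1. quasi_isometric_embedding n X dX Y dY f \<and> quasi_surjective n X Y dY f)"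

definition quasi_isometric_groups ::
  "('a, 'm) monoid_scheme \<Rightarrow> ('b, 'k) monoid_scheme \<Rightarrow> bool" where
  "quasi_isometric_groups G H \<longleftrightarrow>
     (\<exists>S T f. finite S \<and> generating_set G S \<and> finite T \<and> generating_set H T \<and>
        quasi_isometry (cayley_points G S) (cayley_dist G S)
                       (cayley_points H T) (cayley_dist H T) f)"


section \<open>Recursive functions\<close>

text \<open>
  Algorithms are total recursive functions in the sense of Kleene: the least class of functions
  containing the basic ones and closed under composition, primitive recursion and minimisation
  of regular functions. \<open>recursive k f\<close> concerns the values of \<open>f\<close> on lists of length \<open>k\<close>.
\<close>

inductive recursive :: "nat \<Rightarrow> (nat list \<Rightarrow> nat) \<Rightarrow> bool" where
  zero: "recursive k (\<lambda>xs. 0)"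
| succ: "recursive 1 (\<lambda>xs. Suc (xs ! 0))"
| proj: "i < k \<Longrightarrow> recursive k (\<lambda>xs. xs ! i)"
| comp: "\<lbrakk>recursive (length fs) g; \<forall>f\<in>set fs. recursive k f\<rbrakk>
         \<Longrightarrow> recursive k (\<lambda>xs. g (map (\<lambda>f. f xs) fs))"
| prim_rec: "\<lbrakk>recursive k f; recursive (Suc (Suc k)) g\<rbrakk>
         \<Longrightarrow> recursive (Suc k) (\<lambda>xs. rec_nat (f (tl xs)) (\<lambda>m r. g (m # r # tl xs)) (hd xs))"
| minimize: "\<lbrakk>recursive (Suc k) f; \<forall>xs. length xs = k \<longrightarrow> (\<exists>m. f (m # xs) = 0)\<rbrakk>
         \<Longrightarrow> recursive k (\<lambda>xs. LEAST m. f (m # xs) = 0)"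


section \<open>The domino problem\<close>

definition shift :: "('a, 'm) monoid_scheme \<Rightarrow> ('a \<Rightarrow> 'c) \<Rightarrow> 'a \<Rightarrow> 'a \<Rightarrow> 'c" where
  "shift G \<sigma> h = (\<lambda>g\<in>carrier G. \<sigma> (h \<otimes>\<^bsub>G\<^esub> g))"

text \<open>A pattern is a partial map; its domain is the finite set on which it is defined.\<close>

definition subshift ::
  "('a, 'm) monoid_scheme \<Rightarrow> 'c set \<Rightarrow> ('a \<rightharpoonup> 'c) set \<Rightarrow> ('a \<Rightarrow> 'c) set" where
  "subshift G A \<F> =
     {\<sigma> \<in> carrier G \<rightarrow>\<^sub>E A.
        \<forall>\<alpha>\<in>\<F>. \<forall>g\<in>carrier G. \<not> (\<forall>x\<in>dom \<alpha>. Some (shift G \<sigma> g x) = \<alpha> x)}"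

text \<open>
  The generators are enumerated by a list \<open>s\<close>; a word is the list of the indices of its letters.
  The alphabet of size \<open>a\<close> is \<open>{..<a}\<close>.
\<close>

type_synonym coded_pattern = "(nat list \<times> nat) list"

definition word_value :: "('a, 'm) monoid_scheme \<Rightarrow> 'a list \<Rightarrow> nat list \<Rightarrow> 'a" where
  "word_value G s w = foldr (\<lambda>i g. (s ! i) \<otimes>\<^bsub>G\<^esub> g) w \<one>\<^bsub>G\<^esub>"

text \<open>
  A list assigning different letters to words of equal value is not the graph of any partial map,
  and hence contributes no forbidden pattern.
\<close>

definition decoded_patterns ::
  "('a, 'm) monoid_scheme \<Rightarrow> 'a list \<Rightarrow> coded_pattern list \<Rightarrow> ('a \<rightharpoonup> nat) set" where
  "decoded_patterns G s ps =
     {\<alpha>. \<exists>p\<in>set ps. Map.graph \<alpha> = (\<lambda>(w, c). (word_value G s w, c)) ` set p}"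

text \<open>Instances are pairs of an alphabet size and a list of coded patterns over \<open>k\<close> generators.\<close>

definition domino_instances :: "nat \<Rightarrow> (nat \<times> coded_pattern list) set" where
  "domino_instances k =
     {(a, ps). \<forall>p\<in>set ps. \<forall>(w, c)\<in>set p. set w \<subseteq> {..<k} \<and> c < a}"

definition domino_code :: "nat \<times> coded_pattern list \<Rightarrow> nat" where
  "domino_code = (\<lambda>(a, ps). prod_encode
     (a, list_encode (map (\<lambda>p. list_encode (map (\<lambda>(w, c). prod_encode (list_encode w, c)) p)) ps)))"

definition decidable_domino_problem_wrt :: "('a, 'm) monoid_scheme \<Rightarrow> 'a list \<Rightarrow> bool" where
  "decidable_domino_problem_wrt G s \<longleftrightarrow>
     (\<exists>h. recursive 1 h \<and>
        (\<forall>(a, ps) \<in> domino_instances (length s).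
           h [domino_code (a, ps)] = (if subshift G {..<a} (decoded_patterns G s ps) = {} then 1 else 0)))"

definition decidable_domino_problem :: "('a, 'm) monoid_scheme \<Rightarrow> bool" where
  "decidable_domino_problem G \<longleftrightarrow>
     (\<exists>s. generating_set G (set s) \<and> (\<forall>x\<in>set s. inv\<^bsub>G\<^esub> x \<in> set s) \<and>
          decidable_domino_problem_wrt G s)"

end

theory Submission
  imports Defs
begin

text \<open>
  Let \<open>F\<close> be a quasi isometry from \<open>H\<close> to \<open>G\<close>. Its fibres are bounded, so the elements of \<open>H\<close> become
  distinct pairs \<open>(g, i)\<close> of a position in \<open>G\<close> and one of \<open>k\<close> slots, and multiplication with a generator
  of \<open>H\<close> changes the position by one of finitely many displacements. A symbol at \<open>g\<close> records which slots
  are active, where each generator leads from them, and a letter for every slot. That active slots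
  lead to active slots, that the relators of \<open>H\<close> act trivially and that active slots are coarsely
  dense are local conditions, as is the absence of a given pattern of letters along the walks of the
  generators. They define a subshift of finite type on \<open>G\<close>, computable from the one on \<open>H\<close>.
  A configuration of \<open>H\<close> is transported to \<open>G\<close> by \<open>F\<close>. Conversely, because \<open>H\<close> is finitely
  presented, the conditions make \<open>H\<close> act on the active slots of a configuration of \<open>G\<close>, and the letters
  along any orbit form a configuration of \<open>H\<close>. No quasi isometry has to be recovered from the
  configuration of \<open>G\<close>. Hence decidability passes from \<open>G\<close> to \<open>H\<close>, and coarse inverses give the other
  direction.
\<close>


section \<open>Computable functions\<close>

text \<open>The reduction must be recursive, yet nothing computable is assumed about multiplication
  in \<open>G\<close>. It therefore never evaluates a word: positions on a walk are kept as
  concatenated displacement words, all symbols along the walk are guessed, and guesses contradicting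
  each other at one group element are harmless because such patterns occur nowhere. Whether a walk
  along a relator closes up in \<open>G\<close> does need evaluation, but this condition concerns
  only base symbols, whose number does not depend on the instance; it is turned once and for all
  into a constant finite list \<open>P0\<close>. Finitely many relators make \<open>P0\<close>
  finite. An instance contributes only the digits storing letters and the pulled back patterns.
  Since only nonemptiness is compared, decoding may lose information: the action on active slots
  need not be free, and a nontrivial stabilizer merely repeats letters. Quasi isometries are
  replaced by coarse equivalences, phrased with finite sets of group elements, so that the
  generating lists of the domino problems are independent of the generating sets in the quasi
  isometry.\<close>

definition recursive_on :: "nat \<Rightarrow> (nat list \<Rightarrow> nat) \<Rightarrow> bool" where
  "recursive_on k f \<longleftrightarrow> (\<exists>h. recursive k h \<and> (\<forall>xs. length xs = k \<longrightarrow> h xs = f xs))"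

lemma recursive_onI: "recursive k f \<Longrightarrow> recursive_on k f"
  by (auto simp: recursive_on_def)

text \<open>\<open>recursive\<close> speaks of one particular function, whose values on lists of
  other lengths are artefacts of the construction. Ignoring those values allows a function to be
  rewritten for the relevant length.\<close>

lemma recursive_on_cong:
  assumes "recursive_on k f" "\<And>xs. length xs = k \<Longrightarrow> f xs = g xs"
  shows "recursive_on k g"
  using assms by (auto simp: recursive_on_def)

lemma recursive_on_proj: "i < k \<Longrightarrow> recursive_on k (\<lambda>xs. xs ! i)"
  by (intro recursive_onI recursive.proj)

lemma recursive_on_comp:
  assumes "recursive_on (length fs) g" "\<forall>f\<in>set fs. recursive_on k f"
  shows "recursive_on k (\<lambda>xs. g (map (\<lambda>f. f xs) fs))"
proof -
  obtain g' where g': "recursive (length fs) g'" "\<And>xs. length xs = length fs \<Longrightarrow> g' xs = g xs"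
    using assms(1) by (auto simp: recursive_on_def)
  obtain F where F: "\<And>f. f \<in> set fs \<Longrightarrow> recursive k (F f)"
      "\<And>f xs. f \<in> set fs \<Longrightarrow> length xs = k \<Longrightarrow> F f xs = f xs"
    using assms(2) unfolding recursive_on_def by metis
  have "recursive k (\<lambda>xs. g' (map (\<lambda>f. f xs) (map F fs)))"
    using g'(1) F(1) by (intro recursive.comp) auto
  moreover have "g' (map (\<lambda>f. f xs) (map F fs)) = g (map (\<lambda>f. f xs) fs)" if "length xs = k" for xs
    using that F(2) g'(2) by (simp add: comp_def cong: map_cong)
  ultimately show ?thesis
    by (auto simp: recursive_on_def)
qed

lemma recursive_on_comp1:
  "recursive_on 1 g \<Longrightarrow> recursive_on k f \<Longrightarrow> recursive_on k (\<lambda>xs. g [f xs])"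
  using recursive_on_comp[of "[f]" g k] by simp

lemma recursive_on_comp2:
  "recursive_on 2 g \<Longrightarrow> recursive_on k f1 \<Longrightarrow> recursive_on k f2 \<Longrightarrow>
    recursive_on k (\<lambda>xs. g [f1 xs, f2 xs])"
  using recursive_on_comp[of "[f1, f2]" g k] by (simp add: numeral_2_eq_2)

lemma recursive_on_comp3:
  "recursive_on 3 g \<Longrightarrow> recursive_on k f1 \<Longrightarrow> recursive_on k f2 \<Longrightarrow> recursive_on k f3 \<Longrightarrow>
    recursive_on k (\<lambda>xs. g [f1 xs, f2 xs, f3 xs])"
  using recursive_on_comp[of "[f1, f2, f3]" g k] by (simp add: numeral_3_eq_3)

lemma recursive_on_prim_rec:
  assumes "recursive_on k f" "recursive_on (Suc (Suc k)) g"
  shows "recursive_on (Suc k) (\<lambda>xs. rec_nat (f (tl xs)) (\<lambda>m r. g (m # r # tl xs)) (hd xs))"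
proof -
  obtain f' where f': "recursive k f'" "\<And>xs. length xs = k \<Longrightarrow> f' xs = f xs"
    using assms(1) by (auto simp: recursive_on_def)
  obtain g' where g': "recursive (Suc (Suc k)) g'" "\<And>xs. length xs = Suc (Suc k) \<Longrightarrow> g' xs = g xs"
    using assms(2) by (auto simp: recursive_on_def)
  show ?thesis
    unfolding recursive_on_def
    by (intro exI[of _ "\<lambda>xs. rec_nat (f' (tl xs)) (\<lambda>m r. g' (m # r # tl xs)) (hd xs)"] conjI
          recursive.prim_rec f'(1) g'(1)) (simp add: f'(2) g'(2))
qed

lemma recursive_on_minimize:
  assumes "recursive_on (Suc k) f" "\<And>xs. length xs = k \<Longrightarrow> \<exists>m. f (m # xs) = 0"
  shows "recursive_on k (\<lambda>xs. LEAST m. f (m # xs) = 0)"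
proof -
  obtain f' where f': "recursive (Suc k) f'" "\<And>xs. length xs = Suc k \<Longrightarrow> f' xs = f xs"
    using assms(1) by (auto simp: recursive_on_def)
  show ?thesis
    unfolding recursive_on_def
    by (intro exI[of _ "\<lambda>xs. LEAST m. f' (m # xs) = 0"] conjI recursive.minimize)
      (use assms(2) f' in auto)
qed

lemma recursive_on_Suc: "recursive_on k f \<Longrightarrow> recursive_on k (\<lambda>xs. Suc (f xs))"
  using recursive_on_comp1[OF recursive_onI[OF recursive.succ]] by simp

lemma recursive_on_const: "recursive_on k (\<lambda>xs. c)"
  by (induction c) (auto intro: recursive_onI recursive.zero recursive_on_Suc)

lemma recursive_on_iter:
  assumes "recursive_on 1 u"
  shows "recursive_on 2 (\<lambda>xs. ((\<lambda>r. u [r]) ^^ (xs ! 0)) (xs ! 1))"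
proof -
  have "recursive_on (Suc 1) (\<lambda>xs. rec_nat (tl xs ! 0)
      (\<lambda>m r. (\<lambda>ys. u [ys ! 1]) (m # r # tl xs)) (hd xs))"
    by (intro recursive_on_prim_rec recursive_on_proj recursive_on_comp1[OF assms]) auto
  moreover have "rec_nat z (\<lambda>m. f) n = (f ^^ n) z" for f :: "nat \<Rightarrow> nat" and z n
    by (induction n) auto
  ultimately show ?thesis
    unfolding numeral_2_eq_2 One_nat_def
    by (elim recursive_on_cong) (auto simp: length_Suc_conv)
qed

section \<open>Recursive arithmetic, case distinction and the pairing function\<close>

lemma recursive_on_add:
  assumes "recursive_on k f" "recursive_on k g"
  shows "recursive_on k (\<lambda>xs. f xs + g xs)"
proof -
  have "recursive_on 1 (\<lambda>xs. Suc (xs ! 0))"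
    by (intro recursive_on_Suc recursive_on_proj) simp
  note recursive_on_comp2[OF recursive_on_iter[OF this] assms]
  moreover have "(Suc ^^ m) n = m + n" for m n
    by (induction m) auto
  ultimately show ?thesis
    by simp
qed

lemma recursive_on_pred:
  assumes "recursive_on k f"
  shows "recursive_on k (\<lambda>xs. f xs - 1)"
proof -
  have "recursive_on (Suc 0) (\<lambda>xs. rec_nat ((\<lambda>_. 0) (tl xs))
      (\<lambda>m r. (\<lambda>ys. ys ! 0) (m # r # tl xs)) (hd xs))"
    by (intro recursive_on_prim_rec recursive_on_const recursive_on_proj) auto
  then have "recursive_on 1 (\<lambda>xs. xs ! 0 - 1)"
    unfolding One_nat_def
  proof (elim recursive_on_cong)
    fix xs :: "nat list"
    assume "length xs = Suc 0"
    then obtain x where "xs = [x]"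
      by (auto simp: length_Suc_conv)
    then show "rec_nat 0 (\<lambda>m r. (m # r # tl xs) ! 0) (hd xs) = xs ! 0 - Suc 0"
      by (cases x) auto
  qed
  from recursive_on_comp1[OF this assms] show ?thesis
    by simp
qed

lemma recursive_on_diff:
  assumes "recursive_on k f" "recursive_on k g"
  shows "recursive_on k (\<lambda>xs. f xs - g xs)"
proof -
  have "recursive_on 1 (\<lambda>xs. xs ! 0 - 1)"
    by (intro recursive_on_pred recursive_on_proj) simp
  note recursive_on_comp2[OF recursive_on_iter[OF this] assms(2,1)]
  moreover have "((\<lambda>r. r - Suc 0) ^^ m) n = n - m" for m n
    by (induction m) auto
  ultimately show ?thesis
    by simp
qed

lemma recursive_on_if:
  assumes "recursive_on k f" "recursive_on k g" "recursive_on k h"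
  shows "recursive_on k (\<lambda>xs. if f xs = 0 then g xs else h xs)"
proof -
  \<comment> \<open>Primitive recursion on the condition, used only to tell zero from successor: in
    \<open>m # r # tl xs\<close> the entry with index 3 is the third argument, so a nonzero
    condition discards the recursive value.\<close>
  have "recursive_on (Suc 2) (\<lambda>xs. rec_nat ((\<lambda>ys. ys ! 0) (tl xs))
      (\<lambda>m r. (\<lambda>ys. ys ! 3) (m # r # tl xs)) (hd xs))"
    by (intro recursive_on_prim_rec recursive_on_proj) auto
  then have "recursive_on 3 (\<lambda>xs. if xs ! 0 = 0 then xs ! 1 else xs ! 2)"
  proof (simp only: numeral_3_eq_3 numeral_2_eq_2, elim recursive_on_cong)
    fix xs :: "nat list"
    assume "length xs = Suc (Suc (Suc 0))"
    then obtain x y z where "xs = [x, y, z]"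
      by (auto simp: length_Suc_conv)
    then show "rec_nat (tl xs ! 0) (\<lambda>m r. (m # r # tl xs) ! Suc (Suc (Suc 0))) (hd xs) =
        (if xs ! 0 = 0 then xs ! 1 else xs ! Suc (Suc 0))"
      by (cases x) auto
  qed
  from recursive_on_comp3[OF this assms] show ?thesis
    by (simp add: numeral_2_eq_2 cong: if_cong)
qed

lemma recursive_on_triangle:
  assumes "recursive_on k f"
  shows "recursive_on k (\<lambda>xs. triangle (f xs))"
proof -
  have "recursive_on (Suc 0) (\<lambda>xs. rec_nat ((\<lambda>_. 0) (tl xs))
      (\<lambda>m r. (\<lambda>ys. ys ! 1 + Suc (ys ! 0)) (m # r # tl xs)) (hd xs))"
    by (intro recursive_on_prim_rec recursive_on_const recursive_on_add recursive_on_Suc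
          recursive_on_proj) auto
  then have "recursive_on 1 (\<lambda>xs. triangle (xs ! 0))"
    unfolding One_nat_def
  proof (elim recursive_on_cong)
    fix xs :: "nat list"
    assume "length xs = Suc 0"
    then obtain x where "xs = [x]"
      by (auto simp: length_Suc_conv)
    moreover have "rec_nat 0 (\<lambda>m r. Suc (r + m)) x = triangle x"
      by (induction x) auto
    ultimately show "rec_nat 0 (\<lambda>m r. (m # r # tl xs) ! Suc 0 + Suc ((m # r # tl xs) ! 0)) (hd xs) =
        triangle (xs ! 0)"
      by simp
  qed
  from recursive_on_comp1[OF this assms] show ?thesis
    by simp
qed

lemma recursive_on_prod_encode:
  assumes "recursive_on k f" "recursive_on k g"
  shows "recursive_on k (\<lambda>xs. prod_encode (f xs, g xs))"
  unfolding prod_encode_def prod.case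
  by (intro recursive_on_add recursive_on_triangle assms)

lemma triangle_mono: "m \<le> n \<Longrightarrow> triangle m \<le> triangle n"
  unfolding triangle_def by (intro div_le_mono mult_le_mono) auto

text \<open>The diagonal containing \<open>n\<close> is the first one whose successor starts beyond \<open>n\<close>.\<close>

definition diagonal :: "nat \<Rightarrow> nat" where
  "diagonal n = (LEAST s. Suc n - triangle (Suc s) = 0)"

text \<open>The code is \<open>triangle (x + y) + x\<close> with \<open>x \<le> x + y\<close>, hence
  at least \<open>triangle (x + y)\<close> and below \<open>triangle (Suc (x + y))\<close>.\<close>

lemma diagonal_prod_encode: "diagonal (prod_encode (x, y)) = x + y"
  unfolding diagonal_def
proof (rule Least_equality)
  show "Suc (prod_encode (x, y)) - triangle (Suc (x + y)) = 0"
    by (simp add: prod_encode_def)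
next
  fix s
  assume s: "Suc (prod_encode (x, y)) - triangle (Suc s) = 0"
  show "x + y \<le> s"
  proof (rule ccontr)
    assume "\<not> x + y \<le> s"
    then have "triangle (Suc s) \<le> triangle (x + y)"
      by (intro triangle_mono) auto
    with s show False
      by (simp add: prod_encode_def)
  qed
qed

lemma recursive_on_diagonal: 
  assumes "recursive_on k f"
  shows "recursive_on k (\<lambda>xs. diagonal (f xs))"
proof -
  have "recursive_on 1 (\<lambda>xs. LEAST m. (\<lambda>ys. Suc (ys ! 1) - triangle (Suc (ys ! 0))) (m # xs) = 0)"
  proof (intro recursive_on_minimize recursive_on_diff recursive_on_triangle recursive_on_Suc
      recursive_on_proj)
    fix xs :: "nat list"
    show "\<exists>m. Suc ((m # xs) ! 1) - triangle (Suc ((m # xs) ! 0)) = 0"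
      by (intro exI[of _ "xs ! 0"]) simp
  qed auto
  from recursive_on_comp1[OF this assms] show ?thesis
    by (simp add: diagonal_def)
qed

lemma recursive_on_fst:
  assumes "recursive_on k f"
  shows "recursive_on k (\<lambda>xs. fst (prod_decode (f xs)))"
proof -
  have "fst (prod_decode n) = n - triangle (diagonal n)" for n
  proof -
    obtain x y where n: "n = prod_encode (x, y)"
      by (metis prod_decode_inverse surj_pair)
    have "diagonal n = x + y"
      by (simp add: n diagonal_prod_encode)
    then show ?thesis
      by (simp add: n) (simp add: prod_encode_def)
  qed
  then show ?thesis
    by (simp only:) (intro recursive_on_diff recursive_on_triangle recursive_on_diagonal assms)
qed

lemma recursive_on_snd:
  assumes "recursive_on k f"
  shows "recursive_on k (\<lambda>xs. snd (prod_decode (f xs)))"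
proof -
  have "snd (prod_decode n) = diagonal n - fst (prod_decode n)" for n
  proof -
    obtain x y where n: "n = prod_encode (x, y)"
      by (metis prod_decode_inverse surj_pair)
    show ?thesis
      by (simp add: n diagonal_prod_encode)
  qed
  then show ?thesis
    by (simp only:) (intro recursive_on_diff recursive_on_fst recursive_on_diagonal assms)
qed


section \<open>Encoded data types and computable functions between them\<close>

class encodable =
  fixes enc :: "'a \<Rightarrow> nat"
  assumes inj_enc: "inj enc"

lemma enc_eq_iff [simp]: "enc x = enc y \<longleftrightarrow> x = y"
  using inj_enc by (auto dest: injD)

instantiation nat :: encodable
begin
definition "enc (n :: nat) = n"
instance by standard (simp add: enc_nat_def inj_def)
end

instantiation prod :: (encodable, encodable) encodable
begin
definition "enc p = prod_encode (enc (fst p), enc (snd p))"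
instance by standard (auto simp: enc_prod_def inj_def)
end

instantiation list :: (encodable) encodable
begin
definition "enc xs = list_encode (map enc xs)"
instance
  by standard (auto simp: enc_list_def inj_def list_encode_eq dest: map_injective[OF _ inj_enc])
end

lemma enc_list_simps:
  "enc [] = (0 :: nat)" "enc (x # xs) = Suc (prod_encode (enc x, enc xs))"
  by (simp_all add: enc_list_def)

lemma domino_code_eq_enc: "domino_code = enc"
proof
  fix x :: "nat \<times> coded_pattern list"
  show "domino_code x = enc x"
    by (cases x) (simp add: domino_code_def enc_prod_def enc_list_def enc_nat_def
        case_prod_unfold cong: map_cong)
qed

text \<open>The recursive function is constrained on codes only, so it never has to recognise
  whether a number is a code.\<close>

definition computable :: "('a :: encodable \<Rightarrow> 'b :: encodable) \<Rightarrow> bool" where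
  "computable f \<longleftrightarrow> (\<exists>h. recursive_on 1 h \<and> (\<forall>x. h [enc x] = enc (f x)))"

lemma computableI:
  assumes "recursive_on 1 h" "\<And>x. h [enc x] = enc (f x)"
  shows "computable f"
  using assms by (auto simp: computable_def)

lemma computable_recursive:
  assumes "computable f"
  obtains h where "recursive 1 h" "\<And>x. h [enc x] = enc (f x)"
  using assms unfolding computable_def recursive_on_def by auto

lemma computable_id: "computable (\<lambda>x. x)"
  by (rule computableI[OF recursive_on_proj[of 0]]) auto

lemma computable_const: "computable (\<lambda>x. c)"
  by (rule computableI[OF recursive_on_const[of _ "enc c"]]) auto

lemma computable_comp:
  assumes "computable f" "computable g"
  shows "computable (\<lambda>x. f (g x))"
proof -
  obtain hf hg where "recursive_on 1 hf" "\<And>x. hf [enc x] = enc (f x)"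
    "recursive_on 1 hg" "\<And>x. hg [enc x] = enc (g x)"
    using assms by (auto simp: computable_def)
  then show ?thesis
    by (intro computableI[OF recursive_on_comp1[of hf 1 hg]]) auto
qed

lemma computable_enc: "computable f \<Longrightarrow> computable (\<lambda>x. enc (f x))"
  by (rule computable_comp[of enc]) (rule computableI[OF recursive_on_proj[of 0]], auto simp: enc_nat_def)

lemma computable_pair:
  assumes "computable f" "computable g"
  shows "computable (\<lambda>x. (f x, g x))"
proof -
  obtain hf hg where "recursive_on 1 hf" "\<And>x. hf [enc x] = enc (f x)"
    "recursive_on 1 hg" "\<And>x. hg [enc x] = enc (g x)"
    using assms by (auto simp: computable_def)
  then show ?thesis
    by (intro computableI[OF recursive_on_prod_encode[of 1 hf hg]]) (auto simp: enc_prod_def)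
qed

lemma computable_fst: "computable f \<Longrightarrow> computable (\<lambda>x. fst (f x))"
  by (rule computable_comp[of fst], rule computableI[OF recursive_on_fst[OF recursive_on_proj[of 0]]])
    (auto simp: enc_prod_def)

lemma computable_snd: "computable f \<Longrightarrow> computable (\<lambda>x. snd (f x))"
  by (rule computable_comp[of snd], rule computableI[OF recursive_on_snd[OF recursive_on_proj[of 0]]])
    (auto simp: enc_prod_def)

lemma computable_Suc: "computable f \<Longrightarrow> computable (\<lambda>x. Suc (f x))"
  by (rule computable_comp[of Suc],
      rule computableI[OF recursive_on_Suc[OF recursive_on_proj[of 0]]]) (auto simp: enc_nat_def)

lemma computable_if0:
  assumes "computable c" "computable f" "computable g"
  shows "computable (\<lambda>x. if c x = (0 :: nat) then f x else g x)"
proof -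
  obtain hc hf hg where "recursive_on 1 hc" "\<And>x. hc [enc x] = enc (c x)" 
    "recursive_on 1 hf" "\<And>x. hf [enc x] = enc (f x)"
    "recursive_on 1 hg" "\<And>x. hg [enc x] = enc (g x)"
    using assms by (auto simp: computable_def)
  then show ?thesis
    by (intro computableI[OF recursive_on_if[of 1 hc hf hg]]) (auto simp: enc_nat_def)
qed

lemma computable_add:
  assumes "computable f" "computable g"
  shows "computable (\<lambda>x. f x + g x :: nat)"
proof -
  have "recursive_on 1 (\<lambda>xs. fst (prod_decode (xs ! 0)) + snd (prod_decode (xs ! 0)))"
    by (intro recursive_on_add recursive_on_fst recursive_on_snd recursive_on_proj) auto
  then have "computable (\<lambda>p. fst p + snd p :: nat)"
    by (rule computableI) (auto simp: enc_nat_def enc_prod_def)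
  from computable_comp[OF this computable_pair[OF assms]] show ?thesis
    by simp
qed

lemma computable_diff:
  assumes "computable f" "computable g"
  shows "computable (\<lambda>x. f x - g x :: nat)"
proof -
  have "recursive_on 1 (\<lambda>xs. fst (prod_decode (xs ! 0)) - snd (prod_decode (xs ! 0)))"
    by (intro recursive_on_diff recursive_on_fst recursive_on_snd recursive_on_proj) auto
  then have "computable (\<lambda>p. fst p - snd p :: nat)"
    by (rule computableI) (auto simp: enc_nat_def enc_prod_def)
  from computable_comp[OF this computable_pair[OF assms]] show ?thesis
    by simp
qed

lemma computable_iter_closed:
  fixes f :: "'b :: encodable \<Rightarrow> 'b"
  assumes "computable n" "computable z" "computable f"
  shows "computable (\<lambda>x. (f ^^ n x) (z x))"
proof -
  obtain h where h: "recursive_on 1 h" "\<And>x. h [enc x] = enc (f x)"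
    using assms by (auto simp: computable_def)
  obtain hn where hn: "recursive_on 1 hn" "\<And>x. hn [enc x] = enc (n x)"
    using assms by (auto simp: computable_def)
  obtain hz where hz: "recursive_on 1 hz" "\<And>x. hz [enc x] = enc (z x)"
    using assms by (auto simp: computable_def)
  have "((\<lambda>r. h [r]) ^^ m) (enc y) = enc ((f ^^ m) y)" for m y
    by (induction m) (auto simp: h)
  then show ?thesis
    by (intro computableI[OF recursive_on_comp2[OF recursive_on_iter[OF h(1)] hn(1) hz(1)]])
      (simp add: hn hz enc_nat_def)
qed

text \<open>The parameter \<open>x\<close> of the iterated function is carried along in the state.\<close>

lemma computable_iter:
  fixes f :: "'x :: encodable \<Rightarrow> 'b :: encodable \<Rightarrow> 'b"
  assumes "computable n" "computable z" "computable (\<lambda>p. f (fst p) (snd p))"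
  shows "computable (\<lambda>x. (f x ^^ n x) (z x))"
proof -
  define F where "F = (\<lambda>p. (fst p, f (fst p) (snd p)))"
  have "computable (\<lambda>x. snd ((F ^^ n x) (x, z x)))"
    unfolding F_def
    by (intro computable_snd computable_iter_closed computable_pair computable_fst computable_id assms)
  moreover have "(F ^^ m) (x, y) = (x, (f x ^^ m) y)" for m x y
    by (induction m) (auto simp: F_def)
  ultimately show ?thesis
    by simp
qed

lemma computable_mult:
  assumes "computable f" "computable g"
  shows "computable (\<lambda>x. f x * g x :: nat)"
proof -
  have "computable (\<lambda>x. (((\<lambda>x r. g x + r) x) ^^ f x) 0)"
    by (intro computable_iter assms computable_const computable_add computable_comp[OF assms(2)]
          computable_fst computable_snd computable_id)
  moreover have "((\<lambda>r. n + r) ^^ m) 0 = m * n" for m n :: nat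
    by (induction m) auto
  ultimately show ?thesis
    by simp
qed

lemma computable_power:
  assumes "computable f" "computable g"
  shows "computable (\<lambda>x. f x ^ g x :: nat)"
proof -
  have "computable (\<lambda>x. (((\<lambda>x r. f x * r) x) ^^ g x) 1)"
    by (intro computable_iter assms computable_const computable_mult computable_comp[OF assms(1)]
          computable_fst computable_snd computable_id)
  moreover have "((\<lambda>r. n * r) ^^ m) (Suc 0) = n ^ m" for m n :: nat
    by (induction m) auto
  ultimately show ?thesis
    by simp
qed

text \<open>By injectivity of \<open>enc\<close>, equality can be tested on codes; the sum of both
  truncated differences vanishes exactly for equal codes.\<close>

lemma computable_if_eq:
  assumes "computable a" "computable b" "computable f" "computable g"
  shows "computable (\<lambda>x. if a x = b x then f x else g x)"
proof -
  have "computable (\<lambda>x. if (enc (a x) - enc (b x)) + (enc (b x) - enc (a x)) = 0 then f x else g x)"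
    by (intro computable_if0 computable_add computable_diff computable_enc assms)
  moreover have "(enc (a x) - enc (b x)) + (enc (b x) - enc (a x)) = 0 \<longleftrightarrow> a x = b x" for x
    using enc_eq_iff[of "a x" "b x"] by linarith
  ultimately show ?thesis
    by simp
qed

lemma computable_div_mod:
  assumes "computable f" "computable g"
  shows computable_div: "computable (\<lambda>x. f x div g x :: nat)"
    and computable_mod: "computable (\<lambda>x. f x mod g x :: nat)"
proof -
  \<comment> \<open>A counter with the pair of quotient and remainder as its state. For
    \<open>n = 0\<close> the carry never occurs, which yields quotient \<open>0\<close> and
    remainder \<open>m\<close>, in agreement with division by zero in HOL.\<close>
  define S where
    "S = (\<lambda>n (p :: nat \<times> nat). if Suc (snd p) = n then (Suc (fst p), 0) else (fst p, Suc (snd p)))"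
  have c: "computable (\<lambda>x. (((\<lambda>x. S (g x)) x) ^^ f x) (0, 0))"
    unfolding S_def
    by (intro computable_iter assms computable_const computable_if_eq computable_comp[OF assms(2)]
          computable_pair computable_Suc computable_fst computable_snd computable_id)
  have "(S n ^^ m) (0, 0) = (m div n, m mod n)" for m n
    by (induction m) (auto simp: S_def div_Suc mod_Suc)
  with computable_fst[OF c] computable_snd[OF c] show
    "computable (\<lambda>x. f x div g x)" "computable (\<lambda>x. f x mod g x)"
    by simp_all
qed

lemma computable_Cons:
  assumes "computable f" "computable g"
  shows "computable (\<lambda>x. f x # g x)"
proof -
  have "computable (\<lambda>p. fst p # snd p :: 'b list)"
    by (rule computableI[OF recursive_on_Suc[OF recursive_on_proj[of 0]]])
      (auto simp: enc_prod_def enc_list_simps)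
  from computable_comp[OF this computable_pair[OF assms]] show ?thesis
    by simp
qed

lemma computable_tl:
  assumes "computable f"
  shows "computable (\<lambda>x. tl (f x))"
proof -
  \<comment> \<open>The empty list has code \<open>0\<close>, and \<open>0 - 1 = 0\<close>; that
    \<open>0\<close> decodes to second component \<open>0\<close> covers
    \<open>tl [] = []\<close>.\<close>
  have "prod_decode 0 = (0, 0)"
    by (simp add: prod_decode_def prod_decode_aux.simps)
  then have "snd (prod_decode (enc xs - 1)) = enc (tl xs)" for xs :: "'b list"
    by (cases xs) (auto simp: enc_list_simps)
  then have "computable (\<lambda>xs :: 'b list. tl xs)"
    by (intro computableI[OF recursive_on_snd[OF recursive_on_pred[OF recursive_on_proj[of 0]]]]) auto
  from computable_comp[OF this assms] show ?thesis .
qed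

lemma computable_hd:
  assumes "computable f"
  shows "computable (\<lambda>x. hd (f x))"
proof -
  \<comment> \<open>\<open>hd []\<close> is unspecified but one fixed value, so its code can be
    built into the function as a constant.\<close>
  have *: "(if enc xs = 0 then enc (hd [] :: 'b) else fst (prod_decode (enc xs - 1))) = enc (hd xs)"
    for xs :: "'b list"
    by (cases xs) (auto simp: enc_list_simps)
  have "computable (\<lambda>xs :: 'b list. hd xs)"
    by (rule computableI[OF recursive_on_if[OF recursive_on_proj[of 0]
            recursive_on_const[of _ "enc (hd [] :: 'b)"]
            recursive_on_fst[OF recursive_on_pred[OF recursive_on_proj[of 0]]]]])
      (simp_all only: nth_Cons_0 * zero_less_one)
  from computable_comp[OF this assms] show ?thesis .
qed

lemma computable_foldl:
  fixes l :: "'x :: encodable \<Rightarrow> 'a :: encodable list" and z :: "'x \<Rightarrow> 'b :: encodable"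
  assumes "computable l" "computable z" "computable (\<lambda>p. f (fst p) (fst (snd p)) (snd (snd p)))"
  shows "computable (\<lambda>x. foldl (f x) (z x) (l x))"
proof -
  define S where "S = (\<lambda>x (p :: 'b \<times> 'a list). if snd p = [] then p else
    (f x (fst p) (hd (snd p)), tl (snd p)))"
  have f: "computable (\<lambda>x. f (a x) (b x) (c x))"
    if "computable a" "computable b" "computable c" for a b c
    using computable_comp[OF assms(3) computable_pair[OF that(1) computable_pair[OF that(2,3)]]] by simp
  \<comment> \<open>The code of a list bounds its length, and \<open>S\<close> is stationary once
    the list is used up, so iterating that often is enough.\<close>
  have c: "computable (\<lambda>x. (S x ^^ enc (l x)) (z x, l x))"
    unfolding S_def
    by (intro computable_iter assms computable_const computable_if_eq computable_enc computable_hd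
          computable_pair computable_tl computable_fst computable_snd computable_id f)
  have S: "fst ((S x ^^ m) (y, xs)) = foldl (f x) y xs" if "m \<ge> length xs" for m x y xs
    using that
  proof (induction m arbitrary: y xs)
    case (Suc m)
    have "fst ((S x ^^ Suc m) (y, xs)) = fst ((S x ^^ m) (S x (y, xs)))"
      by (simp add: funpow_swap1)
    also have "\<dots> = foldl (f x) y xs"
    proof (cases xs)
      case Nil
      then show ?thesis
        using Suc.IH[of "[]" y] by (simp add: S_def)
    next
      case (Cons a ys)
      then have "S x (y, xs) = (f x y a, ys)"
        by (simp add: S_def)
      then show ?thesis
        using Suc Cons by simp
    qed
    finally show ?case .
  qed auto
  have "length xs \<le> enc xs" for xs :: "'a list"
  proof (induction xs)
    case (Cons x xs)
    then show ?case
      using le_prod_encode_2[of "enc xs" "enc x"] by (simp add: enc_list_simps)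
  qed simp
  with computable_fst[OF c] S show ?thesis
    by simp
qed

lemma computable_rev:
  assumes "computable l"
  shows "computable (\<lambda>x. rev (l x))"
proof -
  have "computable (\<lambda>x. foldl ((\<lambda>x ys y. y # ys) x) [] (l x))"
    by (intro computable_foldl assms computable_const computable_Cons computable_fst computable_snd
          computable_id)
  moreover have "foldl (\<lambda>ys y. y # ys) zs xs = rev xs @ zs" for xs zs :: "'b list"
    by (induction xs arbitrary: zs) auto
  ultimately show ?thesis
    by simp
qed

lemma computable_foldr:
  assumes "computable l" "computable z" "computable (\<lambda>p. f (fst p) (fst (snd p)) (snd (snd p)))"
  shows "computable (\<lambda>x. foldr (f x) (l x) (z x))"
proof -
  have f: "computable (\<lambda>x. f (a x) (b x) (c x))"
    if "computable a" "computable b" "computable c" for a b c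
    using computable_comp[OF assms(3) computable_pair[OF that(1) computable_pair[OF that(2,3)]]] by simp
  have "computable (\<lambda>x. foldl ((\<lambda>x b a. f x a b) x) (z x) (rev (l x)))"
    by (intro computable_foldl assms computable_rev f computable_fst computable_snd computable_id)
  then show ?thesis
    by (simp add: foldl_conv_foldr)
qed

lemma computable_append:
  assumes "computable f" "computable g"
  shows "computable (\<lambda>x. f x @ g x)"
proof -
  have "computable (\<lambda>x. foldr ((\<lambda>x. (#)) x) (f x) (g x))"
    by (intro computable_foldr assms computable_Cons computable_fst computable_snd computable_id)
  moreover have "foldr (#) xs ys = xs @ ys" for xs ys :: "'b list"
    by (induction xs) auto
  ultimately show ?thesis
    by simp
qed

lemma computable_map:
  assumes "computable l" "computable (\<lambda>p. f (fst p) (snd p))"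
  shows "computable (\<lambda>x. map (f x) (l x))"
proof -
  have f: "computable (\<lambda>x. f (a x) (b x))" if "computable a" "computable b" for a b
    using computable_comp[OF assms(2) computable_pair[OF that]] by simp
  have "computable (\<lambda>x. foldr ((\<lambda>x a ys. f x a # ys) x) (l x) [])"
    by (intro computable_foldr assms computable_Cons computable_const f computable_fst computable_snd
          computable_id)
  moreover have "foldr (\<lambda>a ys. g a # ys) xs [] = map g xs" for g :: "'b \<Rightarrow> 'c" and xs
    by (induction xs) auto
  ultimately show ?thesis
    by simp
qed

lemma computable_concat:
  assumes "computable l"
  shows "computable (\<lambda>x. concat (l x))"
proof -
  have "computable (\<lambda>x. foldr ((\<lambda>x. (@)) x) (l x) [])"
    by (intro computable_foldr assms computable_append computable_const computable_fst computable_snd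
          computable_id)
  then show ?thesis
    by (simp add: concat_conv_foldr)
qed

lemma computable_filter_eq:
  assumes "computable l" "computable (\<lambda>p. f (fst p) (snd p))" "computable (\<lambda>p. g (fst p) (snd p))"
  shows "computable (\<lambda>x. filter (\<lambda>y. f x y = g x y) (l x))"
proof -
  have f: "computable (\<lambda>x. f (a x) (b x))" if "computable a" "computable b" for a b
    using computable_comp[OF assms(2) computable_pair[OF that]] by simp
  have g: "computable (\<lambda>x. g (a x) (b x))" if "computable a" "computable b" for a b
    using computable_comp[OF assms(3) computable_pair[OF that]] by simp
  have "computable (\<lambda>x. foldr ((\<lambda>x a ys. if f x a = g x a then a # ys else ys) x) (l x) [])"
    by (intro computable_foldr assms(1) computable_Cons computable_const f g computable_fst
          computable_snd computable_id computable_if_eq)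
  moreover have "foldr (\<lambda>a ys. if P a then a # ys else ys) xs [] = filter P xs"
    for P :: "'b \<Rightarrow> bool" and xs
    by (induction xs) auto
  ultimately show ?thesis
    by simp
qed

lemma computable_upt:
  assumes "computable f"
  shows "computable (\<lambda>x. [0..<f x])"
proof -
  have "computable (\<lambda>x. snd (((\<lambda>x p. (Suc (fst p), snd p @ [fst p])) x ^^ f x) (0, [])))"
    by (intro computable_iter assms computable_snd computable_pair computable_Suc computable_append
          computable_Cons computable_const computable_fst computable_id)
  moreover have "((\<lambda>p. (Suc (fst p), snd p @ [fst p])) ^^ m) (0, []) = (m, [0..<m])" for m
    by (induction m) auto
  ultimately show ?thesis
    by simp
qed

text \<open>Finite tables are computable, however they were obtained: each exceptional argument
  costs one test for equality. This is how the tables of the simulation enter the algorithm.\<close>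

lemma computable_finite_support:
  assumes "finite {x. f x \<noteq> d}"
  shows "computable f"
  using assms
proof (induction "{x. f x \<noteq> d}" arbitrary: f rule: finite_induct)
  case empty
  then have "f = (\<lambda>x. d)"
    by auto
  then show ?case
    by (simp add: computable_const)
next
  case (insert y F)
  have "F = {x. (f(y := d)) x \<noteq> d}"
    using insert.hyps(2,4) by auto
  then have "computable (f(y := d))"
    by (rule insert.hyps(3))
  from computable_if_eq[OF computable_id computable_const[of y] computable_const[of "f y"] this]
  show ?case
    by (rule back_subst[of computable]) auto
qed

lemmas computable_intros =
  computable_id computable_const computable_pair computable_fst computable_snd computable_add
  computable_mult computable_power computable_div computable_mod computable_if_eq computable_Cons
  computable_foldl computable_append computable_map computable_concat computable_filter_eq computable_upt


section \<open>Words and presentations\<close>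

lemma word_value_simps [simp]:
  "word_value G s [] = \<one>\<^bsub>G\<^esub>"
  "word_value G s (i # w) = (s ! i) \<otimes>\<^bsub>G\<^esub> word_value G s w"
  by (simp_all add: word_value_def)

lemma (in group) word_value_closed [simp]:
  assumes "set s \<subseteq> carrier G" "set w \<subseteq> {..<length s}"
  shows "word_value G s w \<in> carrier G"
  using assms(2)
proof (induction w)
  case (Cons i w)
  then have "s ! i \<in> carrier G"
    using assms(1) nth_mem[of i s] by auto
  with assms(1) Cons show ?case
    by auto
qed simp

lemma (in group) word_value_append:
  assumes "set s \<subseteq> carrier G" "set v \<subseteq> {..<length s}" "set w \<subseteq> {..<length s}"
  shows "word_value G s (v @ w) = word_value G s v \<otimes> word_value G s w"
  using assms(2)
proof (induction v)
  case (Cons i v)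
  then have "s ! i \<in> carrier G"
    using assms(1) nth_mem[of i s] by auto
  with assms Cons show ?case
    by (auto simp: m_assoc)
qed (use assms in simp)

lemma (in group) word_exists:
  assumes "generating_set G (set s)" "\<forall>x\<in>set s. inv x \<in> set s" "g \<in> carrier G"
  shows "\<exists>w. set w \<subseteq> {..<length s} \<and> word_value G s w = g"
proof -
  have s: "set s \<subseteq> carrier G"
    using assms(1) by (simp add: generating_set_def)
  have single: "\<exists>w. set w \<subseteq> {..<length s} \<and> word_value G s w = x" if x: "x \<in> set s" for x
  proof -
    obtain i where "i < length s" "s ! i = x"
      using x by (auto simp: in_set_conv_nth)
    with x s show ?thesis
      by (intro exI[of _ "[i]"]) auto
  qed
  have "g \<in> generate G (set s)"
    using assms(1,3) by (simp add: generating_set_def)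
  then show ?thesis
  proof induction
    case one
    show ?case
      by (rule exI[of _ "[]"]) simp
  next
    case (incl h)
    then show ?case
      by (rule single)
  next
    case (inv h)
    with assms(2) show ?case
      by (intro single) auto
  next
    case (eng h1 h2)
    then obtain w1 w2 where "set w1 \<subseteq> {..<length s}" "word_value G s w1 = h1"
      "set w2 \<subseteq> {..<length s}" "word_value G s w2 = h2"
      by auto
    with s show ?case
      by (intro exI[of _ "w1 @ w2"]) (simp add: word_value_append)
  qed
qed

section \<open>Free groups on reduced words\<close>

lemma letter_inv_letter_inv [simp]: "letter_inv (letter_inv l) = l"
  by (simp add: letter_inv_def)

lemma reduced_push_letter: "reduced_word w \<Longrightarrow> reduced_word (push_letter k w)"
  by (cases w) (auto simp: reduced_word_def successively_Cons)

text \<open>If \<open>k\<close> cancels the head of \<open>w\<close>, reducedness prevents the rest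
  from starting with \<open>k\<close>, so that pushing \<open>letter_inv k\<close> restores the head
  instead of cancelling again.\<close>

lemma push_letter_cancel:
  assumes "reduced_word w"
  shows "push_letter (letter_inv k) (push_letter k w) = w"
  using assms by (cases w rule: remdups_adj.cases) (auto simp: reduced_word_def)

lemma push_letter_reduced: "reduced_word (k # w) \<Longrightarrow> push_letter k w = k # w"
  by (cases w) (auto simp: reduced_word_def)

lemma reduced_foldr_push: "reduced_word w \<Longrightarrow> reduced_word (foldr push_letter v w)"
  by (induction v) (auto simp: reduced_push_letter)

text \<open>The one-letter case of associativity. If \<open>k\<close> cancels the head of
  \<open>v\<close>, the right-hand side pushes \<open>letter_inv k\<close> and then \<open>k\<close>
  onto a reduced word, which changes nothing.\<close>

lemma foldr_push_letter_push:
  assumes "reduced_word w"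
  shows "foldr push_letter (push_letter k v) w = push_letter k (foldr push_letter v w)"
proof (cases v)
  case (Cons l v')
  show ?thesis
    using push_letter_cancel[OF reduced_foldr_push[OF assms], of "letter_inv k" v'] Cons by auto
qed simp

lemma foldr_push_assoc:
  assumes "reduced_word w"
  shows "foldr push_letter (foldr push_letter u v) w = foldr push_letter u (foldr push_letter v w)"
  by (induction u) (auto simp: foldr_push_letter_push assms)

lemma foldr_push_Nil: "reduced_word w \<Longrightarrow> foldr push_letter w [] = w"
proof (induction w)
  case (Cons k w)
  then have "reduced_word w"
    by (auto simp: reduced_word_def successively_Cons)
  with Cons push_letter_reduced show ?case
    by simp
qed simp

lemma foldr_push_inverse:
  assumes "reduced_word w"
  shows "foldr push_letter (rev (map letter_inv v)) (foldr push_letter v w) = w"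
  by (induction v) (auto simp: push_letter_cancel reduced_foldr_push assms)

lemma push_letter_lists: "k \<in> L \<Longrightarrow> w \<in> lists L \<Longrightarrow> push_letter k w \<in> lists L"
  by (cases w) auto

lemma foldr_push_lists: "v \<in> lists L \<Longrightarrow> w \<in> lists L \<Longrightarrow> foldr push_letter v w \<in> lists L"
  by (induction v) (auto simp: push_letter_lists)

lemma in_carrier_free_group:
  "w \<in> carrier (free_group n) \<longleftrightarrow> w \<in> lists ({..<n} \<times> UNIV) \<and> reduced_word w"
  by (simp add: free_group_def)

lemma foldr_push_Nil_carrier:
  "w \<in> lists ({..<n} \<times> UNIV) \<Longrightarrow> foldr push_letter w [] \<in> carrier (free_group n)"
  unfolding in_carrier_free_group
  by (intro conjI foldr_push_lists reduced_foldr_push) (auto simp: reduced_word_def)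

lemma mult_free_group: "v \<otimes>\<^bsub>free_group n\<^esub> w = foldr push_letter v w"
  by (simp add: free_group_def)

lemma one_free_group: "\<one>\<^bsub>free_group n\<^esub> = []"
  by (simp add: free_group_def)

lemma group_free_group: "group (free_group n)"
proof (rule groupI; unfold mult_free_group one_free_group)
  fix x
  assume x: "x \<in> carrier (free_group n)"
  have "reduced_word []"
    by (simp add: reduced_word_def)
  \<comment> \<open>The left inverse is the normal form of the formal inverse word; taking the
    normal form avoids showing that the formal inverse is itself reduced.\<close>
  then have "foldr push_letter (foldr push_letter (rev (map letter_inv x)) []) x = []"
    using x foldr_push_inverse[of "[]" x]
    by (simp only: foldr_push_assoc foldr_push_Nil in_carrier_free_group foldr.simps id_apply)
  moreover have "foldr push_letter (rev (map letter_inv x)) [] \<in> carrier (free_group n)"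
    using x by (intro foldr_push_Nil_carrier) (fastforce simp: in_carrier_free_group letter_inv_def)
  ultimately show "\<exists>y\<in>carrier (free_group n). foldr push_letter y x = []"
    by blast
next
  fix x y
  assume "x \<in> carrier (free_group n)" "y \<in> carrier (free_group n)"
  then show "foldr push_letter x y \<in> carrier (free_group n)"
    by (simp only: in_carrier_free_group foldr_push_lists reduced_foldr_push simp_thms)
qed (auto simp: in_carrier_free_group foldr_push_assoc reduced_word_def[of "[]"])

lemma (in group) normal_normal_closure:
  assumes "R \<subseteq> carrier G"
  shows "normal_closure G R \<lhd> G" and "R \<subseteq> normal_closure G R"
proof -
  have "carrier G \<in> {N. N \<lhd> G \<and> R \<subseteq> N}"
    using assms normal_self by auto
  then have "subgroup (normal_closure G R) G"
    unfolding normal_closure_def by (intro subgroups_Inter) (auto intro: normal_imp_subgroup)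
  then show "normal_closure G R \<lhd> G"
    unfolding normal_inv_iff by (auto simp: normal_closure_def normal_inv_iff)
qed (auto simp: normal_closure_def)

lemma fold_closed:
  assumes "\<And>l. l \<in> set w \<Longrightarrow> \<phi> l \<in> \<Omega> \<rightarrow> \<Omega>" "p \<in> \<Omega>"
  shows "fold \<phi> w p \<in> \<Omega>"
  using assms by (induction w arbitrary: p) auto

text \<open>\<open>fold\<close> applies the letters of a word from left to right, so words act from
  the right. Inverse letters act by inverse maps, and hence the cancellations made by
  \<open>push_letter\<close> do not affect the action.\<close>

lemma fold_foldr_push:
  assumes \<phi>: "\<And>l. l \<in> L \<Longrightarrow> \<phi> l \<in> \<Omega> \<rightarrow> \<Omega>"
    and inverse: "\<And>l p. l \<in> L \<Longrightarrow> p \<in> \<Omega> \<Longrightarrow> \<phi> (letter_inv l) (\<phi> l p) = p"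
    and "v \<in> lists L" "w \<in> lists L" "p \<in> \<Omega>"
  shows "fold \<phi> (foldr push_letter v w) p = fold \<phi> w (fold \<phi> v p)"
  using assms(3,5)
proof (induction v arbitrary: p)
  case (Cons k v)
  then have k: "k \<in> L" "\<phi> (letter_inv k) (\<phi> k p) = p"
    using inverse by auto
  have "fold \<phi> (push_letter k u) p = fold \<phi> u (\<phi> k p)" for u
  proof (cases u)
    case (Cons l u')
    then show ?thesis
      using k by (cases "l = letter_inv k") auto
  qed simp
  moreover have "\<phi> k p \<in> \<Omega>"
    using \<phi>[OF k(1)] Cons.prems by auto
  ultimately show ?case
    using Cons by auto
qed simp

text \<open>The words acting trivially form a normal subgroup, which thus contains the normal closure of
  the relators.\<close>

lemma normal_closure_acts_trivially:
  assumes \<phi>: "\<And>l. l \<in> {..<n} \<times> UNIV \<Longrightarrow> \<phi> l \<in> \<Omega> \<rightarrow> \<Omega>"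
    and inverse: "\<And>l p. l \<in> {..<n} \<times> UNIV \<Longrightarrow> p \<in> \<Omega> \<Longrightarrow> \<phi> (letter_inv l) (\<phi> l p) = p"
    and R: "R \<subseteq> carrier (free_group n)" "\<And>r p. r \<in> R \<Longrightarrow> p \<in> \<Omega> \<Longrightarrow> fold \<phi> r p = p"
    and w: "w \<in> normal_closure (free_group n) R" and p: "p \<in> \<Omega>"
  shows "fold \<phi> w p = p"
proof -
  interpret F: group "free_group n"
    by (rule group_free_group)
  define K where "K = {w \<in> carrier (free_group n). \<forall>p\<in>\<Omega>. fold \<phi> w p = p}"
  have mult: "fold \<phi> (u \<otimes>\<^bsub>free_group n\<^esub> v) p = fold \<phi> v (fold \<phi> u p)"
    if "u \<in> carrier (free_group n)" "v \<in> carrier (free_group n)" "p \<in> \<Omega>" for u v p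
    unfolding mult_free_group using that
    by (intro fold_foldr_push[where L = "{..<n} \<times> UNIV" and \<Omega> = \<Omega>] \<phi> inverse)
      (auto simp: in_carrier_free_group)
  have closed: "fold \<phi> u p \<in> \<Omega>" if "u \<in> carrier (free_group n)" "p \<in> \<Omega>" for u p
    using that \<phi> by (intro fold_closed) (auto simp: in_carrier_free_group)
  have inv: "fold \<phi> (inv\<^bsub>free_group n\<^esub> u) (fold \<phi> u p) = p"
    if "u \<in> carrier (free_group n)" "p \<in> \<Omega>" for u p
    using mult[OF that(1) F.inv_closed[OF that(1)] that(2)] that by (simp add: one_free_group)
  have inv': "fold \<phi> u (fold \<phi> (inv\<^bsub>free_group n\<^esub> u) p) = p"
    if "u \<in> carrier (free_group n)" "p \<in> \<Omega>" for u p
    using inv[OF F.inv_closed[OF that(1)] that(2)] that by simp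
  have "subgroup K (free_group n)"
  proof (rule F.subgroupI)
    show "K \<noteq> {}"
      using F.one_closed by (force simp: K_def one_free_group)
  next
    fix a
    assume "a \<in> K"
    then show "inv\<^bsub>free_group n\<^esub> a \<in> K"
      using inv by (force simp: K_def)
  qed (auto simp: K_def mult)
  then have "K \<lhd> free_group n"
    unfolding F.normal_inv_iff by (auto simp: K_def mult closed inv inv')
  moreover have "R \<subseteq> K"
    using R by (auto simp: K_def)
  ultimately have "w \<in> K"
    using w by (auto simp: normal_closure_def)
  with p show ?thesis
    by (simp add: K_def)
qed

text \<open>Index \<open>2 * i\<close> stands for the \<open>i\<close>-th generator and
  \<open>2 * i + 1\<close> for its inverse, so that \<open>n\<close> free generators give a list of
  \<open>2 * n\<close> generators closed under inverses.\<close>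

definition letter_of :: "nat \<Rightarrow> letter" where
  "letter_of t = (t div 2, even t)"

definition index_of :: "letter \<Rightarrow> nat" where
  "index_of l = 2 * fst l + of_bool (\<not> snd l)"

lemma letter_of_index_of [simp]: "letter_of (index_of l) = l"
  by (cases l) (auto simp: letter_of_def index_of_def)

lemma index_of_letter_of [simp]: "index_of (letter_of t) = t"
  by (auto simp: letter_of_def index_of_def elim: oddE)

lemma index_of_less: "index_of l < 2 * n \<longleftrightarrow> l \<in> {..<n} \<times> UNIV"
  by (cases l) (auto simp: index_of_def)

lemma letter_of_in: "letter_of t \<in> {..<n} \<times> UNIV \<longleftrightarrow> t < 2 * n"
  using index_of_less[of "letter_of t" n] by simp

text \<open>The universal property of a presentation, for right actions: maps satisfying the relations
  define an action of the group.\<close>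

lemma finitely_presented_action:
  fixes H :: "('b, 'k) monoid_scheme"
  assumes "group H" "finitely_presented H"
  obtains s rels where
    "generating_set H (set s)" "\<forall>x\<in>set s. inv\<^bsub>H\<^esub> x \<in> set s"
    "finite rels" "\<And>r. r \<in> rels \<Longrightarrow> set r \<subseteq> {..<length s}"
    "\<And>r. r \<in> rels \<Longrightarrow> word_value H s r = \<one>\<^bsub>H\<^esub>"
    "\<And>(\<Omega> :: 'c set) \<phi> v w p. \<lbrakk>\<And>t. t < length s \<Longrightarrow> \<phi> t \<in> \<Omega> \<rightarrow> \<Omega>;
        \<And>r p. r \<in> rels \<Longrightarrow> p \<in> \<Omega> \<Longrightarrow> fold \<phi> r p = p;
        set v \<subseteq> {..<length s}; set w \<subseteq> {..<length s}; word_value H s v = word_value H s w;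
        p \<in> \<Omega>\<rbrakk> \<Longrightarrow> fold \<phi> v p = fold \<phi> w p"
proof -
  interpret H: group H by fact
  obtain n R where R: "finite R" "R \<subseteq> carrier (free_group n)" and iso: "H \<cong> presented_group n R"
    using assms(2) by (auto simp: finitely_presented_def)
  interpret F: group "free_group n"
    by (rule group_free_group)
  define N where "N = normal_closure (free_group n) R"
  have N: "N \<lhd> free_group n" "R \<subseteq> N"
    using F.normal_normal_closure[OF R(2)] by (auto simp: N_def)
  interpret N: normal N "free_group n" by fact
  obtain \<psi> where \<psi>: "\<psi> \<in> iso (free_group n Mod N) H"
    using H.iso_sym[OF iso] by (auto simp: is_iso_def presented_group_def N_def)
  \<comment> \<open>The canonical map from the free group onto \<open>H\<close>; its fibres are the
    cosets of the normal closure \<open>N\<close>.\<close>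
  define \<pi> where "\<pi> = (\<lambda>w. \<psi> (N #>\<^bsub>free_group n\<^esub> w))"
  have \<pi>_hom: "\<pi> \<in> hom (free_group n) H"
    using hom_compose[OF N.r_coset_hom_Mod, of \<psi> H] \<psi> unfolding \<pi>_def comp_def iso_def by blast
  interpret \<pi>: group_hom "free_group n" H \<pi>
    by unfold_locales (rule \<pi>_hom)
  have \<pi>_surj: "\<pi> ` carrier (free_group n) = carrier H"
  proof -
    have "carrier (free_group n Mod N) = (\<lambda>w. N #>\<^bsub>free_group n\<^esub> w) ` carrier (free_group n)"
      by (auto simp: FactGroup_def RCOSETS_def)
    then show ?thesis
      using \<psi> by (simp add: \<pi>_def iso_def bij_betw_def image_image)
  qed
  have \<pi>_eq: "N #>\<^bsub>free_group n\<^esub> v = N #>\<^bsub>free_group n\<^esub> w"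
    if "v \<in> carrier (free_group n)" "w \<in> carrier (free_group n)" "\<pi> v = \<pi> w" for v w
  proof -
    have "inj_on \<psi> (carrier (free_group n Mod N))"
      using \<psi> by (auto simp: iso_def bij_betw_def)
    with that show ?thesis
      unfolding \<pi>_def by (auto simp: FactGroup_def RCOSETS_def inj_on_def)
  qed
  define nf where "nf = (\<lambda>w. foldr push_letter (map letter_of w) [])"
  define s where "s = map (\<lambda>t. \<pi> (nf [t])) [0..<2 * n]"
  have len: "length s = 2 * n"
    by (simp add: s_def)
  have letters: "map letter_of w \<in> lists ({..<n} \<times> UNIV)" if "set w \<subseteq> {..<2 * n}" for w
  proof (unfold in_lists_conv_set, intro ballI)
    fix l
    assume "l \<in> set (map letter_of w)"
    then obtain t where "t \<in> set w" "l = letter_of t"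
      by auto
    with that letter_of_in[of t n] show "l \<in> {..<n} \<times> UNIV"
      by auto
  qed
  have nf: "nf w \<in> carrier (free_group n)" if "set w \<subseteq> {..<2 * n}" for w
    unfolding nf_def using letters[OF that] by (rule foldr_push_Nil_carrier)
  have s_nth: "s ! t = \<pi> (nf [t])" if "t < 2 * n" for t
    using that by (simp add: s_def)
  have wval: "word_value H s w = \<pi> (nf w)" if "set w \<subseteq> {..<2 * n}" for w
    using that
  proof (induction w)
    case Nil
    show ?case
      using \<pi>.hom_one by (simp add: nf_def one_free_group)
  next
    case (Cons t w)
    have "nf (t # w) = nf [t] \<otimes>\<^bsub>free_group n\<^esub> nf w"
      by (simp add: nf_def mult_free_group)
    then show ?case
      using Cons nf[of "[t]"] nf[of w] by (simp add: s_nth)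
  qed
  have sH: "set s \<subseteq> carrier H"
    using nf by (auto simp: s_def)
  \<comment> \<open>Besides the given relators, each index followed by that of the inverse letter is
    a relator. The maps \<open>\<phi> t\<close> are not assumed invertible; these relators force the
    maps of inverse letters to be mutually inverse.\<close>
  define rels where
    "rels = map index_of ` R \<union> (\<lambda>t. [t, index_of (letter_inv (letter_of t))]) ` {..<2 * n}"
  have index_of: "index_of ` set w \<subseteq> {..<2 * n}" if "w \<in> carrier (free_group n)" for w
    using that index_of_less[of _ n] unfolding in_carrier_free_group in_lists_conv_set by blast
  have index_inv: "index_of (letter_inv (letter_of t)) < 2 * n" if "t < 2 * n" for t
    using that letter_of_in[of t n] unfolding index_of_less by (simp add: letter_inv_def letter_of_def)
  have rels: "set r \<subseteq> {..<2 * n}" if "r \<in> rels" for r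
  proof -
    consider w where "w \<in> R" "r = map index_of w"
      | t where "t < 2 * n" "r = [t, index_of (letter_inv (letter_of t))]"
      using \<open>r \<in> rels\<close> by (auto simp: rels_def)
    then show ?thesis
    proof cases
      case 1
      then show ?thesis
        using index_of[of w] R(2) by (simp add: subset_iff)
    next
      case 2
      then show ?thesis
        using index_inv by simp
    qed
  qed
  have nf_R: "nf (map index_of r) = r" if "r \<in> R" for r
    using that R(2) by (auto simp: nf_def comp_def foldr_push_Nil in_carrier_free_group)
  have rel_one: "word_value H s r = \<one>\<^bsub>H\<^esub>" if r: "r \<in> rels" for r
  proof -
    consider r' where "r = map index_of r'" "r' \<in> R"
      | t where "r = [t, index_of (letter_inv (letter_of t))]"
      using r by (auto simp: rels_def)
    then have "nf r \<in> N"
    proof cases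
      case 1
      then show ?thesis
        using nf_R N(2) by auto
    next
      case 2
      then have "nf r = []"
        by (simp add: nf_def)
      then show ?thesis
        using N.one_closed by (simp add: one_free_group)
    qed
    then have "N #>\<^bsub>free_group n\<^esub> nf r = N #>\<^bsub>free_group n\<^esub> \<one>\<^bsub>free_group n\<^esub>"
      using F.coset_join2 N.is_subgroup N.subset by force
    then have "\<pi> (nf r) = \<pi> \<one>\<^bsub>free_group n\<^esub>"
      by (simp only: \<pi>_def)
    then show ?thesis
      using wval[OF rels[OF r]] by simp
  qed
  have gen: "generate H (set s) = carrier H"
  proof
    show "generate H (set s) \<subseteq> carrier H"
      using H.generate_incl[OF sH] .
  next
    have "s ! t \<in> generate H (set s)" if "t < 2 * n" for t
      using that len by (intro generate.incl nth_mem) simp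
    then have "word_value H s w \<in> generate H (set s)" if "set w \<subseteq> {..<2 * n}" for w
      using that by (induction w) (auto intro: generate.one generate.eng)
    moreover have "\<exists>w. set w \<subseteq> {..<2 * n} \<and> word_value H s w = x" if x: "x \<in> carrier H" for x
    proof -
      obtain w where w: "w \<in> carrier (free_group n)" "x = \<pi> w"
        using x \<pi>_surj by blast
      have w': "set (map index_of w) \<subseteq> {..<2 * n}"
        using index_of[OF w(1)] by simp
      have "nf (map index_of w) = w"
        using w(1) by (simp add: nf_def comp_def foldr_push_Nil in_carrier_free_group)
      with w w' wval[OF w'] show ?thesis
        by (intro exI[of _ "map index_of w"]) simp
    qed
    ultimately show "carrier H \<subseteq> generate H (set s)"
      by blast
  qed
  have inv: "inv\<^bsub>H\<^esub> x \<in> set s" if x: "x \<in> set s" for x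
  proof -
    obtain t where t: "t < 2 * n" "x = s ! t"
      using x len by (auto simp: in_set_conv_nth)
    define t' where "t' = index_of (letter_inv (letter_of t))"
    have t': "t' < 2 * n"
      unfolding t'_def by (rule index_inv[OF t(1)])
    have "[t, t'] \<in> rels"
      using t(1) by (auto simp: rels_def t'_def)
    then have "s ! t \<otimes>\<^bsub>H\<^esub> s ! t' = \<one>\<^bsub>H\<^esub>"
      using rel_one[of "[t, t']"] sH t' len nth_mem[of t' s] by (auto simp: subset_iff)
    then have "inv\<^bsub>H\<^esub> x = s ! t'"
      using sH t t' len by (metis H.inv_equality H.inv_inv nth_mem subset_iff)
    with t' len show ?thesis
      by simp
  qed
  show ?thesis
  proof (rule that[of s rels])
    show "generating_set H (set s)"
      using sH gen by (simp add: generating_set_def)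
    show "finite rels"
      using R(1) by (simp add: rels_def)
    fix \<Omega> :: "'c set" and \<phi> v w p
    assume "\<And>t. t < length s \<Longrightarrow> \<phi> t \<in> \<Omega> \<rightarrow> \<Omega>"
    then have \<phi>: "\<phi> (index_of l) \<in> \<Omega> \<rightarrow> \<Omega>" if "l \<in> {..<n} \<times> UNIV" for l
      using that index_of_less[of l n] len by auto
    assume triv: "\<And>r p. r \<in> rels \<Longrightarrow> p \<in> \<Omega> \<Longrightarrow> fold \<phi> r p = p"
    assume v: "set v \<subseteq> {..<length s}" and w: "set w \<subseteq> {..<length s}"
      and eq: "word_value H s v = word_value H s w" and p: "p \<in> \<Omega>"
    have inverse: "\<phi> (index_of (letter_inv l)) (\<phi> (index_of l) q) = q"
      if "l \<in> {..<n} \<times> UNIV" "q \<in> \<Omega>" for l q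
    proof -
      have "[index_of l, index_of (letter_inv l)] \<in> rels"
        using that(1) index_of_less[of l n] by (force simp: rels_def)
      from triv[OF this that(2)] show ?thesis
        by simp
    qed
    have fold_nf: "fold \<phi> u q = fold (\<phi> \<circ> index_of) (nf u) q" if "set u \<subseteq> {..<2 * n}" "q \<in> \<Omega>" for u q
    proof -
      have "fold (\<phi> \<circ> index_of) (nf u) q =
          fold (\<phi> \<circ> index_of) [] (fold (\<phi> \<circ> index_of) (map letter_of u) q)"
        unfolding nf_def
        using letters[OF that(1)] that(2) \<phi> inverse
        by (intro fold_foldr_push[where L = "{..<n} \<times> UNIV" and \<Omega> = \<Omega>])
          (simp_all only: comp_apply lists.Nil)
      also have "\<dots> = fold \<phi> u q"
        by (simp add: fold_map comp_def)
      finally show ?thesis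
        by simp
    qed
    define a b where "a = nf v" and "b = nf w"
    have ab: "a \<in> carrier (free_group n)" "b \<in> carrier (free_group n)"
      using nf v w len by (auto simp: a_def b_def)
    have "\<pi> a = \<pi> b"
      using eq wval v w len by (simp add: a_def b_def)
    \<comment> \<open>Words with equal value in \<open>H\<close> have normal forms that differ by a
      left factor \<open>c\<close> in \<open>N\<close>, and \<open>c\<close> acts trivially.\<close>
    then have "a \<in> N #>\<^bsub>free_group n\<^esub> b"
      using \<pi>_eq[OF ab] F.rcos_self[OF ab(1) N.is_subgroup] by simp
    then obtain c where c: "c \<in> N" "a = c \<otimes>\<^bsub>free_group n\<^esub> b"
      by (auto simp: r_coset_def)
    have "fold (\<phi> \<circ> index_of) a p = fold (\<phi> \<circ> index_of) b (fold (\<phi> \<circ> index_of) c p)"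
      unfolding c(2) mult_free_group
      using \<phi> inverse p ab c(1) N.subset
      by (intro fold_foldr_push[where L = "{..<n} \<times> UNIV" and \<Omega> = \<Omega>])
        (simp_all only: comp_apply in_carrier_free_group subset_iff)
    also have "fold (\<phi> \<circ> index_of) c p = p"
    proof (rule normal_closure_acts_trivially[where n = n and \<Omega> = \<Omega> and R = R])
      fix r q
      assume "r \<in> R" "q \<in> \<Omega>"
      then show "fold (\<phi> \<circ> index_of) r q = q"
        using triv[of "map index_of r" q] by (simp add: rels_def fold_map)
    qed (use \<phi> inverse c(1) R(2) p in \<open>simp_all only: comp_apply N_def\<close>)
    finally show "fold \<phi> v p = fold \<phi> w p"
      using fold_nf v w p len by (simp add: a_def b_def comp_def)
  qed (use inv rels rel_one len in auto)
qed


section \<open>Coarse equivalences\<close>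

text \<open>Finite sets of displacements \<open>inv x \<otimes> y\<close> take the place of balls in
  a left-invariant word metric. With two maps on a common index set, one notion covers both the
  upper and the lower bound of a coarse embedding.\<close>

definition uniformly_close ::
  "('a, 'm) monoid_scheme \<Rightarrow> ('b, 'k) monoid_scheme \<Rightarrow> 'x set \<Rightarrow> ('x \<Rightarrow> 'a) \<Rightarrow> ('x \<Rightarrow> 'b) \<Rightarrow> bool"
where
  "uniformly_close G H X e f \<longleftrightarrow>
     (\<forall>D. finite D \<longrightarrow> (\<exists>E. finite E \<and> (\<forall>x\<in>X. \<forall>y\<in>X.
        inv\<^bsub>G\<^esub> (e x) \<otimes>\<^bsub>G\<^esub> e y \<in> D \<longrightarrow> inv\<^bsub>H\<^esub> (f x) \<otimes>\<^bsub>H\<^esub> f y \<in> E)))"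

definition coarse_equivalence ::
  "('a, 'm) monoid_scheme \<Rightarrow> ('b, 'k) monoid_scheme \<Rightarrow> ('a \<Rightarrow> 'b) \<Rightarrow> bool" where
  "coarse_equivalence G H f \<longleftrightarrow>
     f \<in> carrier G \<rightarrow> carrier H \<and>
     uniformly_close G H (carrier G) (\<lambda>g. g) f \<and>
     uniformly_close H G (carrier G) f (\<lambda>g. g) \<and>
     (\<exists>E. finite E \<and> (\<forall>h\<in>carrier H. \<exists>g\<in>carrier G. inv\<^bsub>H\<^esub> (f g) \<otimes>\<^bsub>H\<^esub> h \<in> E))"

lemma (in group) mult_inv_cancel:
  assumes "x \<in> carrier G" "y \<in> carrier G"
  shows "x \<otimes> (inv x \<otimes> y) = y" "inv x \<otimes> (x \<otimes> y) = y"
  using assms by (simp_all flip: m_assoc)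

text \<open>\<open>f'\<close> selects a coarse preimage of each element. All estimates for
  \<open>f'\<close> are triangle inequalities, written as products of displacements.\<close>

lemma coarse_equivalence_inverse:
  fixes G :: "('a, 'm) monoid_scheme" and H :: "('b, 'k) monoid_scheme"
  assumes "group G" "group H" "coarse_equivalence G H f"
  obtains f' where "coarse_equivalence H G f'"
proof -
  interpret G: group G by fact
  interpret H: group H by fact
  have f: "f \<in> carrier G \<rightarrow> carrier H"
    and up: "uniformly_close G H (carrier G) (\<lambda>g. g) f"
    and low: "uniformly_close H G (carrier G) f (\<lambda>g. g)"
    using assms(3) by (auto simp: coarse_equivalence_def)
  obtain B where B: "finite B" "\<And>h. h \<in> carrier H \<Longrightarrow> \<exists>g\<in>carrier G. inv\<^bsub>H\<^esub> (f g) \<otimes>\<^bsub>H\<^esub> h \<in> B"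
    using assms(3) by (auto simp: coarse_equivalence_def)
  obtain f' where f': "\<And>h. h \<in> carrier H \<Longrightarrow> f' h \<in> carrier G"
      "\<And>h. h \<in> carrier H \<Longrightarrow> inv\<^bsub>H\<^esub> (f (f' h)) \<otimes>\<^bsub>H\<^esub> h \<in> B"
    using B(2) by metis
  have ff': "f (f' h) \<in> carrier H" if "h \<in> carrier H" for h
    using f f'(1)[OF that] by auto
  have "uniformly_close H G (carrier H) (\<lambda>h. h) f'"
    unfolding uniformly_close_def
  proof (intro allI impI)
    fix D :: "'b set"
    assume "finite D"
    \<comment> \<open>The displacement from \<open>f (f' h)\<close> to \<open>f (f' h')\<close>,
      taken via \<open>h\<close> and \<open>h'\<close>: an element of \<open>B\<close>, one of
      \<open>D\<close>, and the inverse of one of \<open>B\<close>.\<close>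
    define D' where "D' = (\<lambda>(a, b, c). a \<otimes>\<^bsub>H\<^esub> b \<otimes>\<^bsub>H\<^esub> inv\<^bsub>H\<^esub> c) ` (B \<times> D \<times> B)"
    have "finite D'"
      using \<open>finite D\<close> B(1) by (simp add: D'_def)
    then obtain E where E: "finite E" "\<And>g g'. \<lbrakk>g \<in> carrier G; g' \<in> carrier G;
        inv\<^bsub>H\<^esub> (f g) \<otimes>\<^bsub>H\<^esub> f g' \<in> D'\<rbrakk> \<Longrightarrow> inv\<^bsub>G\<^esub> g \<otimes>\<^bsub>G\<^esub> g' \<in> E"
      using low unfolding uniformly_close_def by meson
    have "inv\<^bsub>G\<^esub> (f' h) \<otimes>\<^bsub>G\<^esub> f' h' \<in> E"
      if h: "h \<in> carrier H" "h' \<in> carrier H" "inv\<^bsub>H\<^esub> h \<otimes>\<^bsub>H\<^esub> h' \<in> D" for h h'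
    proof (intro E(2) f'(1) h)
      have "inv\<^bsub>H\<^esub> (f (f' h)) \<otimes>\<^bsub>H\<^esub> f (f' h') =
          inv\<^bsub>H\<^esub> (f (f' h)) \<otimes>\<^bsub>H\<^esub> h \<otimes>\<^bsub>H\<^esub> (inv\<^bsub>H\<^esub> h \<otimes>\<^bsub>H\<^esub> h') \<otimes>\<^bsub>H\<^esub> inv\<^bsub>H\<^esub> (inv\<^bsub>H\<^esub> (f (f' h')) \<otimes>\<^bsub>H\<^esub> h')"
        using h ff' by (simp add: H.m_assoc H.inv_mult_group H.mult_inv_cancel)
      then show "inv\<^bsub>H\<^esub> (f (f' h)) \<otimes>\<^bsub>H\<^esub> f (f' h') \<in> D'"
        using h f'(2) unfolding D'_def
        by (intro image_eqI[of _ _ "(inv\<^bsub>H\<^esub> (f (f' h)) \<otimes>\<^bsub>H\<^esub> h, inv\<^bsub>H\<^esub> h \<otimes>\<^bsub>H\<^esub> h',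
              inv\<^bsub>H\<^esub> (f (f' h')) \<otimes>\<^bsub>H\<^esub> h')"]) simp_all
    qed
    with E(1) show "\<exists>E. finite E \<and> (\<forall>x\<in>carrier H. \<forall>y\<in>carrier H.
        inv\<^bsub>H\<^esub> x \<otimes>\<^bsub>H\<^esub> y \<in> D \<longrightarrow> inv\<^bsub>G\<^esub> (f' x) \<otimes>\<^bsub>G\<^esub> f' y \<in> E)"
      by (intro exI[of _ E]) simp
  qed
  moreover have "uniformly_close G H (carrier H) f' (\<lambda>h. h)"
    unfolding uniformly_close_def
  proof (intro allI impI)
    fix D :: "'a set"
    assume "finite D"
    then obtain E where E: "finite E" "\<And>g g'. \<lbrakk>g \<in> carrier G; g' \<in> carrier G;
        inv\<^bsub>G\<^esub> g \<otimes>\<^bsub>G\<^esub> g' \<in> D\<rbrakk> \<Longrightarrow> inv\<^bsub>H\<^esub> (f g) \<otimes>\<^bsub>H\<^esub> f g' \<in> E"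
      using up unfolding uniformly_close_def by meson
    \<comment> \<open>The reverse route: from \<open>h\<close> to \<open>f (f' h)\<close>, on to
      \<open>f (f' h')\<close>, and from there to \<open>h'\<close>.\<close>
    define E' where "E' = (\<lambda>(a, b, c). inv\<^bsub>H\<^esub> a \<otimes>\<^bsub>H\<^esub> b \<otimes>\<^bsub>H\<^esub> c) ` (B \<times> E \<times> B)"
    have "finite E'"
      using E(1) B(1) by (simp add: E'_def)
    moreover have "inv\<^bsub>H\<^esub> h \<otimes>\<^bsub>H\<^esub> h' \<in> E'"
      if h: "h \<in> carrier H" "h' \<in> carrier H" "inv\<^bsub>G\<^esub> (f' h) \<otimes>\<^bsub>G\<^esub> f' h' \<in> D" for h h'
    proof -
      have "inv\<^bsub>H\<^esub> h \<otimes>\<^bsub>H\<^esub> h' = inv\<^bsub>H\<^esub> (inv\<^bsub>H\<^esub> (f (f' h)) \<otimes>\<^bsub>H\<^esub> h) \<otimes>\<^bsub>H\<^esub>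
          (inv\<^bsub>H\<^esub> (f (f' h)) \<otimes>\<^bsub>H\<^esub> f (f' h')) \<otimes>\<^bsub>H\<^esub> (inv\<^bsub>H\<^esub> (f (f' h')) \<otimes>\<^bsub>H\<^esub> h')"
        using h ff' by (simp add: H.m_assoc H.inv_mult_group H.mult_inv_cancel)
      moreover have "inv\<^bsub>H\<^esub> (f (f' h)) \<otimes>\<^bsub>H\<^esub> f (f' h') \<in> E"
        using h by (intro E(2) f'(1))
      ultimately show ?thesis
        using h f'(2) unfolding E'_def
        by (intro image_eqI[of _ _ "(inv\<^bsub>H\<^esub> (f (f' h)) \<otimes>\<^bsub>H\<^esub> h, inv\<^bsub>H\<^esub> (f (f' h)) \<otimes>\<^bsub>H\<^esub> f (f' h'),
              inv\<^bsub>H\<^esub> (f (f' h')) \<otimes>\<^bsub>H\<^esub> h')"]) simp_all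
    qed
    ultimately show "\<exists>E. finite E \<and> (\<forall>x\<in>carrier H. \<forall>y\<in>carrier H.
        inv\<^bsub>G\<^esub> (f' x) \<otimes>\<^bsub>G\<^esub> f' y \<in> D \<longrightarrow> inv\<^bsub>H\<^esub> x \<otimes>\<^bsub>H\<^esub> y \<in> E)"
      by (intro exI[of _ E']) simp
  qed
  \<comment> \<open>For coarse surjectivity of \<open>f'\<close>: the images of
    \<open>f' (f g)\<close> and \<open>g\<close> under \<open>f\<close> differ by an element of
    \<open>B\<close>, so \<open>f' (f g)\<close> itself is boundedly close to
    \<open>g\<close>.\<close>
  moreover obtain E where E: "finite E" "\<And>g g'. \<lbrakk>g \<in> carrier G; g' \<in> carrier G;
      inv\<^bsub>H\<^esub> (f g) \<otimes>\<^bsub>H\<^esub> f g' \<in> B\<rbrakk> \<Longrightarrow> inv\<^bsub>G\<^esub> g \<otimes>\<^bsub>G\<^esub> g' \<in> E"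
    using low B(1) unfolding uniformly_close_def by meson
  moreover have "\<exists>h\<in>carrier H. inv\<^bsub>G\<^esub> (f' h) \<otimes>\<^bsub>G\<^esub> g \<in> E" if g: "g \<in> carrier G" for g
  proof
    show "f g \<in> carrier H"
      using g f by auto
    then show "inv\<^bsub>G\<^esub> (f' (f g)) \<otimes>\<^bsub>G\<^esub> g \<in> E"
      using g by (intro E(2) f')
  qed
  ultimately have "coarse_equivalence H G f'"
    using f'(1) unfolding coarse_equivalence_def by (auto intro!: exI[of _ E])
  then show ?thesis
    by (rule that)
qed


section \<open>Cayley graphs\<close>

definition vertex :: "'v \<Rightarrow> 'v \<Rightarrow> real" where
  "vertex v = edge_point v v 0"

lemma edge_point_simps [simp]:
  "edge_point u v 0 = vertex u" "edge_point u v 1 = vertex v" "edge_point u u t = vertex u"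
  by (auto simp: edge_point_def vertex_def algebra_simps)

lemma path_of_length_nonneg: "path_of_length E p q l \<Longrightarrow> 0 \<le> l"
  by (induction rule: path_of_length.induct) auto

lemma path_of_length_trans:
  assumes "path_of_length E q r l'" "path_of_length E p q l"
  shows "path_of_length E p r (l + l')"
  using assms
proof (induction rule: path_of_length.induct)
  case (segment q u v t l' r)
  then show ?case
    using path_of_length.segment[of E p u v t "l + l'" r] by (simp add: add.assoc)
qed simp

lemma path_of_length_edge:
  assumes "(u, v) \<in> E" "0 \<le> t" "t \<le> 1" "0 \<le> r" "r \<le> 1"
  shows "path_of_length E (edge_point u v t) (edge_point u v r) \<bar>t - r\<bar>"
  using path_of_length.segment[OF path_of_length.trivial assms] by simp

lemma path_of_length_sym:
  assumes "path_of_length E p q l"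
  shows "path_of_length E q p l"
  using assms
proof (induction rule: path_of_length.induct)
  case (trivial p)
  show ?case
    by (rule path_of_length.trivial)
next
  case (segment p u v t l r)
  then show ?case
    using path_of_length_trans[OF segment.IH path_of_length_edge[of u v E r t]]
    by (simp add: abs_minus_commute add.commute)
qed

lemma bdd_below_path_lengths: "bdd_below {l. path_of_length E p q l}"
  by (rule bdd_belowI[of _ 0]) (auto intro: path_of_length_nonneg)

lemma path_dist_le: "path_of_length E p q l \<Longrightarrow> path_dist E p q \<le> l"
  unfolding path_dist_def by (intro cInf_lower bdd_below_path_lengths) simp

lemma path_dist_sym: "path_dist E p q = path_dist E q p"
  unfolding path_dist_def by (intro arg_cong[of _ _ Inf] Collect_cong) (auto intro: path_of_length_sym)

text \<open>The given paths ensure that both infima range over nonempty sets, so that paths with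
  lengths within \<open>e / 2\<close> of them exist and can be joined.\<close>

lemma path_dist_triangle:
  assumes "path_of_length E p q l0" "path_of_length E q r l1"
  shows "path_dist E p r \<le> path_dist E p q + path_dist E q r"
proof (rule field_le_epsilon)
  fix e :: real
  assume "e > 0"
  have "\<exists>l. path_of_length E p q l \<and> l < path_dist E p q + e / 2"
    using cInf_lessD[of "{l. path_of_length E p q l}" "path_dist E p q + e / 2"] assms(1) \<open>e > 0\<close>
    by (auto simp: path_dist_def)
  moreover have "\<exists>l. path_of_length E q r l \<and> l < path_dist E q r + e / 2"
    using cInf_lessD[of "{l. path_of_length E q r l}" "path_dist E q r + e / 2"] assms(2) \<open>e > 0\<close>
    by (auto simp: path_dist_def)
  ultimately obtain l l' where "path_of_length E p q l" "l < path_dist E p q + e / 2"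
    "path_of_length E q r l'" "l' < path_dist E q r + e / 2"
    by blast
  then show "path_dist E p r \<le> path_dist E p q + path_dist E q r + e"
    using path_dist_le[OF path_of_length_trans, of E q r l' p l] by linarith
qed

text \<open>The extension of a function on the vertices that is affine on the edges; barycentric
  coordinates make it independent of the representation of a point.\<close>

definition affine_extension :: "('v \<Rightarrow> real) \<Rightarrow> ('v \<Rightarrow> real) \<Rightarrow> real" where
  "affine_extension \<rho> p = (\<Sum>x | p x \<noteq> 0. p x * \<rho> x)"

lemma affine_extension_edge_point:
  "affine_extension \<rho> (edge_point u v t) = (1 - t) * \<rho> u + t * \<rho> v"
proof -
  have "affine_extension \<rho> (edge_point u v t) = (\<Sum>x\<in>{u, v}. edge_point u v t x * \<rho> x)"
    unfolding affine_extension_def by (intro sum.mono_neutral_left) (auto simp: edge_point_def)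
  also have "\<dots> = (1 - t) * \<rho> u + t * \<rho> v"
    by (cases "u = v") (auto simp: edge_point_def algebra_simps simp del: edge_point_simps)
  finally show ?thesis .
qed

text \<open>Along one edge the extension changes by \<open>\<bar>t - r\<bar>\<close> times the
  difference of the end values. It thus bounds all path lengths from below, including paths that
  turn around inside edges; applied to word length, it shows that geometric distance is not shorter
  than word distance.\<close>

lemma affine_extension_lipschitz:
  assumes "path_of_length E p q l" "\<And>u v. (u, v) \<in> E \<Longrightarrow> \<bar>\<rho> u - \<rho> v\<bar> \<le> 1"
  shows "\<bar>affine_extension \<rho> p - affine_extension \<rho> q\<bar> \<le> l"
  using assms(1)
proof (induction rule: path_of_length.induct)
  case (segment p u v t l r)
  have "\<bar>affine_extension \<rho> (edge_point u v t) - affine_extension \<rho> (edge_point u v r)\<bar> =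
      \<bar>t - r\<bar> * \<bar>\<rho> u - \<rho> v\<bar>"
    by (simp add: affine_extension_edge_point flip: abs_mult) (simp add: abs_if algebra_simps)
  also have "\<dots> \<le> \<bar>t - r\<bar> * 1"
    using assms(2)[OF segment.hyps(2)] by (intro mult_left_mono) auto
  finally show ?case
    using segment.IH abs_triangle_ineq[of "affine_extension \<rho> p - affine_extension \<rho> (edge_point u v t)"
        "affine_extension \<rho> (edge_point u v t) - affine_extension \<rho> (edge_point u v r)"] by simp
qed simp

text \<open>Inverses are included because \<open>S\<close> need not be symmetric while edges may be
  traversed both ways; the balls are cumulative.\<close>

primrec word_ball :: "('a, 'm) monoid_scheme \<Rightarrow> 'a set \<Rightarrow> nat \<Rightarrow> 'a set" where
  "word_ball G S 0 = {\<one>\<^bsub>G\<^esub>}"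
| "word_ball G S (Suc m) = word_ball G S m \<union>
     (\<lambda>(x, s). x \<otimes>\<^bsub>G\<^esub> s) ` (word_ball G S m \<times> (S \<union> m_inv G ` S))"

definition word_length :: "('a, 'm) monoid_scheme \<Rightarrow> 'a set \<Rightarrow> 'a \<Rightarrow> nat" where
  "word_length G S x = (LEAST m. x \<in> word_ball G S m)"

lemma finite_word_ball: "finite S \<Longrightarrow> finite (word_ball G S m)"
  by (induction m) auto

lemma word_ball_mono: "m \<le> n \<Longrightarrow> word_ball G S m \<subseteq> word_ball G S n"
  by (induction n rule: dec_induct) auto

locale generated_group = group G for G (structure) +
  fixes S
  assumes generating: "generating_set G S"
begin

lemma S_subset: "S \<subseteq> carrier G"
  using generating by (simp add: generating_set_def)

lemma word_ball_subset: "word_ball G S m \<subseteq> carrier G"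
  using S_subset by (induction m) auto

lemma word_ball_mult:
  assumes "x \<in> word_ball G S m" "y \<in> word_ball G S n"
  shows "x \<otimes> y \<in> word_ball G S (m + n)"
  using assms(2)
proof (induction n arbitrary: y)
  case 0
  with assms(1) word_ball_subset[of m] show ?case
    by (auto simp: subset_iff)
next
  case (Suc n)
  show ?case
  proof (cases "y \<in> word_ball G S n")
    case True
    with Suc.IH show ?thesis
      by simp
  next
    case False
    with Suc.prems obtain z s where z: "z \<in> word_ball G S n" "s \<in> S \<union> m_inv G ` S" "y = z \<otimes> s"
      by auto
    then have "x \<otimes> y = x \<otimes> z \<otimes> s"
      using assms(1) word_ball_subset S_subset by (auto simp: m_assoc subset_iff)
    then show ?thesis
      using Suc.IH[OF z(1)] z(2) by auto
  qed
qed

lemma word_ball_generator: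
  assumes "s \<in> S \<union> m_inv G ` S"
  shows "s \<in> word_ball G S 1"
proof -
  have "\<one> \<otimes> s \<in> word_ball G S 1"
    using assms by (auto intro!: image_eqI[of _ _ "(\<one>, s)"])
  moreover have "\<one> \<otimes> s = s"
    using assms S_subset by auto
  ultimately show ?thesis
    by simp
qed

lemma word_ball_exhaust:
  assumes "x \<in> carrier G"
  shows "\<exists>m. x \<in> word_ball G S m"
proof -
  have "x \<in> generate G S"
    using assms generating by (simp add: generating_set_def)
  then show ?thesis
  proof induction
    case one
    show ?case
      by (rule exI[of _ 0]) simp
  next
    case (incl h)
    then show ?case
      using word_ball_generator by blast
  next
    case (inv h)
    then show ?case
      using word_ball_generator by blast
  next
    case (eng h1 h2)
    then show ?case
      using word_ball_mult by blast
  qed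
qed

lemma word_length_le_iff:
  assumes "x \<in> carrier G"
  shows "word_length G S x \<le> m \<longleftrightarrow> x \<in> word_ball G S m"
proof
  assume "word_length G S x \<le> m"
  moreover have "x \<in> word_ball G S (word_length G S x)"
    unfolding word_length_def using word_ball_exhaust[OF assms] by (rule LeastI_ex)
  ultimately show "x \<in> word_ball G S m"
    using word_ball_mono[of "word_length G S x" m G S] by auto
qed (simp add: word_length_def Least_le)

lemma finite_subset_word_ball:
  assumes "finite D" "D \<subseteq> carrier G"
  shows "\<exists>m. D \<subseteq> word_ball G S m"
proof -
  have "D \<subseteq> word_ball G S (Max (word_length G S ` D))"
    using assms by (auto simp flip: word_length_le_iff)
  then show ?thesis ..
qed

lemma word_length_mult_generator:
  assumes "x \<in> carrier G" "s \<in> S \<union> m_inv G ` S"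
  shows "word_length G S (x \<otimes> s) \<le> word_length G S x + 1"
proof -
  have "s \<in> carrier G"
    using assms(2) S_subset by auto
  have "x \<in> word_ball G S (word_length G S x)"
    using assms(1) by (simp flip: word_length_le_iff)
  from word_ball_mult[OF this word_ball_generator[OF assms(2)]] show ?thesis
    using assms(1) \<open>s \<in> carrier G\<close> by (simp only: word_length_le_iff m_closed)
qed

lemma word_length_edge:
  assumes "(u, v) \<in> cayley_edges G S" "g \<in> carrier G"
  shows "\<bar>real (word_length G S (inv g \<otimes> u)) - real (word_length G S (inv g \<otimes> v))\<bar> \<le> 1"
proof -
  have *: "\<bar>real (word_length G S (inv g \<otimes> x)) - real (word_length G S (inv g \<otimes> y))\<bar> \<le> 1"
    if x: "x \<in> carrier G" and s: "s \<in> S" and y: "y = x \<otimes> s" for x y s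
  proof -
    have s': "s \<in> carrier G"
      using s S_subset by auto
    have "word_length G S (inv g \<otimes> y) \<le> word_length G S (inv g \<otimes> x) + 1"
      using word_length_mult_generator[of "inv g \<otimes> x" s] x s s' assms(2) by (simp add: y m_assoc)
    moreover have "inv g \<otimes> x = inv g \<otimes> y \<otimes> inv s"
      using x s' assms(2) by (simp add: y m_assoc)
    then have "word_length G S (inv g \<otimes> x) \<le> word_length G S (inv g \<otimes> y) + 1"
      using word_length_mult_generator[of "inv g \<otimes> y" "inv s"] x s s' assms(2) by (simp add: y)
    ultimately show ?thesis
      by linarith
  qed
  from assms(1) obtain s where s: "u \<in> carrier G" "v \<in> carrier G" "s \<in> S" "v = u \<otimes> s \<or> u = v \<otimes> s"
    by (auto simp: cayley_edges_def)
  then show ?thesis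
    using *[of u s v] *[of v s u] by (auto simp: abs_minus_commute)
qed

lemma path_from_vertex:
  assumes "g \<in> carrier G" "x \<in> word_ball G S m"
  shows "\<exists>l\<le>real m. path_of_length (cayley_edges G S) (vertex g) (vertex (g \<otimes> x)) l"
  using assms(2)
proof (induction m arbitrary: x)
  case 0
  with assms(1) show ?case
    by (auto intro: path_of_length.trivial)
next
  case (Suc m)
  show ?case
  proof (cases "x \<in> word_ball G S m")
    case True
    from Suc.IH[OF this] obtain l where
      "l \<le> real m" "path_of_length (cayley_edges G S) (vertex g) (vertex (g \<otimes> x)) l"
      by blast
    then show ?thesis
      by (intro exI[of _ l]) simp
  next
    case False
    with Suc.prems obtain z s where z: "z \<in> word_ball G S m" "s \<in> S \<union> m_inv G ` S" "x = z \<otimes> s"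
      by auto
    have zs: "z \<in> carrier G" "s \<in> carrier G"
      using z word_ball_subset S_subset by auto
    obtain l where l: "l \<le> real m" "path_of_length (cayley_edges G S) (vertex g) (vertex (g \<otimes> z)) l"
      using Suc.IH[OF z(1)] by blast
    have "(g \<otimes> z, g \<otimes> x) \<in> cayley_edges G S"
    proof (cases "s \<in> S")
      case True
      with zs assms(1) show ?thesis
        by (auto simp: cayley_edges_def z(3) m_assoc intro!: bexI[of _ s])
    next
      case False
      \<comment> \<open>An inverse generator runs backwards along the edge labelled by the
        generator.\<close>
      then obtain s' where "s' \<in> S" "s = inv s'"
        using z(2) by auto
      moreover from this have "g \<otimes> z = g \<otimes> x \<otimes> s'"
        using zs assms(1) S_subset by (auto simp: z(3) m_assoc subset_iff)
      moreover have "g \<otimes> z \<in> carrier G" "g \<otimes> x \<in> carrier G"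
        using zs assms(1) by (simp_all add: z(3))
      ultimately show ?thesis
        unfolding cayley_edges_def by blast
    qed
    then have "path_of_length (cayley_edges G S) (vertex (g \<otimes> z)) (vertex (g \<otimes> x)) 1"
      using path_of_length_edge[of "g \<otimes> z" "g \<otimes> x" _ 0 1] by simp
    from path_of_length_trans[OF this l(2)] l(1) show ?thesis
      by (intro exI[of _ "l + 1"]) simp
  qed
qed

abbreviation "cdist \<equiv> cayley_dist G S"
abbreviation "points \<equiv> cayley_points G S"

lemma vertex_in_points: "g \<in> carrier G \<Longrightarrow> vertex g \<in> points"
  unfolding cayley_points_def realization_def vertex_def by force

lemma path_to_point:
  assumes "p \<in> points"
  shows "\<exists>u\<in>carrier G. \<exists>l\<le>1. path_of_length (cayley_edges G S) (vertex u) p l"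
proof -
  obtain u v t where p: "p = edge_point u v t" "u \<in> carrier G" "u = v \<or> (u, v) \<in> cayley_edges G S"
    "0 \<le> t" "t \<le> 1"
    using assms by (auto simp: cayley_points_def realization_def)
  show ?thesis
  proof (cases "u = v")
    case True
    with p show ?thesis
      by (intro bexI[of _ u] exI[of _ 0]) (auto intro: path_of_length.trivial)
  next
    case False
    with p show ?thesis
      using path_of_length_edge[of u v "cayley_edges G S" 0 t] by (intro bexI[of _ u] exI[of _ t]) auto
  qed
qed

lemma path_exists:
  assumes "p \<in> points" "q \<in> points"
  shows "\<exists>l. path_of_length (cayley_edges G S) p q l"
proof -
  obtain u v l l' where u: "u \<in> carrier G" "path_of_length (cayley_edges G S) (vertex u) p l"
    "v \<in> carrier G" "path_of_length (cayley_edges G S) (vertex v) q l'"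
    using path_to_point[OF assms(1)] path_to_point[OF assms(2)] by blast
  obtain m where "inv u \<otimes> v \<in> word_ball G S m"
    using word_ball_exhaust[of "inv u \<otimes> v"] u by auto
  then obtain k where "path_of_length (cayley_edges G S) (vertex u) (vertex (u \<otimes> (inv u \<otimes> v))) k"
    using path_from_vertex u(1) by blast
  then have "path_of_length (cayley_edges G S) (vertex u) (vertex v) k"
    using u by (simp flip: m_assoc)
  then show ?thesis
    using path_of_length_trans path_of_length_sym u(2,4) by metis
qed

lemma cdist_triangle:
  "p \<in> points \<Longrightarrow> q \<in> points \<Longrightarrow> r \<in> points \<Longrightarrow> cdist p r \<le> cdist p q + cdist q r"
  unfolding cayley_dist_def
  using path_exists[of p q] path_exists[of q r] path_dist_triangle[of "cayley_edges G S" p q _ r] by blast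

lemma cdist_sym: "cdist p q = cdist q p"
  unfolding cayley_dist_def by (rule path_dist_sym)

lemma near_vertex:
  assumes "p \<in> points"
  shows "\<exists>u\<in>carrier G. cdist (vertex u) p \<le> 1"
proof -
  obtain u l where "u \<in> carrier G" "l \<le> 1" "path_of_length (cayley_edges G S) (vertex u) p l"
    using path_to_point[OF assms] by blast
  then show ?thesis
    using path_dist_le[of "cayley_edges G S" "vertex u" p l] unfolding cayley_dist_def
    by (intro bexI[of _ u]) linarith+
qed

lemma cdist_vertex_le:
  assumes "u \<in> carrier G" "v \<in> carrier G" "inv u \<otimes> v \<in> word_ball G S m"
  shows "cdist (vertex u) (vertex v) \<le> m"
proof -
  obtain l where "l \<le> real m" "path_of_length (cayley_edges G S) (vertex u) (vertex (u \<otimes> (inv u \<otimes> v))) l"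
    using path_from_vertex assms by blast
  then show ?thesis
    using path_dist_le assms unfolding cayley_dist_def by (fastforce simp flip: m_assoc)
qed

lemma word_length_le_cdist:
  assumes "u \<in> carrier G" "v \<in> carrier G"
  shows "word_length G S (inv u \<otimes> v) \<le> cdist (vertex u) (vertex v)"
  unfolding cayley_dist_def path_dist_def
proof (rule cInf_greatest)
  show "{l. path_of_length (cayley_edges G S) (vertex u) (vertex v) l} \<noteq> {}"
    using path_exists assms vertex_in_points by auto
next
  fix l
  assume "l \<in> {l. path_of_length (cayley_edges G S) (vertex u) (vertex v) l}"
  \<comment> \<open>The word length measured from \<open>u\<close> varies by at most 1 along edges,
    vanishes at \<open>u\<close>, and has the desired value at \<open>v\<close>.\<close>
  then have "\<bar>affine_extension (\<lambda>x. word_length G S (inv u \<otimes> x)) (vertex u) -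
      affine_extension (\<lambda>x. word_length G S (inv u \<otimes> x)) (vertex v)\<bar> \<le> l"
    using word_length_edge assms(1) by (intro affine_extension_lipschitz[of "cayley_edges G S"]) auto
  moreover have "word_length G S \<one> = 0"
    using word_length_le_iff[of \<one> 0] by simp
  ultimately show "word_length G S (inv u \<otimes> v) \<le> l"
    using assms by (simp add: vertex_def affine_extension_edge_point del: edge_point_simps)
qed

lemma word_ball_if_cdist_le:
  assumes "u \<in> carrier G" "v \<in> carrier G" "cdist (vertex u) (vertex v) \<le> real m"
  shows "inv u \<otimes> v \<in> word_ball G S m"
proof -
  have "word_length G S (inv u \<otimes> v) \<le> m"
    using word_length_le_cdist[OF assms(1,2)] assms(3) by linarith
  with assms show ?thesis
    by (simp add: word_length_le_iff)
qed

end

text \<open>\<open>f\<close> moves the image of each vertex to a vertex at distance at most 1.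
  Distances between vertices agree with word lengths, so balls become the finite sets that coarse
  equivalence asks for; finiteness of \<open>S\<close> and \<open>T\<close> enters only
  there.\<close>

lemma quasi_isometric_coarse_equivalence:
  fixes G :: "('a, 'm) monoid_scheme" and H :: "('b, 'k) monoid_scheme"
  assumes "group G" "group H" "quasi_isometric_groups G H"
  obtains f where "coarse_equivalence G H f"
proof -
  obtain S T \<phi> where S: "finite S" "generating_set G S" and T: "finite T" "generating_set H T"
    and "quasi_isometry (cayley_points G S) (cayley_dist G S) (cayley_points H T) (cayley_dist H T) \<phi>"
    using assms(3) by (auto simp: quasi_isometric_groups_def)
  then obtain n where "n \<ge> 1"
    and qie: "quasi_isometric_embedding n (cayley_points G S) (cayley_dist G S)
      (cayley_points H T) (cayley_dist H T) \<phi>"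
    and qs: "quasi_surjective n (cayley_points G S) (cayley_points H T) (cayley_dist H T) \<phi>"
    by (auto simp: quasi_isometry_def)
  interpret G: generated_group G S
    using assms(1) S(2) by (simp add: generated_group_def generated_group_axioms_def)
  interpret H: generated_group H T
    using assms(2) T(2) by (simp add: generated_group_def generated_group_axioms_def)
  have \<phi>: "\<phi> x \<in> H.points" if "x \<in> G.points" for x
    using qie that by (auto simp: quasi_isometric_embedding_def)
  have upper: "H.cdist (\<phi> x) (\<phi> y) \<le> n * G.cdist x y + n" if "x \<in> G.points" "y \<in> G.points" for x y
    using qie that by (auto simp: quasi_isometric_embedding_def)
  have lower: "G.cdist x y \<le> n * (H.cdist (\<phi> x) (\<phi> y) + n)" if "x \<in> G.points" "y \<in> G.points" for x y
  proof -
    have "G.cdist x y / n \<le> H.cdist (\<phi> x) (\<phi> y) + n"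
      using qie that by (force simp: quasi_isometric_embedding_def)
    with \<open>n \<ge> 1\<close> show ?thesis
      by (simp add: field_simps)
  qed
  have "\<exists>u\<in>carrier H. H.cdist (vertex u) (\<phi> (vertex g)) \<le> 1" if "g \<in> carrier G" for g
    using H.near_vertex \<phi> G.vertex_in_points that by blast
  then obtain f where f: "\<And>g. g \<in> carrier G \<Longrightarrow> f g \<in> carrier H"
      "\<And>g. g \<in> carrier G \<Longrightarrow> H.cdist (vertex (f g)) (\<phi> (vertex g)) \<le> 1"
    by metis
  have fv: "H.cdist (vertex (f g)) q \<le> H.cdist (\<phi> (vertex g)) q + 1"
    "H.cdist (\<phi> (vertex g)) q \<le> H.cdist (vertex (f g)) q + 1"
    if "g \<in> carrier G" "q \<in> H.points" for g q
  proof -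
    have *: "vertex (f g) \<in> H.points" "\<phi> (vertex g) \<in> H.points"
      using that f \<phi> G.vertex_in_points H.vertex_in_points by auto
    show "H.cdist (vertex (f g)) q \<le> H.cdist (\<phi> (vertex g)) q + 1"
      using H.cdist_triangle[OF * that(2)] f(2)[OF that(1)] by linarith
    show "H.cdist (\<phi> (vertex g)) q \<le> H.cdist (vertex (f g)) q + 1"
      using H.cdist_triangle[OF *(2,1) that(2)] f(2)[OF that(1)]
        H.cdist_sym[of "vertex (f g)" "\<phi> (vertex g)"] by linarith
  qed
  have points: "\<phi> (vertex g) \<in> H.points" "vertex (f g) \<in> H.points" "vertex g \<in> G.points"
    if "g \<in> carrier G" for g
    using that f(1) \<phi> G.vertex_in_points H.vertex_in_points by auto
  \<comment> \<open>Each of the two end points is moved by at most 1.\<close>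
  have ff: "\<bar>H.cdist (vertex (f g)) (vertex (f g')) - H.cdist (\<phi> (vertex g)) (\<phi> (vertex g'))\<bar> \<le> 2"
    if "g \<in> carrier G" "g' \<in> carrier G" for g g'
    using fv[OF that(1) points(1)[OF that(2)]] fv[OF that(2) points(2)[OF that(1)]]
      H.cdist_sym[of "vertex (f g)" "\<phi> (vertex g')"] H.cdist_sym[of "vertex (f g)" "vertex (f g')"]
    by linarith
  have "uniformly_close G H (carrier G) (\<lambda>g. g) f"
    unfolding uniformly_close_def
  proof (intro allI impI)
    fix D :: "'a set"
    assume "finite D"
    then obtain m where m: "D \<inter> carrier G \<subseteq> word_ball G S m"
      using G.finite_subset_word_ball[of "D \<inter> carrier G"] by auto
    have "inv\<^bsub>H\<^esub> (f g) \<otimes>\<^bsub>H\<^esub> f g' \<in> word_ball H T (n * m + n + 2)"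
      if g: "g \<in> carrier G" "g' \<in> carrier G" "inv\<^bsub>G\<^esub> g \<otimes>\<^bsub>G\<^esub> g' \<in> D" for g g'
    proof (rule H.word_ball_if_cdist_le)
      have "G.cdist (vertex g) (vertex g') \<le> m"
        using g m by (intro G.cdist_vertex_le) auto
      \<comment> \<open>The radius consists of \<open>n * m + n\<close> from the upper bound for
        \<open>\<phi>\<close> and 2 from replacing \<open>\<phi>\<close> by
        \<open>f\<close>.\<close>
      then have "real n * G.cdist (vertex g) (vertex g') \<le> real n * real m"
        by (intro mult_left_mono) auto
      then show "H.cdist (vertex (f g)) (vertex (f g')) \<le> real (n * m + n + 2)"
        using ff[OF g(1,2)] upper[of "vertex g" "vertex g'"] points g by simp
    qed (use f g in auto)
    then show "\<exists>E. finite E \<and> (\<forall>x\<in>carrier G. \<forall>y\<in>carrier G.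
        inv\<^bsub>G\<^esub> x \<otimes>\<^bsub>G\<^esub> y \<in> D \<longrightarrow> inv\<^bsub>H\<^esub> (f x) \<otimes>\<^bsub>H\<^esub> f y \<in> E)"
      by (intro exI[of _ "word_ball H T (n * m + n + 2)"]) (simp add: finite_word_ball T(1))
  qed
  moreover have "uniformly_close H G (carrier G) f (\<lambda>g. g)"
    unfolding uniformly_close_def
  proof (intro allI impI)
    fix D :: "'b set"
    assume "finite D"
    then obtain m where m: "D \<inter> carrier H \<subseteq> word_ball H T m"
      using H.finite_subset_word_ball[of "D \<inter> carrier H"] by auto
    have "inv\<^bsub>G\<^esub> g \<otimes>\<^bsub>G\<^esub> g' \<in> word_ball G S (n * (m + 2 + n))"
      if g: "g \<in> carrier G" "g' \<in> carrier G" "inv\<^bsub>H\<^esub> (f g) \<otimes>\<^bsub>H\<^esub> f g' \<in> D" for g g'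
    proof (rule G.word_ball_if_cdist_le)
      have "H.cdist (vertex (f g)) (vertex (f g')) \<le> m"
        using g m f(1) by (intro H.cdist_vertex_le) auto
      \<comment> \<open>Passing from \<open>f\<close> to \<open>\<phi>\<close> costs 2; the lower
        bound, solved for the distance in \<open>G\<close>, then gives the radius.\<close>
      then have "real n * (H.cdist (\<phi> (vertex g)) (\<phi> (vertex g')) + real n) \<le> real n * (real m + 2 + real n)"
        using ff[OF g(1,2)] by (intro mult_left_mono) auto
      from order_trans[OF lower[OF points(3)[OF g(1)] points(3)[OF g(2)]] this]
      show "G.cdist (vertex g) (vertex g') \<le> real (n * (m + 2 + n))"
        by (simp only: of_nat_mult of_nat_add of_nat_numeral)
    qed (use g in auto)
    then show "\<exists>E. finite E \<and> (\<forall>x\<in>carrier G. \<forall>y\<in>carrier G.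
        inv\<^bsub>H\<^esub> (f x) \<otimes>\<^bsub>H\<^esub> f y \<in> D \<longrightarrow> inv\<^bsub>G\<^esub> x \<otimes>\<^bsub>G\<^esub> y \<in> E)"
      by (intro exI[of _ "word_ball G S (n * (m + 2 + n))"]) (simp add: finite_word_ball S(1))
  qed
  \<comment> \<open>Quasi surjectivity contributes \<open>n\<close>, replacing the point found by a
    vertex within distance 1 contributes \<open>n * 1 + n\<close>, and passing from
    \<open>\<phi>\<close> to \<open>f\<close> contributes 1.\<close>
  moreover have "finite (word_ball H T (3 * n + 1))"
    by (rule finite_word_ball[OF T(1)])
  moreover have "\<exists>g\<in>carrier G. inv\<^bsub>H\<^esub> (f g) \<otimes>\<^bsub>H\<^esub> h \<in> word_ball H T (3 * n + 1)" if h: "h \<in> carrier H" for h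
  proof -
    obtain x where x: "x \<in> G.points" "H.cdist (\<phi> x) (vertex h) \<le> n"
      using qs H.vertex_in_points[OF h] by (auto simp: quasi_surjective_def)
    obtain g where g: "g \<in> carrier G" "G.cdist (vertex g) x \<le> 1"
      using G.near_vertex[OF x(1)] by blast
    have "real n * G.cdist (vertex g) x \<le> real n * 1"
      using g(2) by (intro mult_left_mono) auto
    then have "H.cdist (\<phi> (vertex g)) (vertex h) \<le> 3 * n"
      using upper[of "vertex g" x] x g points
        H.cdist_triangle[of "\<phi> (vertex g)" "\<phi> x" "vertex h"] \<phi>[OF x(1)] H.vertex_in_points[OF h] by auto
    then have "inv\<^bsub>H\<^esub> (f g) \<otimes>\<^bsub>H\<^esub> h \<in> word_ball H T (3 * n + 1)"
      using fv(1)[OF g(1) H.vertex_in_points[OF h]] g f(1) h by (intro H.word_ball_if_cdist_le) auto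
    with g(1) show ?thesis
      by blast
  qed
  ultimately have "coarse_equivalence G H f"
    unfolding coarse_equivalence_def using f(1) by blast
  then show ?thesis
    by (rule that)
qed


section \<open>Patterns and local views\<close>

text \<open>A local view records the symbols seen along the words issuing from a fixed position.\<close>

definition matches :: "(nat list \<Rightarrow> nat) \<Rightarrow> coded_pattern \<Rightarrow> bool" where
  "matches \<tau> q \<longleftrightarrow> (\<forall>(v, x)\<in>set q. \<tau> v = x)"

text \<open>The value on words with invalid letters, where the word value is junk, is immaterial.\<close>

definition view :: "('a, 'm) monoid_scheme \<Rightarrow> 'a list \<Rightarrow> ('a \<Rightarrow> nat) \<Rightarrow> 'a \<Rightarrow> nat list \<Rightarrow> nat" where
  "view G s \<sigma> g v = (if set v \<subseteq> {..<length s} then \<sigma> (g \<otimes>\<^bsub>G\<^esub> word_value G s v) else 0)"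

definition coded_patterns :: "nat \<Rightarrow> nat \<Rightarrow> coded_pattern set" where
  "coded_patterns l a = {p. \<forall>(w, c)\<in>set p. set w \<subseteq> {..<l} \<and> c < a}"

lemma domino_instances_iff:
  "(a, ps) \<in> domino_instances l \<longleftrightarrow> set ps \<subseteq> coded_patterns l a"
  by (simp add: domino_instances_def coded_patterns_def subset_eq)

lemma matches_simps [simp]:
  "matches \<tau> []" "matches \<tau> (vx # q) \<longleftrightarrow> \<tau> (fst vx) = snd vx \<and> matches \<tau> q"
  "matches \<tau> (q @ r) \<longleftrightarrow> matches \<tau> q \<and> matches \<tau> r"
  by (simp_all add: matches_def ball_Un case_prod_unfold)

lemma coded_patterns_simps [simp]:
  "[] \<in> coded_patterns l a"
  "vx # q \<in> coded_patterns l a \<longleftrightarrow> set (fst vx) \<subseteq> {..<l} \<and> snd vx < a \<and> q \<in> coded_patterns l a"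
  "q @ r \<in> coded_patterns l a \<longleftrightarrow> q \<in> coded_patterns l a \<and> r \<in> coded_patterns l a"
  by (auto simp: coded_patterns_def)

text \<open>Membership can be tested directly on the coded lists. A list with different letters for
  one element decodes to no partial map, and it matches no view either since \<open>\<sigma>\<close>
  has one value there.\<close>

lemma (in group) mem_subshift_iff:
  assumes s: "set s \<subseteq> carrier G" and ps: "set ps \<subseteq> coded_patterns (length s) a"
  shows "\<sigma> \<in> subshift G A (decoded_patterns G s ps) \<longleftrightarrow>
    \<sigma> \<in> carrier G \<rightarrow>\<^sub>E A \<and> (\<forall>g\<in>carrier G. \<forall>p\<in>set ps. \<not> matches (view G s \<sigma> g) p)"
proof -
  have match: "matches (view G s \<sigma> g) p \<longleftrightarrow> (\<forall>(w, c)\<in>set p. \<sigma> (g \<otimes> word_value G s w) = c)"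
    if "p \<in> set ps" for g p
    unfolding matches_def
  proof (intro ball_cong refl)
    fix wc
    assume "wc \<in> set p"
    then have "set (fst wc) \<subseteq> {..<length s}"
      using ps that by (force simp: coded_patterns_def subset_eq)
    then show "(case wc of (v, x) \<Rightarrow> view G s \<sigma> g v = x) \<longleftrightarrow>
        (case wc of (w, c) \<Rightarrow> \<sigma> (g \<otimes> word_value G s w) = c)"
      by (simp add: view_def case_prod_unfold)
  qed
  have closed: "word_value G s w \<in> carrier G" if "p \<in> set ps" "(w, c) \<in> set p" for p w c
  proof (rule word_value_closed[OF s])
    show "set w \<subseteq> {..<length s}"
      using ps that unfolding coded_patterns_def by blast
  qed
  have "(\<exists>\<alpha>\<in>decoded_patterns G s ps. \<forall>x\<in>dom \<alpha>. Some (shift G \<sigma> g x) = \<alpha> x) \<longleftrightarrow>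
      (\<exists>p\<in>set ps. matches (view G s \<sigma> g) p)" if g: "g \<in> carrier G" for g
  proof safe
    fix \<alpha>
    assume "\<alpha> \<in> decoded_patterns G s ps" and \<alpha>: "\<forall>x\<in>dom \<alpha>. Some (shift G \<sigma> g x) = \<alpha> x"
    then obtain p where p: "p \<in> set ps" "Map.graph \<alpha> = (\<lambda>(w, c). (word_value G s w, c)) ` set p"
      by (auto simp: decoded_patterns_def)
    have "\<sigma> (g \<otimes> word_value G s w) = c" if wc: "(w, c) \<in> set p" for w c
    proof -
      have "(word_value G s w, c) \<in> Map.graph \<alpha>"
        using p(2) wc by force
      then have "\<alpha> (word_value G s w) = Some c"
        by (simp add: Map.graph_def)
      with \<alpha> have "shift G \<sigma> g (word_value G s w) = c"
        by force
      with closed[OF p(1) wc] show ?thesis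
        by (simp add: shift_def)
    qed
    with p(1) match show "\<exists>p\<in>set ps. matches (view G s \<sigma> g) p"
      by blast
  next
    fix p
    assume p: "p \<in> set ps" "matches (view G s \<sigma> g) p"
    \<comment> \<open>The part of the translated configuration that \<open>p\<close> looks at;
      because \<open>p\<close> matches, its graph is exactly the decoded list.\<close>
    define \<alpha> where "\<alpha> = (\<lambda>x. if x \<in> (\<lambda>wc. word_value G s (fst wc)) ` set p then Some (\<sigma> (g \<otimes> x)) else None)"
    have \<sigma>: "\<sigma> (g \<otimes> word_value G s (fst wc)) = snd wc" if "wc \<in> set p" for wc
      using p(2) that unfolding match[OF p(1)] by auto
    have "Map.graph \<alpha> = (\<lambda>wc. (word_value G s (fst wc), \<sigma> (g \<otimes> word_value G s (fst wc)))) ` set p"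
      by (auto simp: Map.graph_def \<alpha>_def split: if_splits) (force intro: rev_image_eqI)
    also have "\<dots> = (\<lambda>(w, c). (word_value G s w, c)) ` set p"
      using \<sigma> by (intro image_cong) (auto simp: case_prod_unfold)
    finally have "Map.graph \<alpha> = (\<lambda>(w, c). (word_value G s w, c)) ` set p" .
    with p(1) have "\<alpha> \<in> decoded_patterns G s ps"
      by (auto simp: decoded_patterns_def)
    moreover have "\<forall>x\<in>dom \<alpha>. Some (shift G \<sigma> g x) = \<alpha> x"
      using closed[OF p(1)] by (auto simp: \<alpha>_def shift_def split: if_splits)
    ultimately show "\<exists>\<alpha>\<in>decoded_patterns G s ps. \<forall>x\<in>dom \<alpha>. Some (shift G \<sigma> g x) = \<alpha> x"
      by blast
  qed
  then show ?thesis
    unfolding subshift_def by blast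
qed

text \<open>Base \<open>a\<close> expansion: every choice of \<open>k\<close> letters is stored in
  one number below \<open>a ^ k\<close>, by adding the letter of the last slot as leading
  digit.\<close>

lemma exists_digits:
  assumes "\<And>i. i < k \<Longrightarrow> l i < (a :: nat)"
  shows "\<exists>y<a ^ k. \<forall>i<k. y div a ^ i mod a = l i"
  using assms
proof (induction k)
  case (Suc k)
  then obtain y where y: "y < a ^ k" "\<And>i. i < k \<Longrightarrow> y div a ^ i mod a = l i"
    by auto
  have a: "a > 0"
    using Suc.prems[of k] by simp
  have "y + l k * a ^ k < (1 + l k) * a ^ k"
    using y(1) by simp
  also have "\<dots> \<le> a * a ^ k"
    using Suc.prems[of k] by (intro mult_le_mono1) simp
  finally have "y + l k * a ^ k < a ^ Suc k"
    by simp
  moreover have "(y + l k * a ^ k) div a ^ i mod a = l i" if i: "i < Suc k" for i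
  proof (cases "i = k")
    case True
    then show ?thesis
      using y(1) Suc.prems[of k] a by simp
  next
    case False
    then have i: "i < k"
      using i by simp
    \<comment> \<open>The new leading term is a multiple of \<open>a ^ Suc i\<close>, so it leaves
      digit \<open>i\<close> unchanged modulo \<open>a\<close>.\<close>
    then have "a ^ k = a ^ (k - Suc i) * a * a ^ i"
      by (metis Suc_diff_Suc add_diff_inverse_nat le_add_diff_inverse2 less_imp_le_nat nat_less_le
          power_Suc2 power_add not_less)
    then have "y + l k * a ^ k = y + (l k * a ^ (k - Suc i) * a) * a ^ i"
      by simp
    moreover have "(y + z * a ^ i) div a ^ i = y div a ^ i + z" for z
      using a by simp
    ultimately have "(y + l k * a ^ k) div a ^ i = y div a ^ i + l k * a ^ (k - Suc i) * a"
      by metis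
    then show ?thesis
      using y(2)[OF i] by simp
  qed
  ultimately show ?case
    by blast
qed simp


section \<open>Simulating one group in another\<close>

text \<open>Positions in the simulating group carry slots \<open>i < k\<close>. A base symbol \<open>b < N\<close> tells by
  \<open>act b i = 1\<close> whether slot \<open>i\<close> represents an element of the simulated group, and \<open>stp b i t\<close> is the
  displacement and the slot reached by multiplication with its generator \<open>t\<close>. A symbol \<open>x\<close> has base
  symbol \<open>x mod N\<close>, and slot \<open>i\<close> carries the \<open>i\<close>-th digit of \<open>x div N\<close> as its letter.\<close>

definition letter_at :: "nat \<Rightarrow> nat \<Rightarrow> nat \<Rightarrow> nat \<Rightarrow> nat" where
  "letter_at N a x i = x div N div a ^ i mod a"

text \<open>The default values outside a finite set make both tables computable as functions on all
  numbers. A positive \<open>N\<close> makes every symbol have a base symbol below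
  \<open>N\<close>.\<close>

locale slot_tables =
  fixes l k N :: nat and act :: "nat \<Rightarrow> nat \<Rightarrow> nat" and stp :: "nat \<Rightarrow> nat \<Rightarrow> nat \<Rightarrow> nat list \<times> nat"
  assumes finite_act: "finite {p. act (fst p) (snd p) \<noteq> 0}"
    and finite_stp: "finite {p. stp (fst p) (fst (snd p)) (snd (snd p)) \<noteq> ([], 0)}"
    and stp_word: "set (fst (stp b i t)) \<subseteq> {..<l}"
    and N_pos: "N > 0"
begin

text \<open>\<open>\<tau>\<close> is the view of base symbols from a fixed position, and the pair
  consists of a word leading away from it and a slot. Appending the displacement moves on without
  multiplying in the group.\<close>

definition step :: "(nat list \<Rightarrow> nat) \<Rightarrow> nat \<Rightarrow> nat list \<times> nat \<Rightarrow> nat list \<times> nat" where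
  "step \<tau> t p = (fst p @ fst (stp (\<tau> (fst p)) (snd p) t), snd (stp (\<tau> (fst p)) (snd p) t))"

definition walk :: "(nat list \<Rightarrow> nat) \<Rightarrow> nat list \<Rightarrow> nat list \<times> nat \<Rightarrow> nat list \<times> nat" where
  "walk \<tau> w p = fold (step \<tau>) w p"

lemma walk_simps [simp]:
  "walk \<tau> [] p = p" "walk \<tau> (t # w) p = walk \<tau> w (step \<tau> t p)"
  by (simp_all add: walk_def)

lemma walk_snoc: "walk \<tau> (w @ [t]) p = step \<tau> t (walk \<tau> w p)"
  by (simp add: walk_def)

lemma walk_word: "set (fst p) \<subseteq> {..<l} \<Longrightarrow> set (fst (walk \<tau> w p)) \<subseteq> {..<l}"
  using stp_word by (induction w arbitrary: p) (simp_all add: step_def)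

text \<open>Patterns that force a given walk, paired with its end point.\<close>

definition extend_runs ::
  "nat \<Rightarrow> (coded_pattern \<times> nat list \<times> nat) list \<Rightarrow> nat \<Rightarrow> (coded_pattern \<times> nat list \<times> nat) list" where
  "extend_runs A L t = concat (map (\<lambda>r. map (\<lambda>x. ((fst (snd r), x) # fst r,
     (fst (snd r) @ fst (stp (x mod N) (snd (snd r)) t), snd (stp (x mod N) (snd (snd r)) t)))) [0..<A]) L)"

text \<open>The tree of all guesses for the symbols met on the walk. A guess determines the next
  position; guesses that disagree on a word visited twice match no view.\<close>

definition runs :: "nat \<Rightarrow> nat \<Rightarrow> nat list \<Rightarrow> (coded_pattern \<times> nat list \<times> nat) list" where
  "runs A i w = foldl (extend_runs A) [([], ([], i))] w"

definition labelled_runs :: "nat \<Rightarrow> nat \<Rightarrow> nat \<Rightarrow> nat list \<Rightarrow> nat \<Rightarrow> coded_pattern list" where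
  "labelled_runs A a i w c = concat (map (\<lambda>r. map (\<lambda>x. (fst (snd r), x) # fst r)
     (filter (\<lambda>x. letter_at N a x (snd (snd r)) = c) [0..<A])) (runs A i w))"

text \<open>A forbidden pattern is a conjunction of prescribed symbols. That slot \<open>i\<close>
  is active and that for every pair in \<open>p\<close> some labelled run matches is a conjunction
  of disjunctions, which is multiplied out into a list of conjunctions.\<close>

definition pulled_back :: "nat \<Rightarrow> nat \<Rightarrow> nat \<Rightarrow> coded_pattern \<Rightarrow> coded_pattern list" where
  "pulled_back A a i p = foldl (\<lambda>L wc. concat (map (\<lambda>q. map (\<lambda>r. q @ r)
       (labelled_runs A a i (fst wc) (snd wc))) L))
     (map (\<lambda>x. [([], x)]) (filter (\<lambda>x. act (x mod N) i = 1) [0..<A])) p"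

text \<open>Base conditions leave the stored letters free, so each base symbol is replaced by all
  symbols above it. Their number depends on the alphabet of the instance, which is why this belongs
  to the algorithm.\<close>

definition lift_base :: "nat \<Rightarrow> coded_pattern \<Rightarrow> coded_pattern list" where
  "lift_base A q = foldl (\<lambda>L vb. concat (map (\<lambda>r. map (\<lambda>x. (fst vb, x) # r)
     (filter (\<lambda>x. x mod N = snd vb) [0..<A])) L)) [[]] q"

definition reduction ::
  "coded_pattern list \<Rightarrow> nat \<times> coded_pattern list \<Rightarrow> nat \<times> coded_pattern list" where
  "reduction P0 I = (N * fst I ^ k,
     concat (map (lift_base (N * fst I ^ k)) P0) @
     concat (map (\<lambda>p. concat (map (\<lambda>i. pulled_back (N * fst I ^ k) (fst I) i p) [0..<k])) (snd I)))"

section \<open>Computability of the reduction\<close>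

lemma computable_stp:
  assumes "computable b" "computable i" "computable t"
  shows "computable (\<lambda>x. stp (b x) (i x) (t x))"
  using computable_comp[OF computable_finite_support[OF finite_stp]
      computable_pair[OF assms(1) computable_pair[OF assms(2,3)]]] by simp

lemma computable_act:
  assumes "computable b" "computable i"
  shows "computable (\<lambda>x. act (b x) (i x))"
  using computable_comp[OF computable_finite_support[OF finite_act] computable_pair[OF assms]] by simp

lemma computable_extend_runs:
  assumes "computable A" "computable L" "computable t"
  shows "computable (\<lambda>x. extend_runs (A x) (L x) (t x))"
  unfolding extend_runs_def
  by (intro computable_intros computable_stp assms computable_comp[OF assms(1)] computable_comp[OF assms(3)])

lemma computable_runs:
  assumes "computable A" "computable i" "computable w"
  shows "computable (\<lambda>x. runs (A x) (i x) (w x))"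
  unfolding runs_def
  by (intro computable_intros computable_extend_runs assms computable_comp[OF assms(1)])

lemma computable_letter_at:
  assumes "computable a" "computable x" "computable i"
  shows "computable (\<lambda>y. letter_at N (a y) (x y) (i y))"
  unfolding letter_at_def by (intro computable_intros assms)

lemma computable_labelled_runs:
  assumes "computable A" "computable a" "computable i" "computable w" "computable c"
  shows "computable (\<lambda>x. labelled_runs (A x) (a x) (i x) (w x) (c x))"
  unfolding labelled_runs_def
  by (intro computable_intros computable_runs computable_letter_at assms
      assms[THEN computable_comp])

lemma computable_pulled_back:
  assumes "computable A" "computable a" "computable i" "computable p"
  shows "computable (\<lambda>x. pulled_back (A x) (a x) (i x) (p x))"
  unfolding pulled_back_def
  by (intro computable_intros computable_labelled_runs computable_act assms
      assms[THEN computable_comp])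

lemma computable_lift_base:
  assumes "computable A" "computable q"
  shows "computable (\<lambda>x. lift_base (A x) (q x))"
  unfolding lift_base_def
  by (intro computable_intros assms assms[THEN computable_comp])

lemma computable_reduction: "computable (reduction P0)"
  unfolding reduction_def
  by (intro computable_intros computable_lift_base computable_pulled_back)

text \<open>At each step exactly one guess agrees with \<open>\<tau>\<close>, so the matching runs
  have a single end point, namely that of the actual walk.\<close>

lemma runs_matching:
  assumes "\<And>v. \<tau> v < A"
  shows "snd ` {r \<in> set (runs A i w). matches \<tau> (fst r)} = {walk (\<lambda>v. \<tau> v mod N) w ([], i)}"
proof (induction w rule: rev_induct)
  case Nil
  then show ?case
    by (auto simp: runs_def)
next
  case (snoc t w)
  define nxt where "nxt = (\<lambda>r :: coded_pattern \<times> nat list \<times> nat. step (\<lambda>v. \<tau> v mod N) t (snd r))"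
  have "snd ` {r \<in> set (runs A i (w @ [t])). matches \<tau> (fst r)} =
      nxt ` {r \<in> set (runs A i w). matches \<tau> (fst r)}"
    using assms by (force simp: runs_def extend_runs_def nxt_def step_def image_iff)
  also have "\<dots> = step (\<lambda>v. \<tau> v mod N) t ` snd ` {r \<in> set (runs A i w). matches \<tau> (fst r)}"
    by (simp add: nxt_def image_image)
  also have "\<dots> = {walk (\<lambda>v. \<tau> v mod N) (w @ [t]) ([], i)}"
    unfolding snoc.IH by (simp add: walk_snoc)
  finally show ?case .
qed

lemma labelled_runs_matching:
  assumes "\<And>v. \<tau> v < A" and walk: "walk (\<lambda>v. \<tau> v mod N) w ([], i) = (v, j)"
  shows "(\<exists>q\<in>set (labelled_runs A a i w c). matches \<tau> q) \<longleftrightarrow> letter_at N a (\<tau> v) j = c"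
proof -
  have "(\<exists>q\<in>set (labelled_runs A a i w c). matches \<tau> q) \<longleftrightarrow>
      (\<exists>p \<in> snd ` {r \<in> set (runs A i w). matches \<tau> (fst r)}. letter_at N a (\<tau> (fst p)) (snd p) = c)"
    using assms(1) by (force simp: labelled_runs_def)
  also have "\<dots> \<longleftrightarrow> letter_at N a (\<tau> v) j = c"
    unfolding runs_matching[OF assms(1)] walk by simp
  finally show ?thesis .
qed

text \<open>A concatenation matches iff both parts do, so appending a pair to \<open>p\<close> adds
  the condition that one of its labelled runs matches.\<close>

lemma pulled_back_matching:
  assumes "\<And>v. \<tau> v < A"
  shows "(\<exists>q\<in>set (pulled_back A a i p). matches \<tau> q) \<longleftrightarrow> act (\<tau> [] mod N) i = 1 \<and>
    (\<forall>(w, c)\<in>set p. case walk (\<lambda>v. \<tau> v mod N) w ([], i) of (v, j) \<Rightarrow> letter_at N a (\<tau> v) j = c)"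
proof (induction p rule: rev_induct)
  case Nil
  then show ?case
    using assms by (auto simp: pulled_back_def)
next
  case (snoc wc p)
  obtain w c where wc: "wc = (w, c)"
    by force
  obtain v j where walk: "walk (\<lambda>v. \<tau> v mod N) w ([], i) = (v, j)"
    by force
  have "(\<exists>q\<in>set (pulled_back A a i (p @ [wc])). matches \<tau> q) \<longleftrightarrow>
      (\<exists>q\<in>set (pulled_back A a i p). matches \<tau> q) \<and> (\<exists>q\<in>set (labelled_runs A a i w c). matches \<tau> q)"
    by (auto simp: pulled_back_def wc)
  then show ?case
    unfolding snoc.IH labelled_runs_matching[OF assms walk] by (auto simp: wc walk)
qed

lemma lift_base_matching:
  assumes "\<And>v. \<tau> v < A"
  shows "(\<exists>r\<in>set (lift_base A q). matches \<tau> r) \<longleftrightarrow> matches (\<lambda>v. \<tau> v mod N) q"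
proof (induction q rule: rev_induct)
  case Nil
  then show ?case
    by (auto simp: lift_base_def)
next
  case (snoc vb q)
  have "(\<exists>r\<in>set (lift_base A (q @ [vb])). matches \<tau> r) \<longleftrightarrow>
      (\<exists>r\<in>set (lift_base A q). matches \<tau> r) \<and> \<tau> (fst vb) mod N = snd vb"
    using assms by (auto simp: lift_base_def)
  then show ?case
    unfolding snoc.IH by auto
qed

lemma runs_coded:
  "r \<in> set (runs A i w) \<Longrightarrow> fst r \<in> coded_patterns l A \<and> set (fst (snd r)) \<subseteq> {..<l}"
proof (induction w arbitrary: r rule: rev_induct)
  case (snoc t w)
  then show ?case
    using stp_word by (fastforce simp: runs_def extend_runs_def)
qed (simp add: runs_def)

lemma labelled_runs_coded: "q \<in> set (labelled_runs A a i w c) \<Longrightarrow> q \<in> coded_patterns l A"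
  using runs_coded by (fastforce simp: labelled_runs_def)

lemma pulled_back_coded: "q \<in> set (pulled_back A a i p) \<Longrightarrow> q \<in> coded_patterns l A"
proof (induction p arbitrary: q rule: rev_induct)
  case (snoc wc p)
  then show ?case
    using labelled_runs_coded by (fastforce simp: pulled_back_def)
qed (auto simp: pulled_back_def)

lemma lift_base_coded: "q \<in> coded_patterns l N \<Longrightarrow> r \<in> set (lift_base A q) \<Longrightarrow> r \<in> coded_patterns l A"
proof (induction q arbitrary: r rule: rev_induct)
  case (snoc vb q)
  then show ?case
    by (fastforce simp: lift_base_def)
qed (simp add: lift_base_def)

lemma reduction_coded:
  assumes "set P0 \<subseteq> coded_patterns l N"
  shows "reduction P0 I \<in> domino_instances l"
  using assms unfolding reduction_def domino_instances_iff
  by (auto intro: pulled_back_coded lift_base_coded)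

lemma reduction_matching:
  assumes "\<And>v. \<tau> v < N * a ^ k"
  shows "(\<exists>q\<in>set (snd (reduction P0 (a, ps))). matches \<tau> q) \<longleftrightarrow>
    (\<exists>q\<in>set P0. matches (\<lambda>v. \<tau> v mod N) q) \<or>
    (\<exists>i<k. act (\<tau> [] mod N) i = 1 \<and> (\<exists>p\<in>set ps. \<forall>(w, c)\<in>set p.
      case walk (\<lambda>v. \<tau> v mod N) w ([], i) of (v, j) \<Rightarrow> letter_at N a (\<tau> v) j = c))"
proof -
  have "(\<exists>q\<in>set (snd (reduction P0 (a, ps))). matches \<tau> q) \<longleftrightarrow>
    (\<exists>q\<in>set P0. \<exists>r\<in>set (lift_base (N * a ^ k) q). matches \<tau> r) \<or>
    (\<exists>p\<in>set ps. \<exists>i<k. \<exists>r\<in>set (pulled_back (N * a ^ k) a i p). matches \<tau> r)"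
    by (fastforce simp: reduction_def)
  then show ?thesis
    unfolding lift_base_matching[OF assms] pulled_back_matching[OF assms] by blast
qed

text \<open>Only finitely many displacements occur, so that a walk sees only finitely many positions and
  conditions on it are expressed by finitely many forbidden patterns.\<close>

lemma finite_range_stp: "finite (range (\<lambda>b. stp b i t))"
proof -
  define P where "P = {p. stp (fst p) (fst (snd p)) (snd (snd p)) \<noteq> ([], 0)}"
  have "stp b i t \<in> insert ([], 0) ((\<lambda>q. stp (fst q) (fst (snd q)) (snd (snd q))) ` P)" for b
    by (cases "stp b i t = ([], 0)") (auto simp: P_def intro!: image_eqI[of _ _ "(b, i, t)"])
  then have "range (\<lambda>b. stp b i t) \<subseteq> insert ([], 0) ((\<lambda>q. stp (fst q) (fst (snd q)) (snd (snd q))) ` P)"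
    by blast
  then show ?thesis
    by (rule finite_subset) (use finite_stp in \<open>simp add: P_def\<close>)
qed

text \<open>\<open>W\<close> must be chosen before the view is known. The first step reads the
  symbol at the current position and leads to one of finitely many positions; the sets for all of
  these are united.\<close>

lemma walk_finite_dependence:
  assumes "set (fst p) \<subseteq> {..<l}"
  shows "\<exists>W. finite W \<and> (\<forall>v\<in>W. set v \<subseteq> {..<l}) \<and>
    (\<forall>\<tau> \<tau>'. (\<forall>v\<in>W. \<tau> v = \<tau>' v) \<longrightarrow> walk \<tau> w p = walk \<tau>' w p)"
  using assms
proof (induction w arbitrary: p)
  case Nil
  show ?case
    by (rule exI[of _ "{}"]) simp
next
  case (Cons t w)
  define P where "P = range (\<lambda>b. (fst p @ fst (stp b (snd p) t), snd (stp b (snd p) t)))"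
  have "finite ((\<lambda>q. (fst p @ fst q, snd q)) ` range (\<lambda>b. stp b (snd p) t))"
    by (intro finite_imageI finite_range_stp)
  then have "finite P"
    by (simp add: P_def image_image)
  have "\<forall>q\<in>P. \<exists>W. finite W \<and> (\<forall>v\<in>W. set v \<subseteq> {..<l}) \<and>
      (\<forall>\<tau> \<tau>'. (\<forall>v\<in>W. \<tau> v = \<tau>' v) \<longrightarrow> walk \<tau> w q = walk \<tau>' w q)"
  proof
    fix q
    assume "q \<in> P"
    then have "set (fst q) \<subseteq> {..<l}"
      using Cons.prems stp_word by (force simp: P_def)
    then show "\<exists>W. finite W \<and> (\<forall>v\<in>W. set v \<subseteq> {..<l}) \<and>
        (\<forall>\<tau> \<tau>'. (\<forall>v\<in>W. \<tau> v = \<tau>' v) \<longrightarrow> walk \<tau> w q = walk \<tau>' w q)"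
      by (rule Cons.IH)
  qed
  then obtain W where W: "\<And>q. q \<in> P \<Longrightarrow> finite (W q) \<and> (\<forall>v\<in>W q. set v \<subseteq> {..<l}) \<and>
      (\<forall>\<tau> \<tau>'. (\<forall>v\<in>W q. \<tau> v = \<tau>' v) \<longrightarrow> walk \<tau> w q = walk \<tau>' w q)"
    by metis
  have "walk \<tau> (t # w) p = walk \<tau>' (t # w) p"
    if "\<forall>v\<in>insert (fst p) (\<Union>q\<in>P. W q). \<tau> v = \<tau>' v" for \<tau> \<tau>'
  proof -
    have "step \<tau> t p = step \<tau>' t p" "step \<tau> t p \<in> P"
      using that by (auto simp: step_def P_def)
    with W[of "step \<tau> t p"] that show ?thesis
      by auto
  qed
  with W Cons.prems \<open>finite P\<close> show ?case
    by (intro exI[of _ "insert (fst p) (\<Union>q\<in>P. W q)"]) auto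
qed

text \<open>The first condition excludes configurations without active slots, for which the others
  would hold vacuously; \<open>C\<close> bounds how far one may have to look. The predicate
  \<open>trivial\<close> stands for triviality in the simulating group; no algorithm for it is asked
  for.\<close>

definition valid_base ::
  "nat \<Rightarrow> nat list set \<Rightarrow> (nat list \<Rightarrow> bool) \<Rightarrow> nat list set \<Rightarrow> (nat list \<Rightarrow> nat) \<Rightarrow> bool" where
  "valid_base m C trivial rels \<tau> \<longleftrightarrow>
     (\<exists>c\<in>C. \<exists>i<k. act (\<tau> c) i = 1) \<and>
     (\<forall>i<k. act (\<tau> []) i = 1 \<longrightarrow>
        (\<forall>t<m. case walk \<tau> [t] ([], i) of (v, j) \<Rightarrow> j < k \<and> act (\<tau> v) j = 1) \<and>
        (\<forall>r\<in>rels. case walk \<tau> r ([], i) of (v, j) \<Rightarrow> trivial v \<and> j = i))"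

lemma valid_base_finite_dependence:
  assumes "finite C" "\<And>c. c \<in> C \<Longrightarrow> set c \<subseteq> {..<l}" "finite rels"
  shows "\<exists>W. finite W \<and> (\<forall>v\<in>W. set v \<subseteq> {..<l}) \<and>
    (\<forall>\<tau> \<tau>'. (\<forall>v\<in>W. \<tau> v = \<tau>' v) \<longrightarrow> valid_base m C trivial rels \<tau> = valid_base m C trivial rels \<tau>')"
proof -
  have "\<forall>w i. \<exists>W. finite W \<and> (\<forall>v\<in>W. set v \<subseteq> {..<l}) \<and>
      (\<forall>\<tau> \<tau>'. (\<forall>v\<in>W. \<tau> v = \<tau>' v) \<longrightarrow> walk \<tau> w ([], i) = walk \<tau>' w ([], i))"
    by (intro allI walk_finite_dependence) simp
  then obtain W where W: "\<And>w i. finite (W w i)" "\<And>w i v. v \<in> W w i \<Longrightarrow> set v \<subseteq> {..<l}"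
    "\<And>w i \<tau> \<tau>'. (\<And>v. v \<in> W w i \<Longrightarrow> \<tau> v = \<tau>' v) \<Longrightarrow> walk \<tau> w ([], i) = walk \<tau>' w ([], i)"
    by metis
  \<comment> \<open>Besides the symbols read during the walk, the condition on generators inspects
    the symbol at its end point, so the possible end points belong to the window.\<close>
  define ends where "ends = (\<lambda>t i. range (\<lambda>\<tau>. fst (walk \<tau> [t] ([], i))))"
  have fin_ends: "finite (ends t i)" for t i
  proof (rule finite_subset)
    show "ends t i \<subseteq> fst ` range (\<lambda>b. stp b i t)"
      by (auto simp: ends_def step_def)
  qed (intro finite_imageI finite_range_stp)
  define V where "V = insert [] (C \<union> (\<Union>t<m. \<Union>i<k. W [t] i \<union> ends t i) \<union> (\<Union>r\<in>rels. \<Union>i<k. W r i))"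
  have "finite V"
    using assms W(1) fin_ends by (auto simp: V_def)
  moreover have "\<forall>v\<in>V. set v \<subseteq> {..<l}"
  proof
    fix v
    assume "v \<in> V"
    then consider "v = []" | "v \<in> C" | w i where "v \<in> W w i" | t i where "v \<in> ends t i"
      by (auto simp: V_def)
    then show "set v \<subseteq> {..<l}"
    proof cases
      case 4
      then show ?thesis
        using walk_word[of "([], i)"] by (auto simp: ends_def simp del: walk_simps)
    qed (use assms(2) W(2) in simp_all)
  qed
  moreover have "valid_base m C trivial rels \<tau> = valid_base m C trivial rels \<tau>'"
    if eq: "\<forall>v\<in>V. \<tau> v = \<tau>' v" for \<tau> \<tau>'
  proof -
    have C: "\<tau> [] = \<tau>' []" "\<And>c. c \<in> C \<Longrightarrow> \<tau> c = \<tau>' c"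
      using eq by (auto simp: V_def)
    have rels: "walk \<tau> r ([], i) = walk \<tau>' r ([], i)" if "r \<in> rels" "i < k" for r i
      using eq that by (intro W(3)) (auto simp: V_def)
    have gens: "walk \<tau> [t] ([], i) = walk \<tau>' [t] ([], i)" if "t < m" "i < k" for t i
      using eq that by (intro W(3)) (auto simp: V_def)
    have ends: "\<tau> (fst (walk \<tau>' [t] ([], i))) = \<tau>' (fst (walk \<tau>' [t] ([], i)))" if "t < m" "i < k" for t i
      using eq that by (force simp: V_def ends_def)
    show ?thesis
      unfolding valid_base_def case_prod_unfold using C rels gens ends by (simp cong: conj_cong imp_cong bex_cong)
  qed
  ultimately show ?thesis
    by blast
qed

text \<open>A condition depending on a finite window is the exclusion of finitely many patterns, one
  for each way to fill the window that violates it. \<open>P0\<close> need not be found effectively,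
  since it is a constant of the reduction.\<close>

lemma valid_base_patterns:
  assumes "finite C" "\<And>c. c \<in> C \<Longrightarrow> set c \<subseteq> {..<l}" "finite rels"
  obtains P0 where "set P0 \<subseteq> coded_patterns l N"
    "\<And>\<tau>. (\<And>v. \<tau> v < N) \<Longrightarrow> (\<exists>q\<in>set P0. matches \<tau> q) \<longleftrightarrow> \<not> valid_base m C trivial rels \<tau>"
proof -
  obtain W where W: "finite W" "\<And>v. v \<in> W \<Longrightarrow> set v \<subseteq> {..<l}"
    "\<And>\<tau> \<tau>'. (\<And>v. v \<in> W \<Longrightarrow> \<tau> v = \<tau>' v) \<Longrightarrow> valid_base m C trivial rels \<tau> = valid_base m C trivial rels \<tau>'"
    using valid_base_finite_dependence[OF assms, of m trivial] by metis
  obtain ws where ws: "set ws = W"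
    using finite_list[OF W(1)] by blast
  define Q where "Q = {q. \<exists>\<tau>. (\<forall>v. \<tau> v < N) \<and> \<not> valid_base m C trivial rels \<tau> \<and> q = map (\<lambda>v. (v, \<tau> v)) ws}"
  have "Q \<subseteq> {q. set q \<subseteq> W \<times> {..<N} \<and> length q = length ws}"
    using ws by (auto simp: Q_def)
  then have "finite Q"
    by (rule finite_subset) (use W(1) in \<open>simp add: finite_lists_length_eq\<close>)
  then obtain P0 where P0: "set P0 = Q"
    using finite_list by blast
  show ?thesis
  proof (rule that)
    show "set P0 \<subseteq> coded_patterns l N"
      unfolding P0
    proof
      fix q
      assume "q \<in> Q"
      then obtain \<tau> where "\<And>v. \<tau> v < N" "q = map (\<lambda>v. (v, \<tau> v)) ws"
        by (auto simp: Q_def)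
      with W(2) ws show "q \<in> coded_patterns l N"
        by (simp add: coded_patterns_def)
    qed
    fix \<tau> :: "nat list \<Rightarrow> nat"
    assume \<tau>: "\<And>v. \<tau> v < N"
    have "valid_base m C trivial rels \<tau> = valid_base m C trivial rels \<tau>'"
      if "matches \<tau> (map (\<lambda>v. (v, \<tau>' v)) ws)" for \<tau>'
      using that ws by (intro W(3)) (auto simp: matches_def)
    moreover have "matches \<tau> (map (\<lambda>v. (v, \<tau> v)) ws)"
      by (simp add: matches_def)
    ultimately show "(\<exists>q\<in>set P0. matches \<tau> q) \<longleftrightarrow> \<not> valid_base m C trivial rels \<tau>"
      unfolding P0 Q_def using \<tau> by blast
  qed
qed

end

text \<open>The base symbols are an enumeration of all tables with displacements in \<open>D\<close>.\<close>

lemma exists_slot_tables: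
  assumes "finite D" "D \<noteq> {}" "\<And>v. v \<in> D \<Longrightarrow> set v \<subseteq> {..<l}" "k > 0"
  obtains N act stp where "slot_tables l N act stp"
    "\<And>X M. \<lbrakk>\<And>i t. i < k \<Longrightarrow> t < m \<Longrightarrow> M i t \<in> D \<times> {..<k}\<rbrakk> \<Longrightarrow>
      \<exists>b<N. \<forall>i<k. (act b i = 1 \<longleftrightarrow> X i) \<and> (\<forall>t<m. stp b i t = M i t)"
proof -
  define T where "T = ({..<k} \<rightarrow>\<^sub>E (UNIV :: bool set)) \<times> ({..<k} \<times> {..<m} \<rightarrow>\<^sub>E D \<times> {..<k})"
  have "finite T"
    unfolding T_def using assms(1) by (intro finite_SigmaI finite_PiE) auto
  \<comment> \<open>This makes \<open>N\<close> positive. It is the reason why \<open>D\<close> has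
    to be nonempty.\<close>
  have "T \<noteq> {}"
    unfolding T_def using assms(2,4) by (auto simp: PiE_eq_empty_iff)
  obtain e where e: "bij_betw e {0..<card T} T"
    using ex_bij_betw_nat_finite[OF \<open>finite T\<close>] by blast
  define N where "N = card T"
  define act where "act = (\<lambda>b i. if b < N \<and> i < k \<and> fst (e b) i then 1 else 0 :: nat)"
  define stp where "stp = (\<lambda>b i t. if b < N \<and> i < k \<and> t < m then snd (e b) (i, t) else ([], 0))"
  have eT: "e b \<in> T" if "b < N" for b
    using e that by (auto simp: bij_betw_def N_def)
  show ?thesis
  proof (rule that)
    show "slot_tables l N act stp"
    proof
      show "finite {p. act (fst p) (snd p) \<noteq> 0}"
        by (rule finite_subset[of _ "{..<N} \<times> {..<k}"]) (auto simp: act_def split: if_splits)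
      show "finite {p. stp (fst p) (fst (snd p)) (snd (snd p)) \<noteq> ([], 0)}"
        by (rule finite_subset[of _ "{..<N} \<times> {..<k} \<times> {..<m}"]) (auto simp: stp_def split: if_splits)
      show "set (fst (stp b i t)) \<subseteq> {..<l}" for b i t
      proof (cases "b < N \<and> i < k \<and> t < m")
        case True
        then have "snd (e b) (i, t) \<in> D \<times> {..<k}"
          using eT[of b] by (auto simp: T_def PiE_iff)
        with assms(3)[of "fst (snd (e b) (i, t))"] True show ?thesis
          by (simp add: stp_def mem_Times_iff)
      qed (auto simp: stp_def)
      show "0 < N"
        using \<open>finite T\<close> \<open>T \<noteq> {}\<close> by (simp add: N_def card_gt_0_iff)
    qed
    fix X :: "nat \<Rightarrow> bool" and M :: "nat \<Rightarrow> nat \<Rightarrow> nat list \<times> nat"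
    assume M: "\<And>i t. i < k \<Longrightarrow> t < m \<Longrightarrow> M i t \<in> D \<times> {..<k}"
    have "(restrict X {..<k}, \<lambda>(i, t)\<in>{..<k} \<times> {..<m}. M i t) \<in> T"
      using M by (auto simp: T_def)
    then have "(restrict X {..<k}, \<lambda>(i, t)\<in>{..<k} \<times> {..<m}. M i t) \<in> e ` {0..<card T}"
      using e by (simp add: bij_betw_def)
    then obtain b where "b < N" "e b = (restrict X {..<k}, \<lambda>(i, t)\<in>{..<k} \<times> {..<m}. M i t)"
      by (auto simp: N_def)
    then show "\<exists>b<N. \<forall>i<k. (act b i = 1 \<longleftrightarrow> X i) \<and> (\<forall>t<m. stp b i t = M i t)"
      by (intro exI[of _ b]) (auto simp: act_def stp_def)
  qed
qed


lemma (in group) view_less: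
  assumes "set s \<subseteq> carrier G" "g \<in> carrier G" "\<sigma> \<in> carrier G \<rightarrow> {..<A}"
  shows "view G s \<sigma> g v < A"
proof -
  have "\<sigma> g < A"
    using assms by auto
  then have "A > 0"
    by simp
  with assms show ?thesis
    by (auto simp: view_def)
qed

text \<open>\<open>F\<close>, \<open>slot\<close>, \<open>D\<close> and \<open>tables\<close> encode
  a configuration of \<open>H\<close> in \<open>G\<close>, with \<open>F\<close> and
  \<open>slot\<close> jointly injective; \<open>rels\<close> and \<open>action\<close> decode.
  \<open>action\<close> is the universal property of the presentation, for actions on pairs of
  position and slot. \<open>C\<close> supplies active slots near every position.\<close>

locale simulation =
  slot_tables "length s" k N act stp + G: group G + H: group H
  for G :: "('a, 'm) monoid_scheme" and H :: "('b, 'n) monoid_scheme"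
    and s :: "'a list" and u :: "'b list" and k N act stp +
  fixes F :: "'b \<Rightarrow> 'a" and slot :: "'b \<Rightarrow> nat" and D C rels :: "nat list set"
    and P0 :: "coded_pattern list"
  assumes s: "set s \<subseteq> carrier G"
    and u: "generating_set H (set u)" "\<forall>x\<in>set u. inv\<^bsub>H\<^esub> x \<in> set u"
    and rels: "\<And>r. r \<in> rels \<Longrightarrow> set r \<subseteq> {..<length u}" "\<And>r. r \<in> rels \<Longrightarrow> word_value H u r = \<one>\<^bsub>H\<^esub>"
    and action: "\<And>(\<Omega> :: ('a \<times> nat) set) \<phi> v w p. \<lbrakk>\<And>t. t < length u \<Longrightarrow> \<phi> t \<in> \<Omega> \<rightarrow> \<Omega>;
        \<And>r p. r \<in> rels \<Longrightarrow> p \<in> \<Omega> \<Longrightarrow> fold \<phi> r p = p;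
        set v \<subseteq> {..<length u}; set w \<subseteq> {..<length u}; word_value H u v = word_value H u w;
        p \<in> \<Omega>\<rbrakk> \<Longrightarrow> fold \<phi> v p = fold \<phi> w p"
    and F: "\<And>h. h \<in> carrier H \<Longrightarrow> F h \<in> carrier G"
    and slot: "\<And>h. h \<in> carrier H \<Longrightarrow> slot h < k"
      "\<And>h h'. \<lbrakk>h \<in> carrier H; h' \<in> carrier H; F h = F h'; slot h = slot h'\<rbrakk> \<Longrightarrow> h = h'"
    and D: "\<And>v. v \<in> D \<Longrightarrow> set v \<subseteq> {..<length s}"
      "\<And>h t. h \<in> carrier H \<Longrightarrow> t < length u \<Longrightarrow>
        \<exists>v\<in>D. F (h \<otimes>\<^bsub>H\<^esub> u ! t) = F h \<otimes>\<^bsub>G\<^esub> word_value G s v"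
    and C: "\<And>v. v \<in> C \<Longrightarrow> set v \<subseteq> {..<length s}"
      "\<And>g. g \<in> carrier G \<Longrightarrow> \<exists>c\<in>C. \<exists>h\<in>carrier H. F h = g \<otimes>\<^bsub>G\<^esub> word_value G s c"
    and tables: "\<And>X M. \<lbrakk>\<And>i t. i < k \<Longrightarrow> t < length u \<Longrightarrow> M i t \<in> D \<times> {..<k}\<rbrakk> \<Longrightarrow>
      \<exists>b<N. \<forall>i<k. (act b i = 1 \<longleftrightarrow> X i) \<and> (\<forall>t<length u. stp b i t = M i t)"
    and P0: "set P0 \<subseteq> coded_patterns (length s) N"
      "\<And>\<tau>. (\<And>v. \<tau> v < N) \<Longrightarrow> (\<exists>q\<in>set P0. matches \<tau> q) \<longleftrightarrow>
        \<not> valid_base (length u) C (\<lambda>v. word_value G s v = \<one>\<^bsub>G\<^esub>) rels \<tau>"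
begin

lemma u_subset: "set u \<subseteq> carrier H"
  using u(1) by (simp add: generating_set_def)

lemma mem_simulating_subshift_iff:
  "\<sigma> \<in> subshift G {..<N * a ^ k} (decoded_patterns G s (snd (reduction P0 (a, ps)))) \<longleftrightarrow>
    \<sigma> \<in> carrier G \<rightarrow>\<^sub>E {..<N * a ^ k} \<and> (\<forall>g\<in>carrier G.
      valid_base (length u) C (\<lambda>v. word_value G s v = \<one>\<^bsub>G\<^esub>) rels (\<lambda>v. view G s \<sigma> g v mod N) \<and>
      \<not> (\<exists>i<k. act (\<sigma> g mod N) i = 1 \<and> (\<exists>p\<in>set ps. \<forall>(w, c)\<in>set p.
        case walk (\<lambda>v. view G s \<sigma> g v mod N) w ([], i) of
          (v, j) \<Rightarrow> letter_at N a (\<sigma> (g \<otimes>\<^bsub>G\<^esub> word_value G s v)) j = c)))"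
proof -
  have coded: "set (snd (reduction P0 (a, ps))) \<subseteq> coded_patterns (length s) (N * a ^ k)"
    using reduction_coded[OF P0(1), of "(a, ps)"]
    by (cases "reduction P0 (a, ps)") (auto simp: domino_instances_iff reduction_def)
  have "(\<forall>p\<in>set (snd (reduction P0 (a, ps))). \<not> matches (view G s \<sigma> g) p) \<longleftrightarrow>
      valid_base (length u) C (\<lambda>v. word_value G s v = \<one>\<^bsub>G\<^esub>) rels (\<lambda>v. view G s \<sigma> g v mod N) \<and>
      \<not> (\<exists>i<k. act (\<sigma> g mod N) i = 1 \<and> (\<exists>p\<in>set ps. \<forall>(w, c)\<in>set p.
        case walk (\<lambda>v. view G s \<sigma> g v mod N) w ([], i) of
          (v, j) \<Rightarrow> letter_at N a (\<sigma> (g \<otimes>\<^bsub>G\<^esub> word_value G s v)) j = c))"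
    if \<sigma>: "\<sigma> \<in> carrier G \<rightarrow>\<^sub>E {..<N * a ^ k}" and g: "g \<in> carrier G" for g
  proof -
    have less: "view G s \<sigma> g v < N * a ^ k" for v
      using \<sigma> by (intro G.view_less s g) auto
    have "view G s \<sigma> g [] = \<sigma> g"
      using g by (simp add: view_def)
    moreover have "view G s \<sigma> g (fst (walk \<tau> w ([], i))) =
        \<sigma> (g \<otimes>\<^bsub>G\<^esub> word_value G s (fst (walk \<tau> w ([], i))))" for \<tau> w i
      using walk_word[of "([], i)"] by (simp add: view_def)
    moreover have "(\<forall>p\<in>set (snd (reduction P0 (a, ps))). \<not> matches (view G s \<sigma> g) p) \<longleftrightarrow>
        \<not> (\<exists>p\<in>set (snd (reduction P0 (a, ps))). matches (view G s \<sigma> g) p)"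
      by blast
    ultimately show ?thesis
      unfolding reduction_matching[OF less] case_prod_unfold using P0(2) N_pos by simp
  qed
  then show ?thesis
    unfolding G.mem_subshift_iff[OF s coded] by blast
qed

text \<open>The tables in \<open>\<sigma>\<close> let \<open>H\<close> act on the set
  \<open>\<Omega>\<close> of active pairs, and \<open>y\<close> reads the letters along the orbit of
  one pair. A pattern at \<open>h\<close> becomes a pulled back pattern at the position belonging to
  \<open>h\<close>, which \<open>\<sigma>\<close> avoids.\<close>

lemma simulated_configuration:
  assumes ps: "set ps \<subseteq> coded_patterns (length u) a"
    and \<sigma>: "\<sigma> \<in> subshift G {..<N * a ^ k} (decoded_patterns G s (snd (reduction P0 (a, ps))))"
  shows "subshift H {..<a} (decoded_patterns H u ps) \<noteq> {}"
proof -
  define \<tau> where "\<tau> = (\<lambda>g v. view G s \<sigma> g v mod N)"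
  have \<sigma>_PiE: "\<sigma> \<in> carrier G \<rightarrow>\<^sub>E {..<N * a ^ k}"
    and valid: "\<And>g. g \<in> carrier G \<Longrightarrow>
      valid_base (length u) C (\<lambda>v. word_value G s v = \<one>\<^bsub>G\<^esub>) rels (\<tau> g)"
    and avoids: "\<And>g i p. \<lbrakk>g \<in> carrier G; i < k; act (\<sigma> g mod N) i = 1; p \<in> set ps\<rbrakk> \<Longrightarrow>
      \<exists>(w, c)\<in>set p. case walk (\<tau> g) w ([], i) of
        (v, j) \<Rightarrow> letter_at N a (\<sigma> (g \<otimes>\<^bsub>G\<^esub> word_value G s v)) j \<noteq> c"
    using \<sigma> unfolding mem_simulating_subshift_iff \<tau>_def by (blast, blast, fastforce)
  \<comment> \<open>The counterpart of \<open>step\<close> with genuine group elements as positions,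
    reading \<open>\<sigma>\<close> itself.\<close>
  define \<phi> where "\<phi> = (\<lambda>t p. (fst p \<otimes>\<^bsub>G\<^esub> word_value G s (fst (stp (\<sigma> (fst p) mod N) (snd p) t)),
    snd (stp (\<sigma> (fst p) mod N) (snd p) t)))"
  \<comment> \<open>Walks in the view from \<open>g\<close> compute the motion under
    \<open>\<phi>\<close>; this translates the local conditions into statements about the
    action.\<close>
  have fold_\<phi>: "fold \<phi> w (g \<otimes>\<^bsub>G\<^esub> word_value G s v, i) =
      (g \<otimes>\<^bsub>G\<^esub> word_value G s (fst (walk (\<tau> g) w (v, i))), snd (walk (\<tau> g) w (v, i)))"
    if "g \<in> carrier G" "set v \<subseteq> {..<length s}" for g v w i
    using that(2)
  proof (induction w arbitrary: v i)
    case (Cons t w)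
    define d j where "d = fst (stp (\<tau> g v) i t)" and "j = snd (stp (\<tau> g v) i t)"
    have d: "set d \<subseteq> {..<length s}"
      by (simp add: d_def stp_word)
    have \<tau>: "\<tau> g v = \<sigma> (g \<otimes>\<^bsub>G\<^esub> word_value G s v) mod N"
      using Cons.prems by (simp add: \<tau>_def view_def)
    have "\<phi> t (g \<otimes>\<^bsub>G\<^esub> word_value G s v, i) = (g \<otimes>\<^bsub>G\<^esub> word_value G s (v @ d), j)"
      using that(1) s d Cons.prems by (simp add: \<phi>_def G.word_value_append G.m_assoc d_def j_def \<tau>)
    moreover have "step (\<tau> g) t (v, i) = (v @ d, j)"
      by (simp add: step_def d_def j_def)
    ultimately show ?case
      using Cons.IH[of "v @ d" j] Cons.prems d by simp
  qed simp
  have fold_\<phi>_start: "fold \<phi> w (g, i) =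
      (g \<otimes>\<^bsub>G\<^esub> word_value G s (fst (walk (\<tau> g) w ([], i))), snd (walk (\<tau> g) w ([], i)))"
    if "g \<in> carrier G" for g w i
    using fold_\<phi>[OF that, of "[]" w i] that by simp
  define \<Omega> where "\<Omega> = {(g, i). g \<in> carrier G \<and> i < k \<and> act (\<sigma> g mod N) i = 1}"
  have \<tau>: "\<tau> g v = \<sigma> (g \<otimes>\<^bsub>G\<^esub> word_value G s v) mod N" if "set v \<subseteq> {..<length s}" for g v
    using that by (simp add: \<tau>_def view_def)
  have walk_closed: "set (fst (walk \<rho> w ([], i))) \<subseteq> {..<length s}" for \<rho> w i
    by (rule walk_word) simp
  have \<phi>_closed: "\<phi> t \<in> \<Omega> \<rightarrow> \<Omega>" if t: "t < length u" for t
  proof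
    fix p
    assume "p \<in> \<Omega>"
    then obtain g i where p: "p = (g, i)" "g \<in> carrier G" "i < k" "act (\<sigma> g mod N) i = 1"
      by (auto simp: \<Omega>_def)
    have "act (\<tau> g []) i = 1"
      using p by (simp add: \<tau>)
    then have "snd (walk (\<tau> g) [t] ([], i)) < k"
      "act (\<tau> g (fst (walk (\<tau> g) [t] ([], i)))) (snd (walk (\<tau> g) [t] ([], i))) = 1"
      using valid[OF p(2)] p(3) t unfolding valid_base_def case_prod_unfold by blast+
    then have "fold \<phi> [t] (g, i) \<in> \<Omega>"
      unfolding fold_\<phi>_start[OF p(2)] \<tau>[OF walk_closed] using p(2) s walk_closed
      by (simp add: \<Omega>_def del: walk_simps)
    then show "\<phi> t p \<in> \<Omega>"
      by (simp add: p)
  qed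
  have \<phi>_rels: "fold \<phi> r p = p" if r: "r \<in> rels" and "p \<in> \<Omega>" for r p
  proof -
    obtain g i where p: "p = (g, i)" "g \<in> carrier G" "i < k" "act (\<sigma> g mod N) i = 1"
      using \<open>p \<in> \<Omega>\<close> by (auto simp: \<Omega>_def)
    have "act (\<tau> g []) i = 1"
      using p by (simp add: \<tau>)
    then have "word_value G s (fst (walk (\<tau> g) r ([], i))) = \<one>\<^bsub>G\<^esub>" "snd (walk (\<tau> g) r ([], i)) = i"
      using valid[OF p(2)] p(3) r unfolding valid_base_def case_prod_unfold by blast+
    then show ?thesis
      unfolding p(1) fold_\<phi>_start[OF p(2)] using p(2) by simp
  qed
  \<comment> \<open>Coarse density at the identity supplies the starting pair of the orbit.\<close>
  obtain c i0 where c: "c \<in> C" "i0 < k" "act (\<tau> \<one>\<^bsub>G\<^esub> c) i0 = 1"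
    using valid[OF G.one_closed] unfolding valid_base_def by blast
  define p0 where "p0 = (\<one>\<^bsub>G\<^esub> \<otimes>\<^bsub>G\<^esub> word_value G s c, i0)"
  have p0: "p0 \<in> \<Omega>"
    using c C(1) s by (simp add: p0_def \<Omega>_def \<tau>)
  obtain word where word: "\<And>h. h \<in> carrier H \<Longrightarrow> set (word h) \<subseteq> {..<length u}"
      "\<And>h. h \<in> carrier H \<Longrightarrow> word_value H u (word h) = h"
    using H.word_exists[OF u] by metis
  define pos where "pos = (\<lambda>h. fold \<phi> (word h) p0)"
  define y where "y = (\<lambda>h\<in>carrier H. letter_at N a (\<sigma> (fst (pos h))) (snd (pos h)))"
  have pos: "pos h \<in> \<Omega>" if "h \<in> carrier H" for h
    unfolding pos_def using word(1)[OF that] \<phi>_closed p0 by (intro fold_closed) auto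
  \<comment> \<open>Independence of the chosen words, by \<open>action\<close>. Right multiplication
    in \<open>H\<close> becomes a further application of \<open>\<phi>\<close>, as needed because
    patterns at \<open>h\<close> look at \<open>h \<otimes> w\<close>.\<close>
  have pos_mult: "pos (h \<otimes>\<^bsub>H\<^esub> word_value H u w) = fold \<phi> w (pos h)"
    if h: "h \<in> carrier H" and w: "set w \<subseteq> {..<length u}" for h w
  proof -
    have closed: "h \<otimes>\<^bsub>H\<^esub> word_value H u w \<in> carrier H"
      using h w u_subset by simp
    have "fold \<phi> (word (h \<otimes>\<^bsub>H\<^esub> word_value H u w)) p0 = fold \<phi> (word h @ w) p0"
    proof (rule action[where \<Omega> = \<Omega>])
      show "word_value H u (word (h \<otimes>\<^bsub>H\<^esub> word_value H u w)) = word_value H u (word h @ w)"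
        using word(2)[OF closed] word[OF h] w u_subset by (simp add: H.word_value_append)
    qed (use \<phi>_closed \<phi>_rels word(1)[OF closed] word(1)[OF h] w p0 in auto)
    then show ?thesis
      by (simp add: pos_def)
  qed
  have "\<sigma> (fst p0) < N * a ^ k"
    using p0 \<sigma>_PiE by (auto simp: \<Omega>_def)
  \<comment> \<open>A symbol exists, and \<open>i0 < k\<close> makes \<open>k\<close> positive, so
    \<open>a = 0\<close> would give the empty alphabet \<open>N * 0 ^ k = 0\<close>.\<close>
  then have "a > 0"
    using c(2) by (cases "a = 0") (auto simp: power_0_left)
  then have "y \<in> carrier H \<rightarrow>\<^sub>E {..<a}"
    by (auto simp: y_def letter_at_def)
  moreover have "\<not> matches (view H u y h) p" if h: "h \<in> carrier H" and p: "p \<in> set ps" for h p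
  proof
    assume match: "matches (view H u y h) p"
    obtain g i where gi: "pos h = (g, i)" "g \<in> carrier G" "i < k" "act (\<sigma> g mod N) i = 1"
      using pos[OF h] by (auto simp: \<Omega>_def)
    obtain w c where wc: "(w, c) \<in> set p" and
      neq: "letter_at N a (\<sigma> (g \<otimes>\<^bsub>G\<^esub> word_value G s (fst (walk (\<tau> g) w ([], i)))))
        (snd (walk (\<tau> g) w ([], i))) \<noteq> c"
      using avoids[OF gi(2-4) p] unfolding case_prod_unfold by (metis prod.collapse)
    have w: "set w \<subseteq> {..<length u}"
      using wc p ps unfolding coded_patterns_def by blast
    have "view H u y h w = y (h \<otimes>\<^bsub>H\<^esub> word_value H u w)"
      using w by (simp add: view_def)
    also have "\<dots> = letter_at N a (\<sigma> (fst (fold \<phi> w (g, i)))) (snd (fold \<phi> w (g, i)))"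
      using h w u_subset by (simp add: y_def pos_mult gi(1))
    also have "\<dots> \<noteq> c"
      using neq unfolding fold_\<phi>_start[OF gi(2)] by simp
    finally show False
      using match wc by (auto simp: matches_def)
  qed
  ultimately have "y \<in> subshift H {..<a} (decoded_patterns H u ps)"
    unfolding H.mem_subshift_iff[OF u_subset ps] by blast
  then show ?thesis
    by blast
qed

text \<open>The symbol at \<open>g\<close> describes the fibre of \<open>F\<close> over
  \<open>g\<close>: the slots occupied by its elements, where the generators of \<open>H\<close>
  send them, and their letters. Walks then follow multiplication in \<open>H\<close>, so the
  relators and the forbidden patterns are inherited from \<open>H\<close> and
  \<open>y\<close>.\<close>

lemma simulating_configuration:
  assumes ps: "set ps \<subseteq> coded_patterns (length u) a"
    and y: "y \<in> subshift H {..<a} (decoded_patterns H u ps)"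
  shows "subshift G {..<N * a ^ k} (decoded_patterns G s (snd (reduction P0 (a, ps)))) \<noteq> {}"
proof -
  have y_PiE: "y \<in> carrier H \<rightarrow>\<^sub>E {..<a}"
    and avoids: "\<And>h p. h \<in> carrier H \<Longrightarrow> p \<in> set ps \<Longrightarrow> \<not> matches (view H u y h) p"
    using y unfolding H.mem_subshift_iff[OF u_subset ps] by auto
  have y_less: "y h < a" if "h \<in> carrier H" for h
    using y_PiE that by auto
  obtain wd where wd: "\<And>h t. h \<in> carrier H \<Longrightarrow> t < length u \<Longrightarrow> wd h t \<in> D"
      "\<And>h t. h \<in> carrier H \<Longrightarrow> t < length u \<Longrightarrow>
        F (h \<otimes>\<^bsub>H\<^esub> u ! t) = F h \<otimes>\<^bsub>G\<^esub> word_value G s (wd h t)"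
    using D(2) by metis
  have ut: "u ! t \<in> carrier H" if "t < length u" for t
    using u_subset that nth_mem by blast
  have "\<exists>x<N * a ^ k. (\<forall>i<k. act (x mod N) i = 1 \<longleftrightarrow> (\<exists>h\<in>carrier H. F h = g \<and> slot h = i)) \<and>
      (\<forall>h\<in>carrier H. F h = g \<longrightarrow> letter_at N a x (slot h) = y h \<and>
        (\<forall>t<length u. stp (x mod N) (slot h) t = (wd h t, slot (h \<otimes>\<^bsub>H\<^esub> u ! t))))" for g
  proof -
    \<comment> \<open>The element in slot \<open>i\<close> over \<open>g\<close>. The tables also
      need legitimate entries for unoccupied slots, for which the identity serves as a
      dummy.\<close>
    define el where "el = (\<lambda>i. if \<exists>h\<in>carrier H. F h = g \<and> slot h = i
      then SOME h. h \<in> carrier H \<and> F h = g \<and> slot h = i else \<one>\<^bsub>H\<^esub>)"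
    have el: "el (slot h) = h" if "h \<in> carrier H" "F h = g" for h
    proof -
      have "(SOME h'. h' \<in> carrier H \<and> F h' = g \<and> slot h' = slot h) = h"
        using that slot(2) by (intro some_equality) auto
      with that show ?thesis
        unfolding el_def by auto
    qed
    have el_closed: "el i \<in> carrier H" for i
      using someI_ex[of "\<lambda>h. h \<in> carrier H \<and> F h = g \<and> slot h = i"] unfolding el_def by auto
    have "\<exists>b<N. \<forall>i<k. (act b i = 1 \<longleftrightarrow> (\<exists>h\<in>carrier H. F h = g \<and> slot h = i)) \<and>
        (\<forall>t<length u. stp b i t = (wd (el i) t, slot (el i \<otimes>\<^bsub>H\<^esub> u ! t)))"
      using wd(1) el_closed slot(1) ut by (intro tables) auto
    then obtain b where b: "b < N"
      "\<And>i. i < k \<Longrightarrow> act b i = 1 \<longleftrightarrow> (\<exists>h\<in>carrier H. F h = g \<and> slot h = i)"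
      "\<And>i t. i < k \<Longrightarrow> t < length u \<Longrightarrow> stp b i t = (wd (el i) t, slot (el i \<otimes>\<^bsub>H\<^esub> u ! t))"
      by blast
    obtain z where z: "z < a ^ k" "\<And>i. i < k \<Longrightarrow> z div a ^ i mod a = y (el i)"
      using exists_digits[of k "\<lambda>i. y (el i)" a] y_less el_closed by auto
    define x where "x = b + N * z"
    have "x < N * (z + 1)"
      using b(1) by (simp add: x_def)
    also have "\<dots> \<le> N * a ^ k"
      using z(1) by (intro mult_le_mono2) simp
    finally have "x < N * a ^ k" .
    moreover have x: "x mod N = b" "x div N = z"
      using b(1) by (simp_all add: x_def)
    moreover have "letter_at N a x (slot h) = y h \<and>
        (\<forall>t<length u. stp b (slot h) t = (wd h t, slot (h \<otimes>\<^bsub>H\<^esub> u ! t)))"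
      if "h \<in> carrier H" "F h = g" for h
      using z(2)[OF slot(1)[OF that(1)]] b(3)[OF slot(1)[OF that(1)]] el[OF that]
      by (simp add: letter_at_def x)
    ultimately show ?thesis
      using b(2) by (intro exI[of _ x]) auto
  qed
  then obtain \<sigma>' where \<sigma>'_less: "\<And>g. \<sigma>' g < N * a ^ k"
    and \<sigma>'_act: "\<And>g i. i < k \<Longrightarrow> act (\<sigma>' g mod N) i = 1 \<longleftrightarrow> (\<exists>h\<in>carrier H. F h = g \<and> slot h = i)"
    and \<sigma>'_letter: "\<And>h. h \<in> carrier H \<Longrightarrow> letter_at N a (\<sigma>' (F h)) (slot h) = y h"
    and \<sigma>'_stp: "\<And>h t. h \<in> carrier H \<Longrightarrow> t < length u \<Longrightarrow>
      stp (\<sigma>' (F h) mod N) (slot h) t = (wd h t, slot (h \<otimes>\<^bsub>H\<^esub> u ! t))"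
    by metis
  define \<sigma> where "\<sigma> = restrict \<sigma>' (carrier G)"
  have \<sigma>: "\<sigma> g = \<sigma>' g" if "g \<in> carrier G" for g
    using that by (simp add: \<sigma>_def)
  define \<tau> where "\<tau> = (\<lambda>g v. view G s \<sigma> g v mod N)"
  have \<tau>: "\<tau> g v = \<sigma>' (g \<otimes>\<^bsub>G\<^esub> word_value G s v) mod N"
    if "g \<in> carrier G" "set v \<subseteq> {..<length s}" for g v
    using that s by (simp add: \<tau>_def view_def \<sigma>)
  \<comment> \<open>The invariant of a walk: it stands at position \<open>F h\<close> in the slot of
    \<open>h\<close>, and reading a word \<open>w\<close> carries it to
    \<open>h \<otimes> w\<close>.\<close>
  have walk_from: "\<exists>v'. walk (\<tau> g) w (v, slot h) = (v', slot (h \<otimes>\<^bsub>H\<^esub> word_value H u w)) \<and>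
      set v' \<subseteq> {..<length s} \<and> g \<otimes>\<^bsub>G\<^esub> word_value G s v' = F (h \<otimes>\<^bsub>H\<^esub> word_value H u w)"
    if "g \<in> carrier G" "set v \<subseteq> {..<length s}" "h \<in> carrier H" "g \<otimes>\<^bsub>G\<^esub> word_value G s v = F h"
      "set w \<subseteq> {..<length u}" for g v h w
    using that(2-5)
  proof (induction w arbitrary: v h)
    case (Cons t w)
    have t: "t < length u" and w: "set w \<subseteq> {..<length u}"
      using Cons.prems by auto
    have wdD: "set (wd h t) \<subseteq> {..<length s}"
      using D(1) wd(1) Cons.prems(2) t by blast
    have "step (\<tau> g) t (v, slot h) = (v @ wd h t, slot (h \<otimes>\<^bsub>H\<^esub> u ! t))"
      using \<sigma>'_stp[OF Cons.prems(2) t] Cons.prems(1,3) that(1) by (simp add: step_def \<tau>)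
    moreover have "\<exists>v'. walk (\<tau> g) w (v @ wd h t, slot (h \<otimes>\<^bsub>H\<^esub> u ! t)) =
        (v', slot (h \<otimes>\<^bsub>H\<^esub> u ! t \<otimes>\<^bsub>H\<^esub> word_value H u w)) \<and> set v' \<subseteq> {..<length s} \<and>
        g \<otimes>\<^bsub>G\<^esub> word_value G s v' = F (h \<otimes>\<^bsub>H\<^esub> u ! t \<otimes>\<^bsub>H\<^esub> word_value H u w)"
    proof (rule Cons.IH)
      have "g \<otimes>\<^bsub>G\<^esub> word_value G s (v @ wd h t) = F h \<otimes>\<^bsub>G\<^esub> word_value G s (wd h t)"
        using Cons.prems(1) wdD s that(1)
        by (simp add: G.word_value_append G.m_assoc flip: Cons.prems(3))
      then show "g \<otimes>\<^bsub>G\<^esub> word_value G s (v @ wd h t) = F (h \<otimes>\<^bsub>H\<^esub> u ! t)"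
        using wd(2)[OF Cons.prems(2) t] by simp
    qed (use Cons.prems(1,2) wdD ut[OF t] w in auto)
    ultimately show ?case
      using Cons.prems(2) ut[OF t] w u_subset by (simp add: H.m_assoc)
  qed auto
  have walk_start: "\<exists>v'. walk (\<tau> (F h)) w ([], slot h) = (v', slot (h \<otimes>\<^bsub>H\<^esub> word_value H u w)) \<and>
      set v' \<subseteq> {..<length s} \<and> F h \<otimes>\<^bsub>G\<^esub> word_value G s v' = F (h \<otimes>\<^bsub>H\<^esub> word_value H u w)"
    if "h \<in> carrier H" "set w \<subseteq> {..<length u}" for h w
    using that F by (intro walk_from) auto
  have valid: "valid_base (length u) C (\<lambda>v. word_value G s v = \<one>\<^bsub>G\<^esub>) rels (\<tau> g)"
    if g: "g \<in> carrier G" for g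
    unfolding valid_base_def
  proof (intro conjI allI impI ballI)
    obtain c h where c: "c \<in> C" "h \<in> carrier H" "F h = g \<otimes>\<^bsub>G\<^esub> word_value G s c"
      using C(2)[OF g] by blast
    then have "act (\<tau> g c) (slot h) = 1"
      using \<sigma>'_act[OF slot(1)[OF c(2)]] g C(1) by (auto simp: \<tau>)
    with c slot(1) show "\<exists>c\<in>C. \<exists>i<k. act (\<tau> g c) i = 1"
      by blast
  next
    fix i t
    assume i: "i < k" "act (\<tau> g []) i = 1" and t: "t < length u"
    then obtain h where h: "h \<in> carrier H" "F h = g" "slot h = i"
      using g \<sigma>'_act by (auto simp: \<tau>)
    obtain v' where v': "walk (\<tau> g) [t] ([], i) = (v', slot (h \<otimes>\<^bsub>H\<^esub> u ! t))"
        "set v' \<subseteq> {..<length s}" "g \<otimes>\<^bsub>G\<^esub> word_value G s v' = F (h \<otimes>\<^bsub>H\<^esub> u ! t)"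
      using walk_start[of h "[t]"] h t ut[OF t] by auto
    have "h \<otimes>\<^bsub>H\<^esub> u ! t \<in> carrier H"
      using h(1) ut[OF t] by simp
    then have "slot (h \<otimes>\<^bsub>H\<^esub> u ! t) < k \<and> act (\<tau> g v') (slot (h \<otimes>\<^bsub>H\<^esub> u ! t)) = 1"
      using \<sigma>'_act slot(1) v' g by (auto simp: \<tau>)
    then show "case walk (\<tau> g) [t] ([], i) of (v, j) \<Rightarrow> j < k \<and> act (\<tau> g v) j = 1"
      unfolding v'(1) by simp
  next
    fix i r
    assume i: "i < k" "act (\<tau> g []) i = 1" and r: "r \<in> rels"
    then obtain h where h: "h \<in> carrier H" "F h = g" "slot h = i"
      using g \<sigma>'_act by (auto simp: \<tau>)
    obtain v' where v': "walk (\<tau> g) r ([], i) = (v', i)"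
        "set v' \<subseteq> {..<length s}" "g \<otimes>\<^bsub>G\<^esub> word_value G s v' = g"
      using walk_start[of h r] h rels[OF r] by auto
    \<comment> \<open>A relator brings \<open>h\<close> back to itself, hence its position back to
      \<open>g\<close>; left cancellation shows that the displacement is trivial.\<close>
    then have "word_value G s v' = \<one>\<^bsub>G\<^esub>"
      using g s by (metis G.l_cancel_one' G.word_value_closed)
    then show "case walk (\<tau> g) r ([], i) of (v, j) \<Rightarrow> word_value G s v = \<one>\<^bsub>G\<^esub> \<and> j = i"
      unfolding v'(1) by simp
  qed
  have pattern: "\<not> (\<forall>(w, c)\<in>set p. case walk (\<tau> g) w ([], i) of
      (v, j) \<Rightarrow> letter_at N a (\<sigma> (g \<otimes>\<^bsub>G\<^esub> word_value G s v)) j = c)"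
    if g: "g \<in> carrier G" and i: "i < k" "act (\<sigma> g mod N) i = 1" and p: "p \<in> set ps" for g i p
  proof
    assume match: "\<forall>(w, c)\<in>set p. case walk (\<tau> g) w ([], i) of
      (v, j) \<Rightarrow> letter_at N a (\<sigma> (g \<otimes>\<^bsub>G\<^esub> word_value G s v)) j = c"
    obtain h where h: "h \<in> carrier H" "F h = g" "slot h = i"
      using g i \<sigma>'_act by (auto simp: \<sigma>)
    have "view H u y h w = c" if wc: "(w, c) \<in> set p" for w c
    proof -
      have w: "set w \<subseteq> {..<length u}"
        using wc p ps unfolding coded_patterns_def by blast
      have hw: "h \<otimes>\<^bsub>H\<^esub> word_value H u w \<in> carrier H"
        using h(1) w u_subset by simp
      obtain v' where v': "walk (\<tau> g) w ([], i) = (v', slot (h \<otimes>\<^bsub>H\<^esub> word_value H u w))"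
          "set v' \<subseteq> {..<length s}" "g \<otimes>\<^bsub>G\<^esub> word_value G s v' = F (h \<otimes>\<^bsub>H\<^esub> word_value H u w)"
        using walk_start[OF h(1) w] h by auto
      have "letter_at N a (\<sigma> (g \<otimes>\<^bsub>G\<^esub> word_value G s v')) (slot (h \<otimes>\<^bsub>H\<^esub> word_value H u w)) = c"
        using match wc v'(1) by fastforce
      then show ?thesis
        using \<sigma>'_letter[OF hw] F[OF hw] w by (simp add: v'(3) \<sigma> view_def)
    qed
    with avoids[OF h(1) p] show False
      by (auto simp: matches_def)
  qed
  have "\<sigma> \<in> carrier G \<rightarrow>\<^sub>E {..<N * a ^ k}"
    using \<sigma>'_less by (auto simp: \<sigma>_def)
  with valid pattern have "\<sigma> \<in> subshift G {..<N * a ^ k} (decoded_patterns G s (snd (reduction P0 (a, ps))))"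
    unfolding mem_simulating_subshift_iff \<tau>_def by blast
  then show ?thesis
    by blast
qed

lemma decidable_transfer:
  assumes "decidable_domino_problem_wrt G s"
  shows "decidable_domino_problem_wrt H u"
proof -
  obtain hG where hG: "recursive 1 hG" "\<And>I. I \<in> domino_instances (length s) \<Longrightarrow> hG [enc I] =
      (if subshift G {..<fst I} (decoded_patterns G s (snd I)) = {} then 1 else 0)"
    using assms unfolding decidable_domino_problem_wrt_def domino_code_eq_enc by fastforce
  obtain hr where hr: "recursive 1 hr" "\<And>I. hr [enc I] = enc (reduction P0 I)"
    using computable_recursive[OF computable_reduction] by blast
  have "recursive 1 (\<lambda>xs. hG (map (\<lambda>f. f xs) [hr]))"
    using hG(1) hr(1) by (intro recursive.comp) auto
  moreover have "hG [hr [enc (a, ps)]] =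
      (if subshift H {..<a} (decoded_patterns H u ps) = {} then 1 else 0)"
    if "(a, ps) \<in> domino_instances (length u)" for a ps
  proof -
    have ps: "set ps \<subseteq> coded_patterns (length u) a"
      using that by (simp add: domino_instances_iff)
    have "fst (reduction P0 (a, ps)) = N * a ^ k"
      by (simp add: reduction_def)
    moreover have "subshift G {..<N * a ^ k} (decoded_patterns G s (snd (reduction P0 (a, ps)))) = {} \<longleftrightarrow>
        subshift H {..<a} (decoded_patterns H u ps) = {}"
      using simulated_configuration[OF ps] simulating_configuration[OF ps] by blast
    ultimately show ?thesis
      using hG(2)[OF reduction_coded[OF P0(1)], of "(a, ps)"] hr(2) by simp
  qed
  ultimately show ?thesis
    unfolding decidable_domino_problem_wrt_def domino_code_eq_enc
    by (intro exI[of _ "\<lambda>xs. hG (map (\<lambda>f. f xs) [hr])"]) (auto split: if_splits)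
qed

end

text \<open>The map goes from the simulated group \<open>H\<close> to the simulating group
  \<open>G\<close>. The generators of \<open>G\<close> are those for which decidability is given;
  those of \<open>H\<close> come from its presentation, which is allowed because decidability asks
  for some symmetric generating list.\<close>

lemma decidable_domino_coarse_equivalence:
  fixes G :: "('a, 'm) monoid_scheme" and H :: "('b, 'k) monoid_scheme"
  assumes "group G" "group H" "finitely_presented H" "coarse_equivalence H G F"
    and "decidable_domino_problem G"
  shows "decidable_domino_problem H"
proof -
  interpret G: group G by fact
  interpret H: group H by fact
  obtain s where gens: "generating_set G (set s)" "\<forall>x\<in>set s. inv\<^bsub>G\<^esub> x \<in> set s"
    "decidable_domino_problem_wrt G s"
    using assms(5) by (auto simp: decidable_domino_problem_def)
  have s': "set s \<subseteq> carrier G"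
    using gens(1) by (simp add: generating_set_def)
  obtain u rels where u: "generating_set H (set u)" "\<forall>x\<in>set u. inv\<^bsub>H\<^esub> x \<in> set u"
    and rels: "finite rels" "\<And>r. r \<in> rels \<Longrightarrow> set r \<subseteq> {..<length u}"
      "\<And>r. r \<in> rels \<Longrightarrow> word_value H u r = \<one>\<^bsub>H\<^esub>"
    and action: "\<And>(\<Omega> :: ('a \<times> nat) set) \<phi> v w p. \<lbrakk>\<And>t. t < length u \<Longrightarrow> \<phi> t \<in> \<Omega> \<rightarrow> \<Omega>;
        \<And>r p. r \<in> rels \<Longrightarrow> p \<in> \<Omega> \<Longrightarrow> fold \<phi> r p = p;
        set v \<subseteq> {..<length u}; set w \<subseteq> {..<length u}; word_value H u v = word_value H u w;
        p \<in> \<Omega>\<rbrakk> \<Longrightarrow> fold \<phi> v p = fold \<phi> w p"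
  proof (rule finitely_presented_action[OF assms(2,3), where ?'c = "'a \<times> nat"], goal_cases)
    case (1 u rels)
    show ?case
      by (rule 1(1)[OF 1(2-7)])
  qed
  have u': "set u \<subseteq> carrier H"
    using u(1) by (simp add: generating_set_def)
  have F: "F h \<in> carrier G" if "h \<in> carrier H" for h
    using assms(4) that by (auto simp: coarse_equivalence_def)
  have up: "uniformly_close H G (carrier H) (\<lambda>h. h) F"
    and low: "uniformly_close G H (carrier H) F (\<lambda>h. h)"
    using assms(4) by (auto simp: coarse_equivalence_def)
  obtain word where word: "\<And>g. g \<in> carrier G \<Longrightarrow> set (word g) \<subseteq> {..<length s}"
      "\<And>g. g \<in> carrier G \<Longrightarrow> word_value G s (word g) = g"
    using G.word_exists[OF gens(1,2)] by metis
  obtain E where E: "finite E" "\<And>h h'. \<lbrakk>h \<in> carrier H; h' \<in> carrier H; inv\<^bsub>H\<^esub> h \<otimes>\<^bsub>H\<^esub> h' \<in> set u\<rbrakk> \<Longrightarrow>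
      inv\<^bsub>G\<^esub> (F h) \<otimes>\<^bsub>G\<^esub> F h' \<in> E"
    using up[unfolded uniformly_close_def, rule_format, of "set u"] by auto
  \<comment> \<open>Words for the bounded displacements caused by one generator of \<open>H\<close>;
    the empty word keeps \<open>D\<close> nonempty.\<close>
  define D where "D = insert [] (word ` (E \<inter> carrier G))"
  have D: "finite D" "D \<noteq> {}" "\<And>v. v \<in> D \<Longrightarrow> set v \<subseteq> {..<length s}"
    using E(1) word(1) by (auto simp: D_def)
  have D': "\<exists>v\<in>D. F (h \<otimes>\<^bsub>H\<^esub> u ! t) = F h \<otimes>\<^bsub>G\<^esub> word_value G s v"
    if h: "h \<in> carrier H" and t: "t < length u" for h t
  proof
    have ut: "u ! t \<in> carrier H"
      using t u' nth_mem by blast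
    define d where "d = inv\<^bsub>G\<^esub> (F h) \<otimes>\<^bsub>G\<^esub> F (h \<otimes>\<^bsub>H\<^esub> u ! t)"
    have d: "d \<in> carrier G"
      using h ut F by (simp add: d_def)
    have "inv\<^bsub>H\<^esub> h \<otimes>\<^bsub>H\<^esub> (h \<otimes>\<^bsub>H\<^esub> u ! t) = u ! t"
      using h ut by (rule H.mult_inv_cancel)
    then have "d \<in> E"
      unfolding d_def using h ut t by (intro E(2)) auto
    then show "word d \<in> D"
      using d by (simp add: D_def)
    show "F (h \<otimes>\<^bsub>H\<^esub> u ! t) = F h \<otimes>\<^bsub>G\<^esub> word_value G s (word d)"
      using h ut F by (simp add: word(2)[OF d]) (simp add: d_def G.mult_inv_cancel)
  qed
  obtain B where B: "finite B" "\<And>g. g \<in> carrier G \<Longrightarrow> \<exists>h\<in>carrier H. inv\<^bsub>G\<^esub> (F h) \<otimes>\<^bsub>G\<^esub> g \<in> B"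
    using assms(4) by (auto simp: coarse_equivalence_def)
  \<comment> \<open>Elements of \<open>B\<close> lead from a point of the image to \<open>g\<close>;
    the views look from \<open>g\<close> towards the image, hence the inverses.\<close>
  define C where "C = (\<lambda>b. word (inv\<^bsub>G\<^esub> b)) ` (B \<inter> carrier G)"
  have C: "finite C" "\<And>v. v \<in> C \<Longrightarrow> set v \<subseteq> {..<length s}"
    using B(1) word(1) by (auto simp: C_def)
  have C': "\<exists>c\<in>C. \<exists>h\<in>carrier H. F h = g \<otimes>\<^bsub>G\<^esub> word_value G s c" if g: "g \<in> carrier G" for g
  proof -
    obtain h where h: "h \<in> carrier H" "inv\<^bsub>G\<^esub> (F h) \<otimes>\<^bsub>G\<^esub> g \<in> B"
      using B(2)[OF g] by blast
    define b where "b = inv\<^bsub>G\<^esub> (F h) \<otimes>\<^bsub>G\<^esub> g"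
    have b: "b \<in> B \<inter> carrier G"
      using h g F by (simp add: b_def)
    then have "F h = g \<otimes>\<^bsub>G\<^esub> word_value G s (word (inv\<^bsub>G\<^esub> b))"
      using h(1) g F by (simp add: word(2)) (simp add: b_def G.inv_mult_group G.mult_inv_cancel)
    with b h(1) show ?thesis
      by (auto simp: C_def)
  qed
  \<comment> \<open>Elements with the same image have displacement \<open>\<one>\<close> in
    \<open>G\<close>, so the lower bound confines the displacements within a fibre to a finite set,
    whose size is the number of slots.\<close>
  obtain K where K: "finite K" "\<And>h h'. \<lbrakk>h \<in> carrier H; h' \<in> carrier H; F h = F h'\<rbrakk> \<Longrightarrow>
      inv\<^bsub>H\<^esub> h \<otimes>\<^bsub>H\<^esub> h' \<in> K"
    using low[unfolded uniformly_close_def, rule_format, of "{\<one>\<^bsub>G\<^esub>}"] F by auto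
  obtain e where e: "bij_betw e K {0..<card K}"
    using ex_bij_betw_finite_nat[OF K(1)] by blast
  have "\<one>\<^bsub>H\<^esub> \<in> K"
    using K(2)[of "\<one>\<^bsub>H\<^esub>" "\<one>\<^bsub>H\<^esub>"] by simp
  then have k: "card K > 0"
    using K(1) by (auto simp: card_gt_0_iff)
  define rep where "rep = (\<lambda>g. SOME h. h \<in> carrier H \<and> F h = g)"
  have rep: "rep (F h) \<in> carrier H" "F (rep (F h)) = F h" if "h \<in> carrier H" for h
    using someI_ex[of "\<lambda>h'. h' \<in> carrier H \<and> F h' = F h"] that by (auto simp: rep_def)
  \<comment> \<open>Slots number the displacements from a chosen representative of the fibre; this
    separates the elements of each fibre.\<close>
  define slot where "slot = (\<lambda>h. e (inv\<^bsub>H\<^esub> (rep (F h)) \<otimes>\<^bsub>H\<^esub> h))"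
  have in_K: "inv\<^bsub>H\<^esub> (rep (F h)) \<otimes>\<^bsub>H\<^esub> h \<in> K" if "h \<in> carrier H" for h
    using rep[OF that] that by (intro K(2))
  have slot_less: "slot h < card K" if "h \<in> carrier H" for h
    using bij_betwE[OF e] in_K[OF that] by (auto simp: slot_def)
  have slot_inj: "h = h'"
    if "h \<in> carrier H" "h' \<in> carrier H" "F h = F h'" "slot h = slot h'" for h h'
  proof -
    have "inv\<^bsub>H\<^esub> (rep (F h)) \<otimes>\<^bsub>H\<^esub> h = inv\<^bsub>H\<^esub> (rep (F h')) \<otimes>\<^bsub>H\<^esub> h'"
    proof (rule inj_onD)
      show "inj_on e K"
        using e by (simp add: bij_betw_def)
    qed (use that(4) in_K[OF that(1)] in_K[OF that(2)] in \<open>simp_all only: slot_def\<close>)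
    then show ?thesis
      using that rep by simp
  qed
  obtain N act stp where slots: "slot_tables (length s) N act stp"
    and tables: "\<And>X M. \<lbrakk>\<And>i t. i < card K \<Longrightarrow> t < length u \<Longrightarrow> M i t \<in> D \<times> {..<card K}\<rbrakk> \<Longrightarrow>
      \<exists>b<N. \<forall>i<card K. (act b i = 1 \<longleftrightarrow> X i) \<and> (\<forall>t<length u. stp b i t = M i t)"
  proof (rule exists_slot_tables[OF D k, where m = "length u"], goal_cases)
    case (2 N act stp)
    show ?case
      by (rule 2(1)[OF 2(2,3)])
  qed
  interpret slot_tables "length s" "card K" N act stp
    by (rule slots)
  obtain P0 where P0: "set P0 \<subseteq> coded_patterns (length s) N"
    "\<And>\<tau>. (\<And>v. \<tau> v < N) \<Longrightarrow> (\<exists>q\<in>set P0. matches \<tau> q) \<longleftrightarrow>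
      \<not> valid_base (length u) C (\<lambda>v. word_value G s v = \<one>\<^bsub>G\<^esub>) rels \<tau>"
  proof (rule valid_base_patterns[OF C rels(1), where m = "length u"
        and trivial = "\<lambda>v. word_value G s v = \<one>\<^bsub>G\<^esub>"], goal_cases)
    case (2 P0)
    show ?case
      by (rule 2(1)[OF 2(2,3)])
  qed
  interpret simulation G H s u "card K" N act stp F slot D C rels P0
    by unfold_locales (fact s' u rels action F slot_less slot_inj D D' C C' tables P0)+
  show ?thesis
    unfolding decidable_domino_problem_def using u decidable_transfer[OF gens(3)] by blast
qed

theorem theorem1p9:
  fixes G :: "('a, 'm) monoid_scheme" and H :: "('b, 'k) monoid_scheme"
  assumes "group G" and "group H"
    and "finitely_presented G" and "finitely_presented H"
    and "quasi_isometric_groups G H"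
  shows "decidable_domino_problem G \<longleftrightarrow> decidable_domino_problem H"
proof -
  obtain f where f: "coarse_equivalence G H f"
    using quasi_isometric_coarse_equivalence[OF assms(1,2,5)] by blast
  \<comment> \<open>Transferring decidability from \<open>G\<close> to \<open>H\<close> needs a map
    into \<open>G\<close>, hence the coarse inverse; \<open>f\<close> itself serves the
    converse.\<close>
  obtain f' where f': "coarse_equivalence H G f'"
    using coarse_equivalence_inverse[OF assms(1,2) f] by blast
  show ?thesis
    using decidable_domino_coarse_equivalence[OF assms(1,2,4) f']
      decidable_domino_coarse_equivalence[OF assms(2,1,3) f] by blast
qed

end
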